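(* Let $E$ be a complex Banach space, and let $A\in\mathcal{P}(\theta_{A})$ and $B\in\mathcal{P}(\theta_{B})$ be resolvent commuting operators in $E$ with $\theta_{A}>\theta_{B}$ and $\theta_{A}+\theta_{B}>\pi$. Then the operator $A+B$ with domain $\mathcal{D}(A+B)=\mathcal{D}(A)\cap\mathcal{D}(B)$ is closable, and for every $y\in E$ the equation \[ \overline{(A+B)}\,x=y \] has a unique solution $x$; it satisfies \[ x\in\bigcap_{0<\theta<1}\big((E,\mathcal{D}(A))_{\theta,q}\cap(E,\mathcal{D}(B))_{\theta,q}\big)\quad\text{for every } q\in[1,\infty), \] and it is given by \[ x=\frac{1}{2\pi i}\int_{\Gamma_{\theta_{B}}}(A-z)^{-1}(B+z)^{-1}y\,dz. \] If \[ y\in\bigcup_{0<\theta<1}\big((E,\mathcal{D}(A))_{\theta,p}\cup(E,\mathcal{D}(B))_{\theta,p}\big) \] for some $p\in[1,\infty)$, then $x\in\mathcal{D}(A)\cap\mathcal{D}(B)$. Moreover, if $A$ admits a bounded $H^{e,\infty}_{\mathcal{L}(E)}(\theta_{A})$-calculus, then $x\in\mathcal{D}(A)\cap\mathcal{D}(B)$ for every $y\in E$, and $\overline{(A+B)}=A+B$ (i.e. $A+B$ is closed).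
   Context: Sectorial operators: for $K\geq 1$ and $\theta\in[0,\pi)$, $\mathcal{P}_{K}(\theta)$ is the class of closed linear operators $A$ in $E$ such that \[ S_{\theta}=\{z\in\mathbb{C}\mid |\arg z|\leq\theta\}\cup\{0\}\subset\rho(-A)\quad\text{and}\quad (1+|z|)\,\|(A+z)^{-1}\|\leq K\quad\text{for all } z\in S_{\theta}, \] where $\rho$ denotes the resolvent set. Put $\mathcal{P}(\theta)=\bigcup_{K\ge 1}\mathcal{P}_{K}(\theta)$. Paths: for $\rho\geq 0$ and $\theta\in(0,\pi)$, $\Gamma_{\rho,\theta}$ is the positively oriented path $\{\rho e^{i\phi}\mid\theta\leq\phi\leq2\pi-\theta\}\cup\{re^{\pm i\theta}\mid r\geq\rho\}$, i.e. it runs from $\infty e^{-i\theta}$ to $\infty e^{i\theta}$; $\Gamma_{\theta}=\Gamma_{0,\theta}$. If $A\in\mathcal P(0)$, then $A\in\mathcal{P}(\theta)$ for some $\theta>0$, so the angle of an operator in $\mathcal{P}(\theta)$ is always taken to be positive. Resolvent commuting: two closed linear operators $A,B$ in $E$ are resolvent commuting if there exist $\lambda\in\rho(-A)$ and $\mu\in\rho(-B)$ such that $(A+\lambda)^{-1}$ and $(B+\mu)^{-1}$ commute. Interpolation: $(E,\mathcal{D}(A))_{\theta,q}$ is the real interpolation space between $E$ and $\mathcal{D}(A)$, the latter with the graph norm. $\overline{(A+B)}$ is the closure of $A+B$. Calculus: let $A\in\mathcal{P}(\theta)$ with $\theta>\pi/2$. $H^{e,\infty}_{\mathcal{L}(E)}(\theta)$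 is the space of all bounded holomorphic functions $f:\mathbb{C}\setminus S_{\theta}\to\mathcal{L}(E)$ such that $f(\lambda)$ and $(A+z)^{-1}$ commute for all $\lambda\in\mathbb{C}\setminus S_{\theta}$ and $z\in S_{\theta}$, and \[ \|f(\lambda)\|_{\mathcal{L}(E)}\leq c\,\frac{|\lambda|}{1+|\lambda|}\,e^{-\delta|\lambda|}\quad\text{for all }\lambda\in\mathbb{C}\setminus S_{\theta}, \] for some $c,\delta>0$ depending on $f$. Such $f$ is extended to $\partial S_{\theta}$ by its non-tangential boundary values and defines $f(-A)\in\mathcal{L}(E)$ by \[ f(-A)=\frac{1}{2\pi i}\int_{\Gamma_{\theta}}f(\lambda)(A+\lambda)^{-1}\,d\lambda . \] $A$ admits a bounded $H^{e,\infty}_{\mathcal{L}(E)}(\theta)$-calculus if there is a constant $C_{A}$, independent of $f$, with $\|f(-A)\|_{\mathcal{L}(E)}\leq C_{A}\|f\|_{\infty}$ for all $f\in H^{e,\infty}_{\mathcal{L}(E)}(\theta)$, where $\|f\|_{\infty}=\sup_{\lambda\in\mathbb{C}\setminus S_{\theta}}\|f(\lambda)\|_{\mathcal{L}(E)}$.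
   Formalization: The formal theorem additionally assumes that D(A)+D(B) is dense in E; without it the claim fails, e.g. in the space c of convergent sequences with A, B multiplication by n and n(2+(-1)^n), where y=(1,1,...) admits no solution. *)

theory Defs
  imports "HOL-Analysis.Analysis"
begin

(* Complex Banach spaces: HOL-Analysis has real Banach spaces only, so the complex scalar
   multiplication is added on top of class banach, compatibly with the real one. *)
class complex_banach = banach +
  fixes scaleC :: "complex \<Rightarrow> 'a \<Rightarrow> 'a"  (infixr "*\<^sub>C" 75)
  assumes scaleC_add_right: "c *\<^sub>C (x + y) = c *\<^sub>C x + c *\<^sub>C y"
    and scaleC_add_left: "(c + d) *\<^sub>C x = c *\<^sub>C x + d *\<^sub>C x"
    and scaleC_scaleC: "c *\<^sub>C d *\<^sub>C x = (c * d) *\<^sub>C x"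
    and scaleC_of_real: "complex_of_real r *\<^sub>C x = r *\<^sub>R x"
    and norm_scaleC: "norm (c *\<^sub>C x) = cmod c * norm x"

instantiation complex :: complex_banach
begin

definition scaleC_complex :: "complex \<Rightarrow> complex \<Rightarrow> complex" where
  "scaleC_complex c x = c * x"

instance
  by standard (auto simp: scaleC_complex_def algebra_simps norm_mult scaleR_conv_of_real)

end

lemma bounded_linear_scaleC: "bounded_linear (\<lambda>x. c *\<^sub>C (x :: 'a :: complex_banach))"
proof (rule bounded_linear_intro[where K = "cmod c"])
  fix r :: real and x :: 'a
  show "c *\<^sub>C (r *\<^sub>R x) = r *\<^sub>R (c *\<^sub>C x)"
    by (simp add: scaleC_scaleC mult.commute flip: scaleC_of_real)
qed (simp_all add: scaleC_add_right norm_scaleC mult.commute)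

(* The complex scalar multiplication of bounded operators acts on the values. *)
instantiation blinfun :: (real_normed_vector, complex_banach) complex_banach
begin

definition scaleC_blinfun :: "complex \<Rightarrow> ('a \<Rightarrow>\<^sub>L 'b) \<Rightarrow> ('a \<Rightarrow>\<^sub>L 'b)" where
  "scaleC_blinfun c T = Blinfun (\<lambda>x. c *\<^sub>C T x)"

lemma blinfun_apply_scaleC: "blinfun_apply (c *\<^sub>C T) x = c *\<^sub>C T x"
  unfolding scaleC_blinfun_def
  by (subst bounded_linear_Blinfun_apply)
    (auto intro: bounded_linear_compose[OF bounded_linear_scaleC] blinfun.bounded_linear_right)

instance
proof
  fix c d :: complex and r :: real and S T :: "'a \<Rightarrow>\<^sub>L 'b"
  show "c *\<^sub>C (S + T) = c *\<^sub>C S + c *\<^sub>C T"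
    by (rule blinfun_eqI) (simp add: blinfun_apply_scaleC blinfun.add_left scaleC_add_right)
  show "(c + d) *\<^sub>C T = c *\<^sub>C T + d *\<^sub>C T"
    by (rule blinfun_eqI) (simp add: blinfun_apply_scaleC blinfun.add_left scaleC_add_left)
  show "c *\<^sub>C d *\<^sub>C T = (c * d) *\<^sub>C T"
    by (rule blinfun_eqI) (simp add: blinfun_apply_scaleC scaleC_scaleC)
  show "complex_of_real r *\<^sub>C T = r *\<^sub>R T"
    by (rule blinfun_eqI) (simp add: blinfun_apply_scaleC blinfun.scaleR_left scaleC_of_real)
  have le: "norm (a *\<^sub>C U) \<le> cmod a * norm U" for a and U :: "'a \<Rightarrow>\<^sub>L 'b"
    by (rule norm_blinfun_bound)
      (auto simp: blinfun_apply_scaleC norm_scaleC mult.assoc intro!: mult_left_mono norm_blinfun)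
  show "norm (c *\<^sub>C T) = cmod c * norm T"
  proof (cases "c = 0")
    case True
    then show ?thesis using le[of 0 T] by simp
  next
    case False
    have "inverse c *\<^sub>C c *\<^sub>C T = T"
      by (rule blinfun_eqI)
        (simp add: blinfun_apply_scaleC scaleC_scaleC False scaleC_of_real[of 1, simplified])
    then have "norm T \<le> cmod (inverse c) * norm (c *\<^sub>C T)"
      using le[of "inverse c" "c *\<^sub>C T"] by simp
    then have "cmod c * norm T \<le> norm (c *\<^sub>C T)"
      using False by (simp add: norm_inverse divide_simps norm_divide mult.commute)
    then show ?thesis using le[of c T] by simp
  qed
qed

end

(* The complex-linear members of the type of bounded real-linear maps. *)
definition L_space :: "('a :: complex_banach \<Rightarrow>\<^sub>L 'a) set" where
  "L_space = {T. \<forall>c x. blinfun_apply T (c *\<^sub>C x) = c *\<^sub>C blinfun_apply T x}"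


section \<open>Unbounded operators\<close>

(* An operator in E is identified with its graph: (x, y) is a member of A iff x lies in the
   domain of A and A x = y.  Its domain is Domain A. *)
type_synonym 'a op = "('a \<times> 'a) set"

definition linear_op :: "'a :: complex_banach op \<Rightarrow> bool" where
  "linear_op A \<longleftrightarrow> single_valued A \<and> (0, 0) \<in> A \<and>
     (\<forall>x y x' y'. (x, y) \<in> A \<longrightarrow> (x', y') \<in> A \<longrightarrow> (x + x', y + y') \<in> A) \<and>
     (\<forall>c x y. (x, y) \<in> A \<longrightarrow> (c *\<^sub>C x, c *\<^sub>C y) \<in> A)"

definition closed_op :: "'a :: complex_banach op \<Rightarrow> bool" where
  "closed_op A \<longleftrightarrow> linear_op A \<and> closed A"

(* A is closable iff the closure of its graph is again the graph of a linear operator, which is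
   then the closure of A. *)
definition closable_op :: "'a :: complex_banach op \<Rightarrow> bool" where
  "closable_op A \<longleftrightarrow> linear_op A \<and> linear_op (closure A)"

definition op_add :: "'a :: complex_banach op \<Rightarrow> 'a op \<Rightarrow> 'a op" where
  "op_add A B = {(x, y + z) | x y z. (x, y) \<in> A \<and> (x, z) \<in> B}"

lemma Domain_op_add: "Domain (op_add A B) = Domain A \<inter> Domain B"
  by (auto simp: op_add_def)

definition op_uminus :: "'a :: complex_banach op \<Rightarrow> 'a op" where
  "op_uminus A = {(x, - y) | x y. (x, y) \<in> A}"

definition scalar_op :: "complex \<Rightarrow> 'a :: complex_banach op" where
  "scalar_op z = {(x, z *\<^sub>C x) | x. True}"

definition op_graph :: "('a :: complex_banach \<Rightarrow>\<^sub>L 'a) \<Rightarrow> 'a op" where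
  "op_graph T = {(x, blinfun_apply T x) | x. True}"

(* The inverse relation of A is the graph of an everywhere defined bounded operator. *)
definition boundedly_invertible :: "'a :: complex_banach op \<Rightarrow> bool" where
  "boundedly_invertible A \<longleftrightarrow> (\<exists>R. A\<inverse> = op_graph R)"

definition op_inv :: "'a :: complex_banach op \<Rightarrow> 'a \<Rightarrow>\<^sub>L 'a" where
  "op_inv A = (THE R. A\<inverse> = op_graph R)"

lemma op_graph_inject: "op_graph S = op_graph T \<longleftrightarrow> S = T"
proof
  assume eq: "op_graph S = op_graph T"
  show "S = T"
  proof (rule blinfun_eqI)
    fix x
    have "(x, blinfun_apply S x) \<in> op_graph T"
      unfolding eq[symmetric] by (auto simp: op_graph_def)
    then show "blinfun_apply S x = blinfun_apply T x"
      by (simp add: op_graph_def)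
  qed
qed simp

lemma op_inv_eqI: "A\<inverse> = op_graph R \<Longrightarrow> op_inv A = R"
  unfolding op_inv_def by (rule the_equality) (auto simp: op_graph_inject)

definition resolvent_set :: "'a :: complex_banach op \<Rightarrow> complex set" where
  "resolvent_set A = {z. boundedly_invertible (op_add (scalar_op z) (op_uminus A))}"

(* (A + z)^{-1}, meaningful for z in the resolvent set of -A. *)
definition res :: "'a :: complex_banach op \<Rightarrow> complex \<Rightarrow> 'a \<Rightarrow>\<^sub>L 'a" where
  "res A z = op_inv (op_add A (scalar_op z))"

lemma resolvent_set_uminus:
  "resolvent_set (op_uminus A) = {z. boundedly_invertible (op_add A (scalar_op z))}"
proof -
  have "op_add (scalar_op z) (op_uminus (op_uminus A)) = op_add A (scalar_op z)" for z
  proof -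
    have "op_uminus (op_uminus A) = A"
      by (force simp: op_uminus_def)
    moreover have "op_add (scalar_op z) A = op_add A (scalar_op z)"
      unfolding op_add_def by (metis (no_types, opaque_lifting) add.commute)
    ultimately show ?thesis by simp
  qed
  then show ?thesis by (simp add: resolvent_set_def)
qed


section \<open>Sectorial operators\<close>

definition sector :: "real \<Rightarrow> complex set" where
  "sector \<theta> = {z. \<bar>Arg z\<bar> \<le> \<theta>} \<union> {0}"

(* A sectorial operator need not be densely defined.  Without density of D(A) + D(B), which is
   assumed by Da Prato and Grisvard, closure (A + B) x = y may fail to be solvable for some y:
   take densely defined A, B in X whose sum is not closed.  The diagonal operators they induce on
   the space of bounded sequences in X inherit all other hypotheses, with the same constants and
   angles, but by an open mapping argument the range of their sum is not dense. *)
definition sectorial_K :: "real \<Rightarrow> real \<Rightarrow> 'a :: complex_banach op set" where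
  "sectorial_K K \<theta> = {A. closed_op A \<and> sector \<theta> \<subseteq> resolvent_set (op_uminus A) \<and>
     (\<forall>z\<in>sector \<theta>. (1 + cmod z) * norm (res A z) \<le> K)}"

definition sectorial :: "real \<Rightarrow> 'a :: complex_banach op set" where
  "sectorial \<theta> = (\<Union>K\<in>{1..}. sectorial_K K \<theta>)"

definition resolvent_commuting :: "'a :: complex_banach op \<Rightarrow> 'a op \<Rightarrow> bool" where
  "resolvent_commuting A B \<longleftrightarrow>
     (\<exists>\<zeta>\<in>resolvent_set (op_uminus A). \<exists>\<mu>\<in>resolvent_set (op_uminus B).
        res A \<zeta> o\<^sub>L res B \<mu> = res B \<mu> o\<^sub>L res A \<zeta>)"


section \<open>Real interpolation\<close>

(* Peetre's K-functional of the couple (E, D(A)), D(A) with the graph norm. *)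
definition K_functional :: "'a :: complex_banach op \<Rightarrow> real \<Rightarrow> 'a \<Rightarrow> real" where
  "K_functional A t x = (INF (a, b)\<in>A. norm (x - a) + t * (norm a + norm b))"

definition real_interp :: "'a :: complex_banach op \<Rightarrow> real \<Rightarrow> real \<Rightarrow> 'a set" where
  "real_interp A \<theta> q =
     {x. (\<integral>\<^sup>+t\<in>{0<..}. ennreal ((t powr (-\<theta>) * K_functional A t x) powr q / t) \<partial>lborel) < \<infinity>}"


section \<open>Integrals along the boundary of a sector\<close>

(* I is the integral of g along the path from infinity * exp(-i theta) via 0 to
   infinity * exp(i theta).  The gauge integral is used because the Bochner integral of the library
   is restricted to second countable spaces. *)
definition has_Gamma_integral :: "(complex \<Rightarrow> 'a :: complex_banach) \<Rightarrow> 'a \<Rightarrow> real \<Rightarrow> bool" where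
  "has_Gamma_integral g I \<theta> \<longleftrightarrow>
     (\<exists>I\<^sub>1 I\<^sub>2. ((\<lambda>r. cis (-\<theta>) *\<^sub>C g (of_real r * cis (-\<theta>))) has_integral I\<^sub>1) {0..} \<and>
              ((\<lambda>r. cis \<theta> *\<^sub>C g (of_real r * cis \<theta>)) has_integral I\<^sub>2) {0..} \<and>
              I = I\<^sub>2 - I\<^sub>1)"


section \<open>The functional calculus\<close>

definition vholomorphic_on :: "(complex \<Rightarrow> 'a :: complex_banach) \<Rightarrow> complex set \<Rightarrow> bool" where
  "vholomorphic_on f \<Omega> \<longleftrightarrow> (\<forall>z\<in>\<Omega>. \<exists>D. (f has_derivative (\<lambda>h. h *\<^sub>C D)) (at z within \<Omega>))"

definition Hinf_e :: "real \<Rightarrow> 'a :: complex_banach op \<Rightarrow> (complex \<Rightarrow> 'a \<Rightarrow>\<^sub>L 'a) set" where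
  "Hinf_e \<theta> A = {f.
     f ` (- sector \<theta>) \<subseteq> L_space \<and> vholomorphic_on f (- sector \<theta>) \<and> bounded (f ` (- sector \<theta>)) \<and>
     (\<forall>\<zeta>\<in>- sector \<theta>. \<forall>z\<in>sector \<theta>. f \<zeta> o\<^sub>L res A z = res A z o\<^sub>L f \<zeta>) \<and>
     (\<exists>c>0. \<exists>\<delta>>0. \<forall>\<zeta>\<in>- sector \<theta>.
        norm (f \<zeta>) \<le> c * (cmod \<zeta> / (1 + cmod \<zeta>)) * exp (- \<delta> * cmod \<zeta>))}"

(* f tends to l at the boundary point p inside every non-tangential approach region. *)
definition nontangential_limit ::
    "real \<Rightarrow> (complex \<Rightarrow> 'a :: complex_banach) \<Rightarrow> complex \<Rightarrow> 'a \<Rightarrow> bool" where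
  "nontangential_limit \<theta> f p l \<longleftrightarrow>
     (\<forall>k>1. (f \<longlongrightarrow> l) (at p within {z. z \<notin> sector \<theta> \<and> dist z p < k * infdist z (sector \<theta>)}))"

definition boundary_values ::
    "real \<Rightarrow> (complex \<Rightarrow> 'a :: complex_banach) \<Rightarrow> (complex \<Rightarrow> 'a) \<Rightarrow> bool" where
  "boundary_values \<theta> f g \<longleftrightarrow> (\<forall>\<phi>\<in>{\<theta>, -\<theta>}.
     negligible {r. 0 < r \<and> \<not> nontangential_limit \<theta> f (of_real r * cis \<phi>) (g (of_real r * cis \<phi>))})"

(* T = f(-A).  This is a relation, because an operator-valued f may fail to have non-tangential
   boundary values (almost everywhere), in which case f(-A) is not defined. *)
definition has_calculus_value ::
    "real \<Rightarrow> 'a :: complex_banach op \<Rightarrow> (complex \<Rightarrow> 'a \<Rightarrow>\<^sub>L 'a) \<Rightarrow> ('a \<Rightarrow>\<^sub>L 'a) \<Rightarrow> bool" where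
  "has_calculus_value \<theta> A f T \<longleftrightarrow>
     (\<exists>g I. boundary_values \<theta> f g \<and> has_Gamma_integral (\<lambda>\<zeta>. g \<zeta> o\<^sub>L res A \<zeta>) I \<theta> \<and>
        T = (1 / (2 * of_real pi * \<i>)) *\<^sub>C I)"

definition bounded_Hinf_calculus :: "real \<Rightarrow> 'a :: complex_banach op \<Rightarrow> bool" where
  "bounded_Hinf_calculus \<theta> A \<longleftrightarrow>
     (\<exists>C. \<forall>f\<in>Hinf_e \<theta> A. \<forall>T. has_calculus_value \<theta> A f T \<longrightarrow>
        norm T \<le> C * (SUP \<zeta>\<in>- sector \<theta>. norm (f \<zeta>)))"

end

(* Write S for the operator given by the path integral. The resolvent identities turn the integrand
   of S (A^-1 + B^-1) into A^-1 B^-1 ((A - z)^-1 + (B + z)^-1). Rotating the two rays of the path onto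
   the positive real axis for B and onto the negative one for A leaves only circular arcs of total
   angle 2 pi, hence S (A^-1 + B^-1) = A^-1 B^-1. Everything about the closure follows from this
   algebraic identity: S commutes with both resolvents and is injective, (A + B) x = y implies
   x = S y, and S y = A^-1 w implies S y = B^-1 (y - w), so that S y lies in D(A) and D(B) as soon as
   it lies in one of them. By density the closure of A + B is the inverse of S.

   For the calculus, take f(l) = l e^(d l) (B - l)^-1. Its sup norm is bounded uniformly in d > 0, and
   f(-A) A^-1 tends to -S as d tends to 0; the part of f(-A) A^-1 whose integrand does not contain (A + l)^-1 vanishes by
   Cauchy's theorem. This bounds A S on D(A). Since D(A) need not be dense, the bound is carried over to
   B S y = y - A S y for y in D(A) + D(B) by means of m (A + m)^-1, which tends to the identity on
   B S y as m tends to infinity. *)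

theory Submission
  imports Defs
begin

section \<open>Complex scalar multiplication\<close>

text \<open>The argument uses only the bounded operators (A + z)^-1 on closed sectors: D(A) is the
  range of A^-1, so membership in a domain becomes a factorisation through A^-1, and closedness
  becomes continuity of A^-1. The angle \<open>\<phi>\<close> of the path stays free in [pi -
  \<open>\<theta>\<^sub>A\<close>, \<open>\<theta>\<^sub>B\<close>], because two values are needed:
  the solution formula lives at \<open>\<theta>\<^sub>B\<close>, whereas the calculus integrates
  over the path with angle \<open>\<theta>\<^sub>A\<close>, whose reflection has angle pi -
  \<open>\<theta>\<^sub>A\<close>. The latter is acute, since the two angle hypotheses force
  \<open>\<theta>\<^sub>A\<close> > pi/2; hence exp (- d z) decays along it. Single resolvents decay
  only like 1/|z|, so the cancellation between them has to be carried out on truncated paths. In the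
  final estimate y ranges over D(A) + D(B) because B S y then lies in D(A) plus the range of S, and
  m (A + m)^-1 tends to the identity on both.\<close>

lemma bounded_bilinear_scaleC:
  "bounded_bilinear (scaleC :: complex \<Rightarrow> 'b \<Rightarrow> 'b :: complex_banach)"
proof
  fix r :: real and c d :: complex and x y :: 'b
  show "(r *\<^sub>R c) *\<^sub>C x = r *\<^sub>R c *\<^sub>C x"
    by (simp add: scaleR_conv_of_real scaleC_scaleC flip: scaleC_of_real)
  show "c *\<^sub>C r *\<^sub>R x = r *\<^sub>R c *\<^sub>C x"
    by (simp add: scaleC_scaleC mult.commute flip: scaleC_of_real)
  show "\<exists>K. \<forall>(c::complex) x::'b. norm (c *\<^sub>C x) \<le> norm c * norm x * K"
    by (intro exI[of _ 1]) (simp add: norm_scaleC)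
qed (simp_all add: scaleC_add_left scaleC_add_right)

interpretation scaleC: bounded_bilinear "scaleC :: complex \<Rightarrow> 'b \<Rightarrow> 'b :: complex_banach"
  by (rule bounded_bilinear_scaleC)

interpretation blinfun_compose: bounded_bilinear "(o\<^sub>L)"
  by (rule bounded_bilinear_blinfun_compose)

lemmas [continuous_intros] = scaleC.continuous_on blinfun_compose.continuous_on

lemma scaleC_one [simp]: "1 *\<^sub>C (x :: 'b :: complex_banach) = x"
  using scaleC_of_real[of 1 x] by simp

lemma blinfun_compose_scaleC_left: "(c *\<^sub>C S) o\<^sub>L T = c *\<^sub>C (S o\<^sub>L T)"
  by (rule blinfun_eqI) (simp add: blinfun_apply_scaleC)

lemma blinfun_compose_scaleC_right: "S \<in> L_space \<Longrightarrow> S o\<^sub>L (c *\<^sub>C T) = c *\<^sub>C (S o\<^sub>L T)"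
  by (rule blinfun_eqI) (simp add: blinfun_apply_scaleC L_space_def)

lemma blinfun_compose_assoc: "(S o\<^sub>L T) o\<^sub>L U = S o\<^sub>L (T o\<^sub>L U)"
  by (rule blinfun_eqI) simp

lemma L_spaceD: "T \<in> L_space \<Longrightarrow> blinfun_apply T (c *\<^sub>C x) = c *\<^sub>C blinfun_apply T x"
  by (simp add: L_space_def)

lemma scaleC_L_space: "T \<in> L_space \<Longrightarrow> c *\<^sub>C T \<in> L_space"
  by (auto simp: L_space_def blinfun_apply_scaleC scaleC_scaleC mult.commute)


section \<open>Integrals over a half-line\<close>

lemma has_integral_one_plus_powr:
  fixes \<epsilon> :: real
  assumes "0 < \<epsilon>" "0 \<le> a" "a \<le> b"
  shows "((\<lambda>r. C * (1 + r) powr (-1 - \<epsilon>)) has_integral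
           (C / \<epsilon> * (1 + a) powr (-\<epsilon>) - C / \<epsilon> * (1 + b) powr (-\<epsilon>))) {a..b}"
proof -
  have "((\<lambda>r. C * (1 + r) powr (-1 - \<epsilon>)) has_integral
           (- C / \<epsilon> * (1 + b) powr (-\<epsilon>) - - C / \<epsilon> * (1 + a) powr (-\<epsilon>))) {a..b}"
  proof (rule fundamental_theorem_of_calculus)
    fix x assume "x \<in> {a..b}"
    then have "x > -1" using assms by auto
    moreover have "(1 + x) powr (-1 - \<epsilon>) = (1 + x) powr (-\<epsilon>) / (1 + x)"
      using \<open>x > -1\<close> by (simp add: powr_diff powr_minus divide_simps)
    ultimately have "((\<lambda>r. - C / \<epsilon> * (1 + r) powr (-\<epsilon>)) has_real_derivative C * (1 + x) powr (-1 - \<epsilon>))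
        (at x within {a..b})"
      using assms(1) by (auto intro!: derivative_eq_intros simp: field_simps minus_diff_commute)
    then show "((\<lambda>r. - C / \<epsilon> * (1 + r) powr (-\<epsilon>)) has_vector_derivative C * (1 + x) powr (-1 - \<epsilon>))
        (at x within {a..b})"
      by (simp add: has_real_derivative_iff_has_vector_derivative)
  qed (use assms in auto)
  then show ?thesis by (simp add: algebra_simps)
qed

lemma halfline_tail_bound:
  fixes f :: "real \<Rightarrow> 'b :: banach"
  assumes cont: "continuous_on {0..} f" and "0 < \<epsilon>"
    and bound: "\<And>r. 0 \<le> r \<Longrightarrow> norm (f r) \<le> C * (1 + r) powr (-1 - \<epsilon>)"
    and "0 \<le> a" "a \<le> b"
  shows "norm (integral {0..b} f - integral {0..a} f) \<le> C / \<epsilon> * (1 + a) powr (-\<epsilon>)"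
proof -
  have int: "f integrable_on {s..t}" if "0 \<le> s" for s t
    by (rule integrable_continuous_interval) (rule continuous_on_subset[OF cont], use that in auto)
  have "C \<ge> 0" using order_trans[OF norm_ge_zero bound[of 0]] by simp
  have "integral {0..b} f - integral {0..a} f = integral {a..b} f"
    using Henstock_Kurzweil_Integration.integral_combine[of 0 a b f] assms int by (simp add: algebra_simps)
  also have "norm (integral {a..b} f) \<le> integral {a..b} (\<lambda>r. C * (1 + r) powr (-1 - \<epsilon>))"
    by (rule integral_norm_bound_integral)
      (use assms int has_integral_one_plus_powr[of \<epsilon> a b C] in \<open>auto simp: integrable_on_def\<close>)
  also have "\<dots> = C / \<epsilon> * (1 + a) powr (-\<epsilon>) - C / \<epsilon> * (1 + b) powr (-\<epsilon>)"
    using has_integral_one_plus_powr[of \<epsilon> a b C] assms by (intro integral_unique) auto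
  also have "\<dots> \<le> C / \<epsilon> * (1 + a) powr (-\<epsilon>)"
    using \<open>C \<ge> 0\<close> \<open>0 < \<epsilon>\<close> by simp
  finally show ?thesis .
qed

lemma powr_minus_at_top:
  assumes "0 < \<epsilon>"
  shows "((\<lambda>a. c * (1 + a) powr (-\<epsilon>)) \<longlongrightarrow> (0::real)) at_top"
proof -
  have "filterlim (\<lambda>a::real. 1 + a) at_top at_top"
    by (rule filterlim_tendsto_add_at_top[OF tendsto_const filterlim_ident])
  then have "((\<lambda>a. (1 + a) powr (-\<epsilon>)) \<longlongrightarrow> (0::real)) at_top"
    by (rule tendsto_neg_powr[rotated]) (use assms in auto)
  then show ?thesis using tendsto_mult_right_zero by blast
qed

text \<open>The tail \<open>C / \<epsilon> * (1 + a) powr (-\<epsilon>)\<close> does everything: it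
  makes the integrals over {0..n} a Cauchy sequence, its vanishing gives the limit along all
  truncations, and its value at a = 0 is the norm bound.\<close>

lemma halfline_integral:
  fixes f :: "real \<Rightarrow> 'b :: banach"
  assumes cont: "continuous_on {0..} f" and eps: "0 < \<epsilon>"
    and bound: "\<And>r. 0 \<le> r \<Longrightarrow> norm (f r) \<le> C * (1 + r) powr (-1 - \<epsilon>)"
  shows halfline_integrable: "f integrable_on {0..}"
    and halfline_integral_norm_le: "norm (integral {0..} f) \<le> C / \<epsilon>"
    and halfline_integral_tendsto: "((\<lambda>N. integral {0..N} f) \<longlongrightarrow> integral {0..} f) at_top"
proof -
  define T where "T a = C / \<epsilon> * (1 + a) powr (-\<epsilon>)" for a
  note tail = halfline_tail_bound[OF cont eps bound, folded T_def]
  have T0: "(T \<longlongrightarrow> 0) at_top"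
    unfolding T_def using powr_minus_at_top[OF eps] by blast
  have Cauchy: "Cauchy (\<lambda>n::nat. integral {0..real n} f)"
  proof (rule CauchyI')
    fix e :: real assume "0 < e"
    then have "\<forall>\<^sub>F a in at_top. T a < e" using T0 by (auto dest: order_tendstoD)
    then obtain N where N: "\<And>a. a \<ge> N \<Longrightarrow> T a < e" by (auto simp: eventually_at_top_linorder)
    obtain M :: nat where "N \<le> real M" using real_arch_simple by blast
    show "\<exists>M. \<forall>m\<ge>M. \<forall>n>m. dist (integral {0..real m} f) (integral {0..real n} f) < e"
    proof (intro exI allI impI)
      fix m n :: nat assume "M \<le> m" "m < n"
      then have "norm (integral {0..real n} f - integral {0..real m} f) \<le> T m" by (intro tail) auto
      also have "\<dots> < e" using \<open>N \<le> real M\<close> \<open>M \<le> m\<close> by (intro N) linarith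
      finally show "dist (integral {0..real m} f) (integral {0..real n} f) < e"
        by (simp add: dist_norm norm_minus_commute)
    qed
  qed
  then obtain l where l: "(\<lambda>n::nat. integral {0..real n} f) \<longlonglongrightarrow> l"
    by (auto simp: Cauchy_convergent_iff convergent_def)
  have close: "norm (l - integral {0..a} f) \<le> T a" if "0 \<le> a" for a
  proof (rule tendsto_upperbound)
    show "(\<lambda>n. norm (integral {0..real n} f - integral {0..a} f)) \<longlonglongrightarrow> norm (l - integral {0..a} f)"
      by (intro tendsto_intros l)
    obtain M :: nat where "a \<le> real M" using real_arch_simple by blast
    then show "\<forall>\<^sub>F n in sequentially. norm (integral {0..real n} f - integral {0..a} f) \<le> T a"
      by (intro eventually_sequentiallyI[of M] tail) (use that in auto)
  qed simp
  have hi: "(f has_integral l) {0..}"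
    unfolding has_integral_alt'
  proof (intro conjI allI impI)
    have restr: "((\<lambda>x. if x \<in> {0..} then f x else 0) integrable_on cbox a b) \<and>
        integral (cbox a b) (\<lambda>x. if x \<in> {0..} then f x else 0) = integral {max 0 a..b} f" for a b
    proof -
      have "{0..} \<inter> {a..b} = {max 0 a..b}" by auto
      moreover have "f integrable_on {max 0 a..b}"
        by (rule integrable_continuous_interval) (rule continuous_on_subset[OF cont], auto)
      ultimately show ?thesis
        using integrable_restrict_Int[of "{0..}" f "{a..b}"] integral_restrict_Int[of "{a..b}" "{0..}" f]
        by (simp add: Int_commute)
    qed
    show "(\<lambda>x. if x \<in> {0..} then f x else 0) integrable_on cbox a b" for a b using restr by blast
    fix e :: real assume "0 < e"
    then have "\<forall>\<^sub>F a in at_top. T a < e" using T0 by (auto dest: order_tendstoD)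
    then obtain N where N: "\<And>a. a \<ge> N \<Longrightarrow> T a < e" by (auto simp: eventually_at_top_linorder)
    show "\<exists>B>0. \<forall>a b. ball 0 B \<subseteq> cbox a b \<longrightarrow>
        norm (integral (cbox a b) (\<lambda>x. if x \<in> {0..} then f x else 0) - l) < e"
    \<comment> \<open>An interval containing the ball of this radius starts below 0 and ends beyond
      \<open>N\<close>; the 1 makes the radius positive.\<close>
    proof (intro exI[of _ "max N 1"] conjI allI impI)
      fix a b :: real assume "ball 0 (max N 1) \<subseteq> cbox a b"
      then have "{- max N 1<..<max N 1} \<subseteq> {a..b}" by (simp add: ball_eq_greaterThanLessThan)
      then have "a \<le> - max N 1 \<and> max N 1 \<le> b"
        by (subst (asm) greaterThanLessThan_subseteq_atLeastAtMost_iff) auto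
      then have ab: "a \<le> 0" "N \<le> b" "0 \<le> b" by auto
      then have "integral (cbox a b) (\<lambda>x. if x \<in> {0..} then f x else 0) = integral {0..b} f"
        using restr[of a b] by (simp add: max_def)
      then show "norm (integral (cbox a b) (\<lambda>x. if x \<in> {0..} then f x else 0) - l) < e"
        using close[OF ab(3)] N[OF ab(2)] by (simp add: norm_minus_commute)
    qed simp
  qed
  then show "f integrable_on {0..}" by blast
  have l_eq: "integral {0..} f = l" using hi by (rule integral_unique)
  show "norm (integral {0..} f) \<le> C / \<epsilon>" using close[of 0] by (simp add: l_eq T_def)
  show "((\<lambda>N. integral {0..N} f) \<longlongrightarrow> integral {0..} f) at_top"
    unfolding l_eq Lim_null[of _ l]
    by (rule Lim_null_comparison[OF _ T0])
      (use close in \<open>auto simp: norm_minus_commute intro: eventually_at_top_linorderI[of 0]\<close>)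
qed


section \<open>Rotation of rays\<close>

definition ray :: "(complex \<Rightarrow> 'b :: complex_banach) \<Rightarrow> real \<Rightarrow> real \<Rightarrow> 'b" where
  "ray f t r = cis t *\<^sub>C f (of_real r * cis t)"

definition wedge :: "real \<Rightarrow> real \<Rightarrow> complex set" where
  "wedge a b = {of_real r * cis t | r t. 0 \<le> r \<and> a \<le> t \<and> t \<le> b}"

lemma ray_eta: "(\<lambda>r. cis t *\<^sub>C f (of_real r * cis t)) = ray f t"
  by (auto simp: ray_def)

lemma wedgeI: "0 \<le> r \<Longrightarrow> a \<le> t \<Longrightarrow> t \<le> b \<Longrightarrow> of_real r * cis t \<in> wedge a b"
  by (auto simp: wedge_def)

text \<open>Derivatives are relative to a set throughout: the paths contain the vertex and the
  boundary rays of sectors, beyond which nothing is known about the function.\<close>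

lemma has_vector_derivative_chain_scaleC:
  assumes "(f has_derivative (\<lambda>h. h *\<^sub>C D)) (at (g t) within S)"
    and "(g has_vector_derivative g') (at t within T)" and "g ` T \<subseteq> S"
  shows "((\<lambda>t. f (g t)) has_vector_derivative g' *\<^sub>C D) (at t within T)"
proof -
  have "((\<lambda>t. f (g t)) has_derivative (\<lambda>x. (x *\<^sub>R g') *\<^sub>C D)) (at t within T)"
    using assms(2) has_derivative_subset[OF assms(1,3)]
    unfolding has_vector_derivative_def by (rule has_derivative_in_compose)
  then show ?thesis by (simp add: has_vector_derivative_def scaleC.scaleR_left)
qed

lemma has_vector_derivative_cis: "(cis has_vector_derivative \<i> * cis t) (at t within T)"
  unfolding has_vector_derivative_def by (auto intro!: derivative_eq_intros)

text \<open>The angular derivative of the integrand is the radial derivative of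
  \<open>\<i> r e\<^sup>i\<^sup>t f (r e\<^sup>i\<^sup>t)\<close>, so differentiation under the integral sign replaces
  Cauchy's theorem on a circular sector.\<close>

lemma integral_ray_diff:
  fixes f :: "complex \<Rightarrow> 'b :: complex_banach"
  assumes "a \<le> b" "0 \<le> N"
    and der: "\<And>z. z \<in> wedge a b \<Longrightarrow> (f has_derivative (\<lambda>h. h *\<^sub>C f' z)) (at z within wedge a b)"
    and cont: "continuous_on (wedge a b) f'"
  shows "integral {0..N} (ray f b) - integral {0..N} (ray f a) =
    integral {a..b} (\<lambda>t. (\<i> * of_real N * cis t) *\<^sub>C f (of_real N * cis t))"
proof -
  define D where "D t r = cis t *\<^sub>C ((of_real r * (\<i> * cis t)) *\<^sub>C f' (of_real r * cis t))
      + (\<i> * cis t) *\<^sub>C f (of_real r * cis t)" for t r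
  have contf: "continuous_on (wedge a b) f"
    using der by (rule has_derivative_continuous_on)
  have polar: "continuous_on ({a..b} \<times> {0..N}) (\<lambda>(t, r). h (of_real r * cis t))"
    if "continuous_on (wedge a b) h" for h :: "complex \<Rightarrow> 'b"
    unfolding case_prod_beta
    by (rule continuous_on_compose2[OF that]) (auto intro!: continuous_intros wedgeI)
  have angular: "((\<lambda>t. ray f t r) has_vector_derivative D t r) (at t within {a..b})"
    if "t \<in> {a..b}" "r \<in> {0..N}" for t r
    unfolding ray_def D_def
  proof (intro scaleC.has_vector_derivative has_vector_derivative_cis
      has_vector_derivative_chain_scaleC[OF der])
    show "((\<lambda>t. of_real r * cis t) has_vector_derivative of_real r * (\<i> * cis t)) (at t within {a..b})"
      by (intro has_vector_derivative_mult_right has_vector_derivative_cis)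
  qed (use that in \<open>auto intro: wedgeI\<close>)
  have radial: "((\<lambda>r. (\<i> * of_real r * cis t) *\<^sub>C f (of_real r * cis t)) has_vector_derivative D t r)
      (at r within {0..N})" if "t \<in> {a..b}" "r \<in> {0..N}" for t r
  proof -
    have lin: "((\<lambda>r. c * of_real r * d) has_vector_derivative c * d) (at r within {0..N})"
      for c d :: complex
      unfolding has_vector_derivative_def
      by (auto intro!: derivative_eq_intros simp: scaleR_conv_of_real)
    have "((\<lambda>r. (\<i> * of_real r * cis t) *\<^sub>C f (of_real r * cis t)) has_vector_derivative
        (\<i> * of_real r * cis t) *\<^sub>C (cis t *\<^sub>C f' (of_real r * cis t))
          + (\<i> * cis t) *\<^sub>C f (of_real r * cis t)) (at r within {0..N})"
    proof (intro scaleC.has_vector_derivative lin has_vector_derivative_chain_scaleC[OF der])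
      show "((\<lambda>r. of_real r * cis t) has_vector_derivative cis t) (at r within {0..N})"
        using lin[of 1 "cis t"] by simp
    qed (use that in \<open>auto intro: wedgeI\<close>)
    then show ?thesis by (simp add: D_def scaleC_scaleC algebra_simps)
  qed
  have "((\<lambda>t. integral (cbox 0 N) (ray f t)) has_vector_derivative integral (cbox 0 N) (D t))
      (at t within {a..b})" if "t \<in> {a..b}" for t
  proof (rule leibniz_rule_vector_derivative)
    show "continuous_on ({a..b} \<times> cbox 0 N) (\<lambda>(t, r). D t r)"
      using polar[OF cont] polar[OF contf] unfolding D_def case_prod_beta
      by (auto intro!: continuous_intros)
    show "ray f t integrable_on cbox 0 N" if "t \<in> {a..b}" for t
      unfolding ray_def cbox_interval
      by (intro integrable_continuous_interval continuous_intros continuous_on_compose2[OF contf])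
        (use that in \<open>auto intro: wedgeI\<close>)
  qed (use that angular in auto)
  moreover have "integral {0..N} (D t) = (\<i> * of_real N * cis t) *\<^sub>C f (of_real N * cis t)"
    if "t \<in> {a..b}" for t
    using fundamental_theorem_of_calculus[OF \<open>0 \<le> N\<close> radial[OF that]]
    by (simp add: integral_unique scaleC.zero_left)
  ultimately have "((\<lambda>t. (\<i> * of_real N * cis t) *\<^sub>C f (of_real N * cis t)) has_integral
      (integral {0..N} (ray f b) - integral {0..N} (ray f a))) {a..b}"
    by (intro fundamental_theorem_of_calculus[OF \<open>a \<le> b\<close>]) simp
  then show ?thesis by (simp add: integral_unique)
qed

lemma continuous_on_ray:
  assumes "continuous_on S f" and "\<And>r. 0 \<le> r \<Longrightarrow> of_real r * cis t \<in> S"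
  shows "continuous_on {0..} (ray f t)"
  unfolding ray_def
  by (intro continuous_intros continuous_on_compose2[OF assms(1)]) (use assms(2) in auto)

lemma norm_ray: "norm (ray f t r) = norm (f (of_real r * cis t))"
  by (simp add: ray_def norm_scaleC)

text \<open>The arc of radius N has length N (b - a), and on it f is at most C (1 + N)^(-1 -
  \<epsilon>). Its contribution is therefore of order N^(-\<epsilon>) and vanishes in the
  limit.\<close>

lemma integral_ray_eq:
  fixes f :: "complex \<Rightarrow> 'b :: complex_banach"
  assumes "a \<le> b" and eps: "0 < \<epsilon>"
    and der: "\<And>z. z \<in> wedge a b \<Longrightarrow> (f has_derivative (\<lambda>h. h *\<^sub>C f' z)) (at z within wedge a b)"
    and cont: "continuous_on (wedge a b) f'"
    and bound: "\<And>z. z \<in> wedge a b \<Longrightarrow> norm (f z) \<le> C * (1 + cmod z) powr (-1 - \<epsilon>)"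
  shows "integral {0..} (ray f a) = integral {0..} (ray f b)"
proof -
  have contf: "continuous_on (wedge a b) f"
    using der by (rule has_derivative_continuous_on)
  have lim: "((\<lambda>N. integral {0..N} (ray f t)) \<longlongrightarrow> integral {0..} (ray f t)) at_top"
    if "t = a \<or> t = b" for t
  proof (rule halfline_integral_tendsto[OF continuous_on_ray[OF contf] eps, where C = C])
    fix r :: real assume "0 \<le> r"
    then show "of_real r * cis t \<in> wedge a b" using that \<open>a \<le> b\<close> by (auto intro: wedgeI)
    from bound[OF this] \<open>0 \<le> r\<close> show "norm (ray f t r) \<le> C * (1 + r) powr (-1 - \<epsilon>)"
      by (simp add: norm_ray norm_mult)
  qed
  have "0 \<le> C"
    using order_trans[OF norm_ge_zero bound[of 0]] wedgeI[of 0 a a b] \<open>a \<le> b\<close> by simp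
  have "norm (integral {0..N} (ray f b) - integral {0..N} (ray f a)) \<le> (C * (b - a)) * (1 + N) powr (-\<epsilon>)"
    if "0 \<le> N" for N
  proof -
    have "norm (integral {0..N} (ray f b) - integral {0..N} (ray f a)) \<le>
        (C * (1 + N) powr (-\<epsilon>)) * (b - a)"
    proof (subst integral_ray_diff[OF \<open>a \<le> b\<close> that der cont], assumption, rule integral_bound[OF \<open>a \<le> b\<close>])
      show "continuous_on {a..b} (\<lambda>t. (\<i> * of_real N * cis t) *\<^sub>C f (of_real N * cis t))"
        by (intro continuous_intros continuous_on_compose2[OF contf]) (use that in \<open>auto intro: wedgeI\<close>)
      fix t assume "t \<in> {a..b}"
      have "norm (f (of_real N * cis t)) \<le> C * (1 + N) powr (-1 - \<epsilon>)"
        using bound[OF wedgeI[OF that, of a t b]] \<open>t \<in> {a..b}\<close> that by (simp add: norm_mult)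
      then have "N * norm (f (of_real N * cis t)) \<le> (1 + N) * (C * (1 + N) powr (-1 - \<epsilon>))"
        using that by (intro mult_mono) auto
      also have "(1 + N) powr (-1 - \<epsilon>) = (1 + N) powr (-\<epsilon>) / (1 + N)"
        using that by (simp add: powr_diff powr_minus divide_simps)
      finally show "norm ((\<i> * of_real N * cis t) *\<^sub>C f (of_real N * cis t)) \<le> C * (1 + N) powr (-\<epsilon>)"
        using that by (simp add: norm_scaleC norm_mult)
    qed
    then show ?thesis by (simp add: mult_ac)
  qed
  then have "((\<lambda>N. integral {0..N} (ray f b) - integral {0..N} (ray f a)) \<longlongrightarrow> 0) at_top"
    by (intro Lim_null_comparison[OF _ powr_minus_at_top[OF eps]])
      (auto intro: eventually_at_top_linorderI[of 0])
  moreover have "((\<lambda>N. integral {0..N} (ray f b) - integral {0..N} (ray f a)) \<longlongrightarrow>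
      integral {0..} (ray f b) - integral {0..} (ray f a)) at_top"
    by (intro tendsto_diff lim) auto
  ultimately have "integral {0..} (ray f b) - integral {0..} (ray f a) = 0"
    by (rule tendsto_unique[OF trivial_limit_at_top_linorder, rotated])
  then show ?thesis by simp
qed


section \<open>Integrals along the boundary of a sector\<close>

definition Gamma_path :: "real \<Rightarrow> complex set" where
  "Gamma_path \<theta> = {of_real r * cis t | r t. 0 \<le> r \<and> (t = \<theta> \<or> t = -\<theta>)}"

definition Gamma_integral :: "real \<Rightarrow> (complex \<Rightarrow> 'b) \<Rightarrow> 'b :: complex_banach" where
  "Gamma_integral \<theta> f = integral {0..} (ray f \<theta>) - integral {0..} (ray f (-\<theta>))"

text \<open>Serves as the integrability hypothesis. Both constants stay explicit because they enter
  the bound 2 C / \<epsilon> of the integral.\<close>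

definition Gamma_decay :: "real \<Rightarrow> (complex \<Rightarrow> 'b :: complex_banach) \<Rightarrow> real \<Rightarrow> real \<Rightarrow> bool" where
  "Gamma_decay \<theta> f \<epsilon> C \<longleftrightarrow> 0 < \<epsilon> \<and> continuous_on (Gamma_path \<theta>) f \<and>
     (\<forall>z\<in>Gamma_path \<theta>. norm (f z) \<le> C * (1 + cmod z) powr (-1 - \<epsilon>))"

lemma Gamma_pathI: "0 \<le> r \<Longrightarrow> t = \<theta> \<or> t = -\<theta> \<Longrightarrow> of_real r * cis t \<in> Gamma_path \<theta>"
  by (auto simp: Gamma_path_def)

lemma has_Gamma_integral_iff:
  "has_Gamma_integral g I \<theta> \<longleftrightarrow>
     ray g \<theta> integrable_on {0..} \<and> ray g (-\<theta>) integrable_on {0..} \<and> I = Gamma_integral \<theta> g"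
  unfolding has_Gamma_integral_def Gamma_integral_def ray_eta
  by (auto simp: has_integral_iff)

lemma Gamma_decay_ray:
  assumes "Gamma_decay \<theta> f \<epsilon> C" "t = \<theta> \<or> t = -\<theta>"
  shows "ray f t integrable_on {0..}" "norm (integral {0..} (ray f t)) \<le> C / \<epsilon>"
    "((\<lambda>N. integral {0..N} (ray f t)) \<longlongrightarrow> integral {0..} (ray f t)) at_top"
proof -
  have 1: "continuous_on {0..} (ray f t)"
    by (rule continuous_on_ray[of "Gamma_path \<theta>"]) (use assms in \<open>auto simp: Gamma_decay_def intro: Gamma_pathI\<close>)
  have 2: "norm (ray f t r) \<le> C * (1 + r) powr (-1 - \<epsilon>)" if "0 \<le> r" for r
  proof -
    have "of_real r * cis t \<in> Gamma_path \<theta>" using assms(2) that by (intro Gamma_pathI) auto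
    with assms(1) have "norm (f (of_real r * cis t)) \<le> C * (1 + cmod (of_real r * cis t)) powr (-1 - \<epsilon>)"
      unfolding Gamma_decay_def by blast
    with that show ?thesis by (simp add: norm_ray norm_mult)
  qed
  have 3: "0 < \<epsilon>" using assms(1) by (simp add: Gamma_decay_def)
  show "ray f t integrable_on {0..}" "norm (integral {0..} (ray f t)) \<le> C / \<epsilon>"
    "((\<lambda>N. integral {0..N} (ray f t)) \<longlongrightarrow> integral {0..} (ray f t)) at_top"
    using halfline_integral[OF 1 3 2] by auto
qed

lemma has_Gamma_integral:
  assumes "Gamma_decay \<theta> f \<epsilon> C"
  shows "has_Gamma_integral f (Gamma_integral \<theta> f) \<theta>"
  using Gamma_decay_ray(1)[OF assms] by (simp add: has_Gamma_integral_iff)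

lemma norm_Gamma_integral_le:
  assumes "Gamma_decay \<theta> f \<epsilon> C"
  shows "norm (Gamma_integral \<theta> f) \<le> 2 * (C / \<epsilon>)"
  using Gamma_decay_ray(2)[OF assms, of \<theta>] Gamma_decay_ray(2)[OF assms, of "-\<theta>"]
    norm_triangle_ineq4[of "integral {0..} (ray f \<theta>)" "integral {0..} (ray f (-\<theta>))"]
  unfolding Gamma_integral_def by simp

text \<open>\<open>bounded_linear\<close> means linearity over the reals; complex homogeneity is
  required separately, because the factors \<open>cis t\<close> of the path have to pass through
  \<open>h\<close>.\<close>

lemma has_Gamma_integral_linear:
  assumes "has_Gamma_integral f I \<theta>" and "bounded_linear h" and "\<And>c x. h (c *\<^sub>C x) = c *\<^sub>C h x"
  shows "has_Gamma_integral (\<lambda>z. h (f z)) (h I) \<theta>"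
proof -
  have eq: "ray (\<lambda>z. h (f z)) t = h \<circ> ray f t" for t
    by (auto simp: ray_def assms(3))
  show ?thesis
    using assms(1) integral_linear[OF _ assms(2)] integrable_linear[OF _ assms(2)]
    by (auto simp: has_Gamma_integral_iff eq Gamma_integral_def
        linear_diff[OF bounded_linear.linear[OF assms(2)]])
qed

lemma Gamma_integral_linear:
  assumes "Gamma_decay \<theta> f \<epsilon> C" and "bounded_linear h" and "\<And>c x. h (c *\<^sub>C x) = c *\<^sub>C h x"
  shows "h (Gamma_integral \<theta> f) = Gamma_integral \<theta> (\<lambda>z. h (f z))"
  using has_Gamma_integral_linear[OF has_Gamma_integral[OF assms(1)] assms(2,3)]
  by (simp add: has_Gamma_integral_iff)

lemma Gamma_integral_diff:
  assumes "Gamma_decay \<theta> f \<epsilon> C" and "Gamma_decay \<theta> g \<epsilon>' C'"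
  shows "Gamma_integral \<theta> (\<lambda>z. f z - g z) = Gamma_integral \<theta> f - Gamma_integral \<theta> g"
proof -
  have "ray (\<lambda>z. f z - g z) t = (\<lambda>r. ray f t r - ray g t r)" for t
    by (auto simp: ray_def scaleC.diff_right)
  then show ?thesis
    using Gamma_decay_ray(1)[OF assms(1)] Gamma_decay_ray(1)[OF assms(2)]
    by (simp add: Gamma_integral_def Henstock_Kurzweil_Integration.integral_diff)
qed

lemma Gamma_integral_cong:
  assumes "\<And>z. z \<in> Gamma_path \<theta> \<Longrightarrow> f z = g z"
  shows "Gamma_integral \<theta> f = Gamma_integral \<theta> g"
proof -
  have "integral {0..} (ray f t) = integral {0..} (ray g t)" if "t = \<theta> \<or> t = -\<theta>" for t
    by (rule integral_cong) (use that in \<open>simp add: ray_def assms[OF Gamma_pathI]\<close>)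
  then show ?thesis by (simp add: Gamma_integral_def)
qed

text \<open>The reflected path carries the opposite orientation, which cancels the sign of \<open>d (-z)\<close>.\<close>

lemma ray_uminus: "ray f t r = - ray (\<lambda>z. f (- z)) (t - pi) r"
  by (simp add: ray_def cis_divide[symmetric] scaleC.minus_left)

lemma ray_uminus': "ray f t r = - ray (\<lambda>z. f (- z)) (t + pi) r"
  by (simp add: ray_def cis_mult[symmetric] scaleC.minus_left)

lemma Gamma_integral_uminus:
  "Gamma_integral \<theta> (\<lambda>z. f (- z)) = Gamma_integral (pi - \<theta>) f"
proof -
  have "ray (\<lambda>z. f (- z)) \<theta> = (\<lambda>r. - ray f (- (pi - \<theta>)) r)"
    using ray_uminus[of "\<lambda>z. f (- z)" \<theta>] by (auto simp: algebra_simps)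
  moreover have "ray (\<lambda>z. f (- z)) (- \<theta>) = (\<lambda>r. - ray f (pi - \<theta>) r)"
    using ray_uminus'[of "\<lambda>z. f (- z)" "- \<theta>"] by (auto simp: algebra_simps)
  ultimately show ?thesis by (simp add: Gamma_integral_def)
qed


section \<open>Sectors\<close>

lemma zero_in_sector [simp]: "0 \<in> sector \<theta>"
  by (simp add: sector_def)

lemma of_real_in_sector: "0 \<le> r \<Longrightarrow> 0 \<le> \<theta> \<Longrightarrow> of_real r \<in> sector \<theta>"
  by (simp add: sector_def)

lemma sector_mono: "\<theta> \<le> \<theta>' \<Longrightarrow> sector \<theta> \<subseteq> sector \<theta>'"
  by (auto simp: sector_def)

lemma polar_in_sector:
  assumes "0 \<le> r" "\<bar>t\<bar> \<le> \<theta>" "\<theta> < pi"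
  shows "of_real r * cis t \<in> sector \<theta>"
proof (cases "r = 0")
  case False
  moreover have "Arg (cis t) = t" using assms by (intro Arg_cis) auto
  ultimately show ?thesis using assms by (simp add: sector_def)
qed simp

lemma uminus_polar_in_sector:
  assumes "0 \<le> r" "\<bar>t\<bar> \<le> pi" "pi - \<theta> \<le> \<bar>t\<bar>" "\<theta> < pi"
  shows "- (of_real r * cis t) \<in> sector \<theta>"
proof (cases "t \<ge> 0")
  case True
  have "of_real r * cis (t - pi) \<in> sector \<theta>" by (rule polar_in_sector) (use assms True in auto)
  then show ?thesis by (simp add: cis_divide[symmetric])
next
  case False
  have "of_real r * cis (t + pi) \<in> sector \<theta>" by (rule polar_in_sector) (use assms False in auto)
  then show ?thesis by (simp add: cis_mult[symmetric])
qed

text \<open>The functions of the calculus live outside a sector of A; there -z falls into a sector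
  on which the resolvent of B is controlled.\<close>

lemma uminus_in_sector_if_not:
  assumes "z \<notin> sector \<theta>"
  shows "- z \<in> sector (pi - \<theta>)"
proof -
  have "z \<noteq> 0" "\<theta> < \<bar>Arg z\<bar>" using assms by (auto simp: sector_def)
  moreover have "- pi < Arg z" "Arg z \<le> pi" using Arg_bounded by auto
  ultimately show ?thesis by (auto simp: sector_def Arg_minus)
qed

lemma Re_ge_if_in_sector:
  assumes "z \<in> sector \<theta>" "\<theta> \<le> pi"
  shows "cos \<theta> * cmod z \<le> Re z"
proof (cases "z = 0")
  case False
  then have "\<bar>Arg z\<bar> \<le> \<theta>" using assms by (auto simp: sector_def)
  then have "cos \<theta> \<le> cos \<bar>Arg z\<bar>" using assms by (intro cos_monotone_0_pi_le) auto
  then show ?thesis using False by (simp add: cos_Arg field_simps)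
qed simp

lemma Gamma_path_subset_sector:
  assumes "0 \<le> \<phi>" "\<phi> \<le> \<theta>" "\<theta> < pi"
  shows "Gamma_path \<phi> \<subseteq> sector \<theta>"
  using assms by (auto simp: Gamma_path_def intro!: polar_in_sector)

lemma uminus_Gamma_path_in_sector:
  assumes "0 \<le> \<phi>" "\<phi> \<le> pi" "pi - \<phi> \<le> \<theta>" "\<theta> < pi" "z \<in> Gamma_path \<phi>"
  shows "- z \<in> sector \<theta>"
  using assms by (auto simp: Gamma_path_def intro!: uminus_polar_in_sector)


section \<open>Resolvent families\<close>

lemma powr_minus_one_minus_one: "0 \<le> (x::real) \<Longrightarrow> (1 + x) powr (-1 - 1) = 1 / (1 + x)\<^sup>2"
  using powr_minus_divide[of "1 + x" 2] by (simp add: powr_numeral)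

text \<open>\<open>R z\<close> stands for (A + z)^-1 on the closed sector; A is recovered as the
  inverse of the injective operator \<open>R 0\<close>.\<close>

locale resolvent_family =
  fixes R :: "complex \<Rightarrow> 'a :: complex_banach \<Rightarrow>\<^sub>L 'a" and \<theta> K :: real
  assumes angle: "0 < \<theta>" "\<theta> < pi"
    and clinear: "z \<in> sector \<theta> \<Longrightarrow> R z \<in> L_space"
    and resolvent_identity:
      "z \<in> sector \<theta> \<Longrightarrow> w \<in> sector \<theta> \<Longrightarrow> R z - R w = (w - z) *\<^sub>C (R z o\<^sub>L R w)"
    and bound: "z \<in> sector \<theta> \<Longrightarrow> (1 + cmod z) * norm (R z) \<le> K"
    and inj: "R 0 x = 0 \<Longrightarrow> x = 0"
begin

lemma K_nonneg: "0 \<le> K"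
  using order_trans[OF norm_ge_zero, of "R 0" K] bound[of 0] by simp

lemma norm_R_le: "z \<in> sector \<theta> \<Longrightarrow> norm (R z) \<le> K / (1 + cmod z)"
  using bound[of z] by (simp add: field_simps add_pos_nonneg)

lemma norm_R_le_K: "z \<in> sector \<theta> \<Longrightarrow> norm (R z) \<le> K"
  by (rule order_trans[OF norm_R_le]) (use K_nonneg in \<open>simp_all add: divide_le_eq mult_le_cancel_left1 add_pos_nonneg\<close>)

lemma commute_self:
  assumes "z \<in> sector \<theta>" "w \<in> sector \<theta>"
  shows "R z o\<^sub>L R w = R w o\<^sub>L R z"
proof (cases "z = w")
  case False
  have "(w - z) *\<^sub>C (R z o\<^sub>L R w) = (w - z) *\<^sub>C (R w o\<^sub>L R z)"
    using resolvent_identity[OF assms] resolvent_identity[OF assms(2,1)]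
    by (metis minus_diff_eq scaleC.minus_left)
  then have "(1 / (w - z)) *\<^sub>C (w - z) *\<^sub>C (R z o\<^sub>L R w) = (1 / (w - z)) *\<^sub>C (w - z) *\<^sub>C (R w o\<^sub>L R z)"
    by simp
  then show ?thesis using False by (simp add: scaleC_scaleC)
qed simp

lemma identity_apply:
  assumes "z \<in> sector \<theta>" "w \<in> sector \<theta>"
  shows "R z x - R w x = (w - z) *\<^sub>C R z (R w x)"
  using arg_cong[OF resolvent_identity[OF assms], of "\<lambda>T. blinfun_apply T x"]
  by (simp add: blinfun.diff_left blinfun_apply_scaleC)

lemma commute_self_apply:
  assumes "z \<in> sector \<theta>" "w \<in> sector \<theta>"
  shows "R z (R w x) = R w (R z x)"
  using arg_cong[OF commute_self[OF assms], of "\<lambda>T. blinfun_apply T x"] by simp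

lemma continuous_on_R: "continuous_on (sector \<theta>) R"
proof (rule continuous_on_iff[THEN iffD2], intro ballI allI impI)
  fix z and e :: real assume z: "z \<in> sector \<theta>" and "0 < e"
  show "\<exists>d>0. \<forall>w\<in>sector \<theta>. dist w z < d \<longrightarrow> dist (R w) (R z) < e"
  \<comment> \<open>By the resolvent identity \<open>K\<^sup>2\<close> is a Lipschitz constant;
    adding 1 allows for \<open>K = 0\<close>.\<close>
  proof (intro exI[of _ "e / (K\<^sup>2 + 1)"] conjI ballI impI)
    fix w assume w: "w \<in> sector \<theta>" and d: "dist w z < e / (K\<^sup>2 + 1)"
    have "dist (R w) (R z) \<le> cmod (z - w) * norm (R w o\<^sub>L R z)"
      by (simp add: dist_norm resolvent_identity[OF w z] norm_scaleC)
    also have "norm (R w o\<^sub>L R z) \<le> K\<^sup>2"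
      unfolding power2_eq_square using w z K_nonneg
      by (intro order_trans[OF norm_blinfun_compose] mult_mono norm_R_le_K) auto
    also have "cmod (z - w) * K\<^sup>2 \<le> cmod (z - w) * (K\<^sup>2 + 1)" by (intro mult_left_mono) auto
    also have "\<dots> < e"
      using d by (simp add: dist_norm norm_minus_commute pos_less_divide_eq add_nonneg_pos)
    finally show "dist (R w) (R z) < e" by (simp add: mult_left_mono)
  qed (use \<open>0 < e\<close> in \<open>simp add: add_nonneg_pos\<close>)
qed

text \<open>The resolvent identity writes the remainder as (w - z) (R z - R w) R z, so continuity of
  R is enough.\<close>

lemma has_derivative_R:
  assumes z: "z \<in> sector \<theta>" and "S \<subseteq> sector \<theta>"
  shows "(R has_derivative (\<lambda>h. h *\<^sub>C - (R z o\<^sub>L R z))) (at z within S)"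
proof (rule has_derivative_subset[OF _ assms(2)])
  have "((\<lambda>w. norm ((R z - R w) o\<^sub>L R z)) \<longlongrightarrow> norm ((R z - R z) o\<^sub>L R z)) (at z within sector \<theta>)"
    using continuous_on_R z unfolding continuous_on_def
    by (intro tendsto_norm blinfun_compose.tendsto tendsto_intros) auto
  then have lim: "((\<lambda>w. norm ((R z - R w) o\<^sub>L R z)) \<longlongrightarrow> 0) (at z within sector \<theta>)" by simp
  show "(R has_derivative (\<lambda>h. h *\<^sub>C - (R z o\<^sub>L R z))) (at z within sector \<theta>)"
    unfolding has_derivative_iff_norm
  proof (intro conjI scaleC.bounded_linear_left)
    show "((\<lambda>w. norm (R w - R z - (w - z) *\<^sub>C - (R z o\<^sub>L R z)) / norm (w - z)) \<longlongrightarrow> 0) (at z within sector \<theta>)"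
    proof (rule Lim_transform_within[OF lim zero_less_one])
      fix w assume w: "w \<in> sector \<theta>" and "0 < dist w z"
      then have "w \<noteq> z" by auto
      have "R w - R z - (w - z) *\<^sub>C - (R z o\<^sub>L R z) = (w - z) *\<^sub>C ((R z - R w) o\<^sub>L R z)"
        unfolding resolvent_identity[OF w z] blinfun_compose.diff_left scaleC.diff_right scaleC.minus_right
        using scaleC.minus_left[of "w - z" "R w o\<^sub>L R z"] by simp
      then show "norm ((R z - R w) o\<^sub>L R z) = norm (R w - R z - (w - z) *\<^sub>C - (R z o\<^sub>L R z)) / norm (w - z)"
        using \<open>w \<noteq> z\<close> by (simp add: norm_scaleC)
    qed
  qed
qed

lemma wedge_subset_sector:
  assumes "- t \<le> a" "b \<le> t" "t \<le> \<theta>"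
  shows "wedge a b \<subseteq> sector \<theta>"
  using assms angle by (auto simp: wedge_def intro!: polar_in_sector)

text \<open>The integral of \<open>R\<close> itself along the boundary of a sector diverges in general; in the
  symmetric limit only the circular arc contributes, which subtends the angle \<open>2 t\<close>.\<close>

lemma integral_ray_diff_tendsto:
  assumes "0 \<le> t" "t \<le> \<theta>"
  shows "((\<lambda>N. R 0 o\<^sub>L (integral {0..N} (ray R t) - integral {0..N} (ray R (-t)))) \<longlongrightarrow>
    (2 * \<i> * of_real t) *\<^sub>C R 0) at_top"
proof -
  define g where "g N s = of_real N * cis s" for N s
  have g: "g N s \<in> sector \<theta>" "cmod (g N s) = N" if "0 \<le> N" "s \<in> {-t..t}" for N s
    using that assms angle by (auto simp: g_def norm_mult intro!: polar_in_sector)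
  have contg: "continuous_on {-t..t} (\<lambda>s. R (g N s))" if "0 \<le> N" for N
    by (rule continuous_on_compose2[OF continuous_on_R])
      (use that g in \<open>auto simp: g_def intro!: continuous_intros\<close>)
  have eq: "R 0 o\<^sub>L (integral {0..N} (ray R t) - integral {0..N} (ray R (-t))) =
      (2 * \<i> * of_real t) *\<^sub>C R 0 - \<i> *\<^sub>C integral {-t..t} (\<lambda>s. R (g N s))" if N: "0 \<le> N" for N
  proof -
    have "integral {0..N} (ray R t) - integral {0..N} (ray R (-t)) =
        integral {-t..t} (\<lambda>s. (\<i> * g N s) *\<^sub>C R (g N s))"
      unfolding g_def mult.assoc[symmetric]
    proof (rule integral_ray_diff[OF _ N])
      show "continuous_on (wedge (-t) t) (\<lambda>z. - (R z o\<^sub>L R z))"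
        by (intro continuous_intros continuous_on_subset[OF continuous_on_R] wedge_subset_sector[of t])
          (use assms in auto)
    qed (use assms wedge_subset_sector[of t "-t" t] in \<open>auto intro!: has_derivative_R\<close>)
    also have "R 0 o\<^sub>L \<dots> = integral {-t..t} (\<lambda>s. R 0 o\<^sub>L ((\<i> * g N s) *\<^sub>C R (g N s)))"
      by (rule integral_linear[unfolded comp_def, symmetric])
        (use contg[OF N] in \<open>auto simp: g_def intro!: integrable_continuous_interval continuous_intros
          blinfun_compose.bounded_linear_right\<close>)
    also have "\<dots> = integral {-t..t} (\<lambda>s. \<i> *\<^sub>C (R 0 - R (g N s)))"
    proof (rule integral_cong)
      fix s assume s: "s \<in> {-t..t}"
      \<comment> \<open>This is what the factor \<open>R 0\<close> is for: the arc integrand z R(z),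
        bounded but not small, turns into a constant minus a term of order 1/N.\<close>
      have "R 0 - R (g N s) = g N s *\<^sub>C (R 0 o\<^sub>L R (g N s))"
        using resolvent_identity[OF zero_in_sector g(1)[OF N s]] by simp
      then show "R 0 o\<^sub>L ((\<i> * g N s) *\<^sub>C R (g N s)) = \<i> *\<^sub>C (R 0 - R (g N s))"
        by (simp add: blinfun_compose_scaleC_right clinear scaleC_scaleC)
    qed
    also have "\<dots> = \<i> *\<^sub>C integral {-t..t} (\<lambda>s. R 0 - R (g N s))"
      by (rule integral_linear[unfolded comp_def])
        (use contg[OF N] in \<open>auto intro!: integrable_continuous_interval continuous_intros bounded_linear_scaleC\<close>)
    also have "integral {-t..t} (\<lambda>s. R 0 - R (g N s)) = (2 * t) *\<^sub>R R 0 - integral {-t..t} (\<lambda>s. R (g N s))"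
      using assms contg[OF N]
      by (subst Henstock_Kurzweil_Integration.integral_diff)
        (auto intro!: integrable_continuous_interval)
    also have "(2 * t) *\<^sub>R R 0 = of_real (2 * t) *\<^sub>C R 0" by (simp only: scaleC_of_real)
    finally show ?thesis by (simp add: scaleC.diff_right scaleC_scaleC mult_ac)
  qed
  \<comment> \<open>The remaining arc subtends the angle 2 t, and the resolvent on it is at most K /
    (1 + N).\<close>
  have "norm ((R 0 o\<^sub>L (integral {0..N} (ray R t) - integral {0..N} (ray R (-t)))) - (2 * \<i> * of_real t) *\<^sub>C R 0)
      \<le> (2 * t * K) * (1 + N) powr (-1)" if N: "0 \<le> N" for N
  proof -
    have "norm (integral {-t..t} (\<lambda>s. R (g N s))) \<le> (K / (1 + N)) * (t - - t)"
      by (rule integral_bound) (use assms contg[OF N] norm_R_le g N in fastforce)+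
    then show ?thesis
      unfolding eq[OF N] using N by (simp add: norm_scaleC powr_minus_divide mult_ac)
  qed
  then show ?thesis
    unfolding Lim_null[of _ "(2 * \<i> * of_real t) *\<^sub>C R 0"]
    by (intro Lim_null_comparison[OF _ powr_minus_at_top[of 1 "2 * t * K"]])
      (auto intro: eventually_at_top_linorderI[of 0])
qed

end


section \<open>Commuting resolvent families\<close>

lemma Gamma_decay_linear:
  assumes "Gamma_decay \<phi> f \<epsilon> C" and "bounded_linear h"
  obtains C' where "Gamma_decay \<phi> (\<lambda>z. h (f z)) \<epsilon> C'"
proof -
  interpret h: bounded_linear h by fact
  obtain M where M: "\<And>x. norm (h x) \<le> norm x * M" "0 \<le> M" using h.nonneg_bounded by blast
  have "Gamma_decay \<phi> (\<lambda>z. h (f z)) \<epsilon> (C * M)"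
    unfolding Gamma_decay_def
  proof (intro conjI ballI)
    fix z assume "z \<in> Gamma_path \<phi>"
    then have "norm (f z) \<le> C * (1 + cmod z) powr (-1 - \<epsilon>)" using assms(1) by (simp add: Gamma_decay_def)
    then have "norm (f z) * M \<le> C * (1 + cmod z) powr (-1 - \<epsilon>) * M" using M(2) by (rule mult_right_mono)
    with M(1)[of "f z"] show "norm (h (f z)) \<le> C * M * (1 + cmod z) powr (-1 - \<epsilon>)" by (simp add: mult_ac)
  qed (use assms(1) in \<open>auto simp: Gamma_decay_def intro!: h.continuous_on\<close>)
  then show ?thesis by (rule that)
qed

lemma Gamma_decay_cong:
  "(\<And>z. z \<in> Gamma_path \<phi> \<Longrightarrow> f z = g z) \<Longrightarrow> Gamma_decay \<phi> f \<epsilon> C \<longleftrightarrow> Gamma_decay \<phi> g \<epsilon> C"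
  by (simp add: Gamma_decay_def cong: continuous_on_cong)

text \<open>Formally this is (A + B)^-1 by Cauchy's formula: the pole of (B + z)^-1 at z = - B
  evaluates (A - z)^-1 there. The angle is an argument because the solution formula and the calculus
  use different paths.\<close>

definition sum_inverse ::
    "(complex \<Rightarrow> 'a :: complex_banach \<Rightarrow>\<^sub>L 'a) \<Rightarrow> (complex \<Rightarrow> 'a \<Rightarrow>\<^sub>L 'a) \<Rightarrow> real \<Rightarrow> 'a \<Rightarrow>\<^sub>L 'a" where
  "sum_inverse RA RB \<phi> =
     (1 / (2 * of_real pi * \<i>)) *\<^sub>C Gamma_integral \<phi> (\<lambda>z. RA (- z) o\<^sub>L RB z)"

text \<open>The last two bounds on \<phi> put the path into the sector of B and its reflection into
  the sector of A. They can be met together because the two angles add up to more than pi.\<close>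

locale commuting_pair =
  A: resolvent_family RA \<theta>\<^sub>A K\<^sub>A + B: resolvent_family RB \<theta>\<^sub>B K\<^sub>B
  for RA RB :: "complex \<Rightarrow> 'a :: complex_banach \<Rightarrow>\<^sub>L 'a" and \<theta>\<^sub>A K\<^sub>A \<theta>\<^sub>B K\<^sub>B +
  fixes \<phi> :: real
  assumes commute:
      "z \<in> sector \<theta>\<^sub>A \<Longrightarrow> w \<in> sector \<theta>\<^sub>B \<Longrightarrow> RA z o\<^sub>L RB w = RB w o\<^sub>L RA z"
    and phi: "0 < \<phi>" "\<phi> < pi" "\<phi> \<le> \<theta>\<^sub>B" "pi - \<phi> \<le> \<theta>\<^sub>A"
begin

text \<open>Together with \<open>S_swap\<close> this is the symmetry between A and B: a fact about
  \<open>RA\<close> yields its counterpart about \<open>RB\<close> for the same operator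
  \<open>S\<close>.\<close>

lemma swap: "commuting_pair RB RA \<theta>\<^sub>B K\<^sub>B \<theta>\<^sub>A K\<^sub>A (pi - \<phi>)"
  by unfold_locales (use phi commute in auto)

abbreviation S where "S \<equiv> sum_inverse RA RB \<phi>"

lemma commute_apply:
  assumes "z \<in> sector \<theta>\<^sub>A" "w \<in> sector \<theta>\<^sub>B"
  shows "RA z (RB w x) = RB w (RA z x)"
  using arg_cong[OF commute[OF assms], of "\<lambda>T. blinfun_apply T x"] by simp

section \<open>Convergence of the path integral\<close>

lemma path_B: "z \<in> Gamma_path \<phi> \<Longrightarrow> z \<in> sector \<theta>\<^sub>B"
  using Gamma_path_subset_sector[of \<phi> \<theta>\<^sub>B] phi B.angle by auto

lemma path_A: "z \<in> Gamma_path \<phi> \<Longrightarrow> - z \<in> sector \<theta>\<^sub>A"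
  by (rule uminus_Gamma_path_in_sector[of \<phi>]) (use phi A.angle in auto)

lemma continuous_on_path_B: "continuous_on (Gamma_path \<phi>) RB"
  by (rule continuous_on_subset[OF B.continuous_on_R]) (use path_B in auto)

lemma continuous_on_path_A: "continuous_on (Gamma_path \<phi>) (\<lambda>z. RA (- z))"
  by (rule continuous_on_compose2[OF A.continuous_on_R]) (use path_A in \<open>auto intro!: continuous_intros\<close>)

lemma norm_compose_le:
  assumes "- z \<in> sector \<theta>\<^sub>A" "z \<in> sector \<theta>\<^sub>B"
  shows "norm (RA (- z) o\<^sub>L RB z) \<le> K\<^sub>A * K\<^sub>B * (1 + cmod z) powr (-1 - 1)"
proof -
  have "norm (RA (- z) o\<^sub>L RB z) \<le> (K\<^sub>A / (1 + cmod z)) * (K\<^sub>B / (1 + cmod z))"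
    using A.norm_R_le[OF assms(1)] B.norm_R_le[OF assms(2)] A.K_nonneg
    by (intro order_trans[OF norm_blinfun_compose] mult_mono) auto
  then show ?thesis by (simp only: powr_minus_one_minus_one[OF norm_ge_zero]) (simp add: power2_eq_square)
qed

lemma S_decay: "Gamma_decay \<phi> (\<lambda>z. RA (- z) o\<^sub>L RB z) 1 (K\<^sub>A * K\<^sub>B)"
  unfolding Gamma_decay_def
  using continuous_on_path_A continuous_on_path_B norm_compose_le path_A path_B
  by (auto intro!: continuous_intros)

section \<open>Linearity, commutation and symmetry of \<open>S\<close>\<close>

lemma S_linear:
  assumes "bounded_linear h" "\<And>c x. h (c *\<^sub>C x) = c *\<^sub>C h x"
  shows "h S = (1 / (2 * of_real pi * \<i>)) *\<^sub>C Gamma_integral \<phi> (\<lambda>z. h (RA (- z) o\<^sub>L RB z))"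
  unfolding sum_inverse_def assms(2) Gamma_integral_linear[OF S_decay assms] ..

text \<open>Transfers identities between integrands to \<open>S\<close>; they have to be checked
  only where both resolvents are controlled.\<close>

lemma S_linear_cong:
  assumes "bounded_linear h" "\<And>c x. h (c *\<^sub>C x) = c *\<^sub>C h x"
    and "bounded_linear k" "\<And>c x. k (c *\<^sub>C x) = c *\<^sub>C k x"
    and "\<And>z. - z \<in> sector \<theta>\<^sub>A \<Longrightarrow> z \<in> sector \<theta>\<^sub>B \<Longrightarrow> h (RA (- z) o\<^sub>L RB z) = k (RA (- z) o\<^sub>L RB z)"
  shows "h S = k S"
  unfolding S_linear[OF assms(1,2)] S_linear[OF assms(3,4)]
  by (intro arg_cong[where f = "scaleC _"] Gamma_integral_cong assms(5) path_A path_B)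

lemma S_clinear: "S \<in> L_space"
proof -
  have "S (c *\<^sub>C x) = c *\<^sub>C S x" for c x
    by (rule S_linear_cong[where h = "\<lambda>T. T (c *\<^sub>C x)" and k = "\<lambda>T. c *\<^sub>C T x"])
      (auto simp: blinfun_apply_scaleC scaleC_scaleC mult.commute L_spaceD A.clinear B.clinear
        intro!: blinfun.bounded_linear_left bounded_linear_compose[OF bounded_linear_scaleC])
  then show ?thesis by (simp add: L_space_def)
qed

lemma S_commute:
  assumes "T \<in> L_space" "\<And>z. z \<in> sector \<theta>\<^sub>A \<Longrightarrow> T o\<^sub>L RA z = RA z o\<^sub>L T"
    "\<And>z. z \<in> sector \<theta>\<^sub>B \<Longrightarrow> T o\<^sub>L RB z = RB z o\<^sub>L T"
  shows "T o\<^sub>L S = S o\<^sub>L T"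
proof (rule S_linear_cong[where h = "\<lambda>X. T o\<^sub>L X" and k = "\<lambda>X. X o\<^sub>L T"])
  fix z assume z: "- z \<in> sector \<theta>\<^sub>A" "z \<in> sector \<theta>\<^sub>B"
  show "T o\<^sub>L (RA (- z) o\<^sub>L RB z) = (RA (- z) o\<^sub>L RB z) o\<^sub>L T"
    using assms(2)[OF z(1)] assms(3)[OF z(2)] by (metis blinfun_compose_assoc)
qed (simp_all add: blinfun_compose_scaleC_right[OF assms(1)] blinfun_compose_scaleC_left
    blinfun_compose.bounded_linear_right blinfun_compose.bounded_linear_left)

lemma S_RA: "w \<in> sector \<theta>\<^sub>A \<Longrightarrow> S (RA w x) = RA w (S x)"
  using S_commute[of "RA w"] A.commute_self commute A.clinear
  by (metis blinfun_apply_blinfun_compose)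

lemma S_RB: "w \<in> sector \<theta>\<^sub>B \<Longrightarrow> S (RB w x) = RB w (S x)"
  using S_commute[of "RB w"] B.commute_self commute B.clinear
  by (metis blinfun_apply_blinfun_compose)

lemma S_swap: "sum_inverse RB RA (pi - \<phi>) = S"
proof -
  have "Gamma_integral (pi - \<phi>) (\<lambda>z. RB (- z) o\<^sub>L RA z) = Gamma_integral \<phi> (\<lambda>z. RB z o\<^sub>L RA (- z))"
    using Gamma_integral_uminus[of \<phi> "\<lambda>z. RB (- z) o\<^sub>L RA z"] by simp
  also have "\<dots> = Gamma_integral \<phi> (\<lambda>z. RA (- z) o\<^sub>L RB z)"
    by (rule Gamma_integral_cong) (simp add: commute path_A path_B)
  finally show ?thesis by (simp add: sum_inverse_def)
qed

text \<open>The identities A^-1 = (A - z)^-1 - z (A - z)^-1 A^-1 and B^-1 = (B + z)^-1 + z B^-1 (B +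
  z)^-1 carry z with opposite signs. After multiplication with B^-1 (B + z)^-1 and A^-1 (A - z)^-1
  respectively, the terms with z coincide up to sign and cancel.\<close>

lemma integrand_times_sum:
  assumes z: "- z \<in> sector \<theta>\<^sub>A" "z \<in> sector \<theta>\<^sub>B"
  shows "(RA (- z) o\<^sub>L RB z) o\<^sub>L (RA 0 + RB 0) =
    (RA 0 o\<^sub>L (RB 0 o\<^sub>L RB z)) + (RB 0 o\<^sub>L (RA 0 o\<^sub>L RA (- z)))"
proof (rule blinfun_eqI)
  fix x
  note c = commute_apply[OF z] commute_apply[OF zero_in_sector z(2)]
    commute_apply[OF z(1) zero_in_sector] commute_apply[OF zero_in_sector zero_in_sector]
    A.commute_self_apply[OF zero_in_sector z(1)] B.commute_self_apply[OF zero_in_sector z(2)]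
  have "RA 0 (RB z x) = RA (- z) (RB z x) - z *\<^sub>C RA (- z) (RA 0 (RB z x))"
    using A.identity_apply[OF z(1) zero_in_sector, of "RB z x"] by (simp add: algebra_simps)
  from arg_cong[OF this, of "RB 0"]
  have 1: "RB 0 (RA 0 (RB z x)) = RB 0 (RA (- z) (RB z x)) - z *\<^sub>C RB 0 (RA (- z) (RA 0 (RB z x)))"
    by (simp add: blinfun.diff_right L_spaceD B.clinear)
  have "RB 0 (RA (- z) x) = RB z (RA (- z) x) + z *\<^sub>C RB 0 (RB z (RA (- z) x))"
    using B.identity_apply[OF zero_in_sector z(2), of "RA (- z) x"] by (simp add: algebra_simps)
  from arg_cong[OF this, of "RA 0"]
  have 2: "RA 0 (RB 0 (RA (- z) x)) = RA 0 (RB z (RA (- z) x)) + z *\<^sub>C RA 0 (RB 0 (RB z (RA (- z) x)))"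
    by (simp add: blinfun.add_right L_spaceD A.clinear)
  have "RB 0 (RA 0 (RB z x)) + RA 0 (RB 0 (RA (- z) x)) =
      RB 0 (RA (- z) (RB z x)) + RA 0 (RB z (RA (- z) x))"
    unfolding 1 2 by (simp add: c)
  then show "((RA (- z) o\<^sub>L RB z) o\<^sub>L (RA 0 + RB 0)) x =
      ((RA 0 o\<^sub>L (RB 0 o\<^sub>L RB z)) + (RB 0 o\<^sub>L (RA 0 o\<^sub>L RA (- z)))) x"
    by (simp add: blinfun.add_left blinfun.add_right c algebra_simps)
qed

text \<open>\<open>H\<close> decays like 1/|z|^2, but its two summands only like 1/|z|. Hence the
  truncated integrals are split, and the limit is taken for the difference of the two rays.\<close>

lemma S_times_sum: "S o\<^sub>L (RA 0 + RB 0) = RA 0 o\<^sub>L RB 0"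
proof -
  define H where "H z = (RA 0 o\<^sub>L (RB 0 o\<^sub>L RB z)) + (RB 0 o\<^sub>L (RA 0 o\<^sub>L RA (- z)))" for z
  define J where "J R N t = integral {0..N} (ray R t)" for R :: "complex \<Rightarrow> 'a \<Rightarrow>\<^sub>L 'a" and N t
  have H: "(RA (- z) o\<^sub>L RB z) o\<^sub>L (RA 0 + RB 0) = H z" if "z \<in> Gamma_path \<phi>" for z
    unfolding H_def using integrand_times_sum path_A path_B that by blast
  have lin: "bounded_linear (\<lambda>X. X o\<^sub>L (RA 0 + RB 0))" by (rule blinfun_compose.bounded_linear_left)
  obtain C where "Gamma_decay \<phi> (\<lambda>z. (RA (- z) o\<^sub>L RB z) o\<^sub>L (RA 0 + RB 0)) 1 C"
    by (rule Gamma_decay_linear[OF S_decay lin])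
  then have decay: "Gamma_decay \<phi> H 1 C" using H by (simp cong: Gamma_decay_cong)
  have S_eq: "S o\<^sub>L (RA 0 + RB 0) = (1 / (2 * of_real pi * \<i>)) *\<^sub>C Gamma_integral \<phi> H"
    using S_linear[OF lin] H by (simp add: blinfun_compose_scaleC_left cong: Gamma_integral_cong)
  have lim: "((\<lambda>N. J H N \<phi> - J H N (-\<phi>)) \<longlongrightarrow> Gamma_integral \<phi> H) at_top"
    unfolding Gamma_integral_def J_def by (intro tendsto_diff Gamma_decay_ray(3)[OF decay]) auto
  have intB: "ray RB t integrable_on {0..N}" if "t = \<phi> \<or> t = - \<phi>" for t N
    by (intro integrable_continuous_interval continuous_on_subset[OF continuous_on_ray[OF continuous_on_path_B]]
        Gamma_pathI that) auto
  have intA: "ray (\<lambda>z. RA (- z)) t integrable_on {0..N}" if "t = \<phi> \<or> t = - \<phi>" for t N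
    by (intro integrable_continuous_interval continuous_on_subset[OF continuous_on_ray[OF continuous_on_path_A]]
        Gamma_pathI that) auto
  have split: "J H N t = (RA 0 o\<^sub>L (RB 0 o\<^sub>L J RB N t)) + (RB 0 o\<^sub>L (RA 0 o\<^sub>L J (\<lambda>z. RA (- z)) N t))"
    if t: "t = \<phi> \<or> t = - \<phi>" for N t
  proof -
    have L: "RA 0 \<in> L_space" "RB 0 \<in> L_space" by (simp_all add: A.clinear B.clinear)
    have "ray H t = (\<lambda>r. (RA 0 o\<^sub>L (RB 0 o\<^sub>L ray RB t r)) + (RB 0 o\<^sub>L (RA 0 o\<^sub>L ray (\<lambda>z. RA (- z)) t r)))"
      by (auto simp: H_def ray_def scaleC_add_right blinfun_compose_scaleC_right L)
    moreover have bl: "bounded_linear (\<lambda>X. X1 o\<^sub>L (X2 o\<^sub>L X))" for X1 X2 :: "'a \<Rightarrow>\<^sub>L 'a"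
      by (intro bounded_linear_compose[OF blinfun_compose.bounded_linear_right] blinfun_compose.bounded_linear_right)
    ultimately show ?thesis
      unfolding J_def
      using integral_linear[OF intB[OF t] bl[of "RA 0" "RB 0"], of N] integral_linear[OF intA[OF t] bl[of "RB 0" "RA 0"], of N]
        integrable_linear[OF intB[OF t] bl[of "RA 0" "RB 0"], of N] integrable_linear[OF intA[OF t] bl[of "RB 0" "RA 0"], of N]
      by (simp add: Henstock_Kurzweil_Integration.integral_add comp_def)
  qed
  \<comment> \<open>Reflection turns the A-part into an integral of \<open>RA\<close> over the path
    with angle pi - \<phi>; the sign makes up for the interchange of the two rays.\<close>
  have A1: "J (\<lambda>z. RA (- z)) N \<phi> = - J RA N (- (pi - \<phi>))" for N
    unfolding J_def ext[OF ray_uminus[of "\<lambda>z. RA (- z)" \<phi>]] by (simp add: algebra_simps)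
  have A2: "J (\<lambda>z. RA (- z)) N (- \<phi>) = - J RA N (pi - \<phi>)" for N
    unfolding J_def ext[OF ray_uminus'[of "\<lambda>z. RA (- z)" "- \<phi>"]] by (simp add: algebra_simps)
  have "J H N \<phi> - J H N (-\<phi>) =
      (RA 0 o\<^sub>L (RB 0 o\<^sub>L (J RB N \<phi> - J RB N (-\<phi>))))
        + (RB 0 o\<^sub>L (RA 0 o\<^sub>L (J RA N (pi - \<phi>) - J RA N (- (pi - \<phi>)))))" for N
    by (simp add: split A1 A2 blinfun_compose.diff_right blinfun_compose.minus_right)
  \<comment> \<open>The arcs subtend 2 \<phi> for B and 2 (pi - \<phi>) for A, together the full
    angle 2 pi.\<close>
  moreover have "((\<lambda>N. (RA 0 o\<^sub>L (RB 0 o\<^sub>L (J RB N \<phi> - J RB N (-\<phi>))))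
        + (RB 0 o\<^sub>L (RA 0 o\<^sub>L (J RA N (pi - \<phi>) - J RA N (- (pi - \<phi>)))))) \<longlongrightarrow>
      (RA 0 o\<^sub>L ((2 * \<i> * of_real \<phi>) *\<^sub>C RB 0)) + (RB 0 o\<^sub>L ((2 * \<i> * of_real (pi - \<phi>)) *\<^sub>C RA 0))) at_top"
    unfolding J_def
    by (intro tendsto_add blinfun_compose.tendsto tendsto_const
        B.integral_ray_diff_tendsto A.integral_ray_diff_tendsto) (use phi in auto)
  ultimately have "Gamma_integral \<phi> H =
      (RA 0 o\<^sub>L ((2 * \<i> * of_real \<phi>) *\<^sub>C RB 0)) + (RB 0 o\<^sub>L ((2 * \<i> * of_real (pi - \<phi>)) *\<^sub>C RA 0))"
    using tendsto_unique[OF _ lim] by simp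
  also have "\<dots> = (2 * of_real pi * \<i>) *\<^sub>C (RA 0 o\<^sub>L RB 0)"
    by (simp add: blinfun_compose_scaleC_right A.clinear B.clinear commute algebra_simps flip: scaleC_add_left)
  finally show ?thesis unfolding S_eq by (simp add: scaleC_scaleC)
qed

section \<open>\<open>S\<close> as the inverse of the sum\<close>

lemma S_times_sum_apply: "S (RA 0 x) + S (RB 0 x) = RA 0 (RB 0 x)"
  using arg_cong[OF S_times_sum, of "\<lambda>T. blinfun_apply T x"] by (simp add: blinfun.add_left blinfun.add_right)

text \<open>Here a = A x and b = B x. Since A^-1 S a = S x = B^-1 S b, the injective operator A^-1
  B^-1 sends both sides to B^-1 S x + A^-1 S x.\<close>

lemma S_add_eq:
  assumes "x = RA 0 a" "x = RB 0 b"
  shows "S (a + b) = x"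
proof -
  have "RA 0 (RB 0 (S (a + b))) = RB 0 (S (RA 0 a)) + RA 0 (S (RB 0 b))"
    by (simp add: blinfun.add_right S_RA S_RB commute_apply)
  also have "\<dots> = S (RA 0 x) + S (RB 0 x)"
    by (simp add: S_RA S_RB flip: assms)
  also have "\<dots> = RA 0 (RB 0 x)" by (rule S_times_sum_apply)
  finally have "RA 0 (RB 0 (S (a + b) - x)) = 0" by (simp add: blinfun.diff_right)
  then have "S (a + b) - x = 0" using A.inj B.inj by blast
  then show ?thesis by simp
qed

lemma S_inj: assumes "S y = 0" shows "y = 0"
proof -
  have "RA 0 (RB 0 y) = 0"
    using S_times_sum_apply[of y] by (simp add: S_RA S_RB assms)
  then show ?thesis using A.inj B.inj by blast
qed

text \<open>With w = A S y, the vector y - w has to be B S y: cancel A^-1 in A^-1 S y + B^-1 S y =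
  A^-1 B^-1 y.\<close>

lemma S_eq_RB_if_RA:
  assumes "S y = RA 0 w"
  shows "S y = RB 0 (y - w)"
proof -
  have "RA 0 (S y) + RB 0 (RA 0 w) = RA 0 (RB 0 y)"
    using S_times_sum_apply[of y] by (simp add: S_RA S_RB assms)
  then have "RA 0 (S y - RB 0 (y - w)) = 0"
    by (simp add: blinfun.diff_right blinfun.add_right commute_apply algebra_simps)
  then have "S y - RB 0 (y - w) = 0" by (rule A.inj)
  then show ?thesis by simp
qed

section \<open>Regularity of the values of \<open>S\<close>\<close>

text \<open>The exponent \<open>\<delta>\<close> makes \<open>A (A - z)\<^sup>-\<^sup>1 (B + z)\<^sup>-\<^sup>1 y\<close> integrable over the path.\<close>

lemma S_in_range_RA:
  assumes "0 < \<delta>"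
    and nice: "\<And>z. z \<in> sector \<theta>\<^sub>A \<Longrightarrow> norm (y - z *\<^sub>C RA z y) \<le> C * (1 + cmod z) powr (-\<delta>)"
  obtains w where "S y = RA 0 w"
proof -
  \<comment> \<open>Since y + z (A - z)^-1 y = A (A - z)^-1 y, this is A applied to the integrand.
    Pulling \<open>RA 0\<close> out of its integral takes the place of closedness of A.\<close>
  define g where "g z = RB z (y - (- z) *\<^sub>C RA (- z) y)" for z
  have decay: "Gamma_decay \<phi> g \<delta> (K\<^sub>B * C)"
    unfolding Gamma_decay_def
  proof (intro conjI ballI)
    show "continuous_on (Gamma_path \<phi>) g"
      unfolding g_def
      by (intro blinfun.continuous_on continuous_intros continuous_on_path_A continuous_on_path_B)
    fix z assume z: "z \<in> Gamma_path \<phi>"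
    have "norm (g z) \<le> norm (RB z) * norm (y - (- z) *\<^sub>C RA (- z) y)"
      unfolding g_def by (rule norm_blinfun)
    also have "\<dots> \<le> (K\<^sub>B / (1 + cmod z)) * (C * (1 + cmod z) powr (-\<delta>))"
      using B.norm_R_le[OF path_B[OF z]] nice[OF path_A[OF z]] B.K_nonneg by (intro mult_mono) auto
    also have "\<dots> = K\<^sub>B * C * (1 + cmod z) powr (-1 - \<delta>)"
      by (simp add: powr_diff powr_minus divide_simps add_nonneg_eq_0_iff)
    finally show "norm (g z) \<le> K\<^sub>B * C * (1 + cmod z) powr (-1 - \<delta>)" .
  qed fact
  have L: "RA 0 \<in> L_space" by (simp add: A.clinear)
  have "RA 0 (g z) = RA (- z) (RB z y)" if z: "z \<in> Gamma_path \<phi>" for z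
  proof -
    have "RA 0 (g z) = RB z (RA 0 y + z *\<^sub>C RA 0 (RA (- z) y))"
      by (simp add: g_def commute_apply path_B[OF z] blinfun.add_right scaleC.minus_left L_spaceD[OF L])
    also have "RA 0 y + z *\<^sub>C RA 0 (RA (- z) y) = RA (- z) y"
      using A.identity_apply[OF zero_in_sector path_A[OF z], of y]
      by (simp add: scaleC.minus_left algebra_simps)
    finally show ?thesis using z by (simp add: commute_apply path_A path_B)
  qed
  then have "RA 0 (Gamma_integral \<phi> g) = Gamma_integral \<phi> (\<lambda>z. RA (- z) (RB z y))"
    unfolding Gamma_integral_linear[OF decay blinfun.bounded_linear_right L_spaceD[OF L]]
    by (rule Gamma_integral_cong)
  then have "S y = RA 0 ((1 / (2 * of_real pi * \<i>)) *\<^sub>C Gamma_integral \<phi> g)"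
    using S_linear[OF blinfun.bounded_linear_left, of y]
    by (simp add: blinfun_apply_scaleC L_spaceD[OF L])
  then show ?thesis by (rule that)
qed

text \<open>For any x, x - s (A + s)^-1 x equals A (A + s)^-1 x, whose decay in s measures
  smoothness of x. It suffices to estimate Q = A (A + s)^-1 (A + w)^-1 with w = - z on the path. Q
  is symmetric in s and w, hence bounded by M / (1 + |s|) as well as by M / (1 + |w|). A weighted
  geometric mean of the two bounds gives |s|^(-\<delta>) and leaves |w|^(-(1 - \<delta>)), which is
  integrable together with (B + z)^-1.\<close>

lemma norm_S_minus_resolvent_le:
  assumes "0 < \<delta>" "\<delta> < 1"
  obtains C where "0 \<le> C" "\<And>s. s \<in> sector \<theta>\<^sub>A \<Longrightarrow>
    norm (S y - s *\<^sub>C RA s (S y)) \<le> C * (1 + cmod s) powr (-\<delta>)"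
proof -
  \<comment> \<open>\<open>1 + K\<^sub>A\<close> bounds A (A + s)^-1; the second factor comes from
    (A + w)^-1.\<close>
  define M where "M = (1 + K\<^sub>A) * K\<^sub>A"
  have "0 \<le> M" using A.K_nonneg by (simp add: M_def)
  have Q: "norm (RA w - s *\<^sub>C (RA s o\<^sub>L RA w)) \<le> M / (1 + cmod w)"
    if w: "w \<in> sector \<theta>\<^sub>A" and s: "s \<in> sector \<theta>\<^sub>A" for w s
  proof -
    have "cmod s * norm (RA s) \<le> (1 + cmod s) * norm (RA s)" by (intro mult_right_mono) auto
    also have "\<dots> \<le> K\<^sub>A" by (rule A.bound[OF s])
    finally have "cmod s * norm (RA s) \<le> K\<^sub>A" .
    moreover have "norm (s *\<^sub>C (RA s o\<^sub>L RA w)) \<le> (cmod s * norm (RA s)) * norm (RA w)"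
      unfolding norm_scaleC mult.assoc by (intro mult_left_mono norm_blinfun_compose) auto
    ultimately have "norm (RA w - s *\<^sub>C (RA s o\<^sub>L RA w)) \<le> norm (RA w) + K\<^sub>A * norm (RA w)"
      by (smt (verit) norm_triangle_ineq4 mult_right_mono norm_ge_zero)
    also have "\<dots> = (1 + K\<^sub>A) * norm (RA w)" by (simp add: algebra_simps)
    also have "\<dots> \<le> (1 + K\<^sub>A) * (K\<^sub>A / (1 + cmod w))"
      using A.norm_R_le[OF w] A.K_nonneg by (intro mult_left_mono) auto
    finally show ?thesis by (simp add: M_def)
  qed
  have Q_sym: "RA w - s *\<^sub>C (RA s o\<^sub>L RA w) = RA s - w *\<^sub>C (RA w o\<^sub>L RA s)"
    if "w \<in> sector \<theta>\<^sub>A" "s \<in> sector \<theta>\<^sub>A" for w s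
    using A.resolvent_identity[OF that] A.commute_self[OF that] by (simp add: scaleC.diff_left algebra_simps)
  have Q_le: "norm (RA w - s *\<^sub>C (RA s o\<^sub>L RA w)) \<le> M * (1 + cmod s) powr (-\<delta>) * (1 + cmod w) powr (- (1 - \<delta>))"
    if w: "w \<in> sector \<theta>\<^sub>A" and s: "s \<in> sector \<theta>\<^sub>A" for w s
  proof -
    define q where "q = norm (RA w - s *\<^sub>C (RA s o\<^sub>L RA w))"
    have q: "q \<le> M / (1 + cmod w)" "q \<le> M / (1 + cmod s)"
      unfolding q_def using Q[OF w s] Q[OF s w] Q_sym[OF w s] by simp_all
    have "0 \<le> q" by (simp add: q_def)
    have "q = q powr \<delta> * q powr (1 - \<delta>)"
      using \<open>0 \<le> q\<close> by (cases "q = 0") (simp_all flip: powr_add)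
    also have "\<dots> \<le> (M / (1 + cmod s)) powr \<delta> * (M / (1 + cmod w)) powr (1 - \<delta>)"
      using q \<open>0 \<le> q\<close> assms by (intro mult_mono powr_mono2) auto
    also have "\<dots> = (M powr \<delta> * M powr (1 - \<delta>)) * (1 + cmod s) powr (-\<delta>) * (1 + cmod w) powr (- (1 - \<delta>))"
      unfolding powr_minus_divide using \<open>0 \<le> M\<close> by (simp add: powr_divide)
    also have "M powr \<delta> * M powr (1 - \<delta>) = M"
      using \<open>0 \<le> M\<close> by (cases "M = 0") (simp_all flip: powr_add)
    finally show ?thesis by (simp add: q_def)
  qed
  \<comment> \<open>1 / (2 pi) is the prefactor of the integral, 2 counts its rays, and 1 - \<delta>
    is the decay exponent that is left over.\<close>
  define C where "C = norm y * (1 / (2 * pi) * (2 * (M * K\<^sub>B / (1 - \<delta>))))"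
  show ?thesis
  proof (rule that)
    show "0 \<le> C" using \<open>0 \<le> M\<close> B.K_nonneg assms by (simp add: C_def)
    fix s assume s: "s \<in> sector \<theta>\<^sub>A"
    define h where "h X = X - s *\<^sub>C (RA s o\<^sub>L X)" for X :: "'a \<Rightarrow>\<^sub>L 'a"
    have lin: "bounded_linear h"
      unfolding h_def
      by (intro bounded_linear_sub bounded_linear_ident blinfun_compose.bounded_linear_right
          bounded_linear_compose[OF bounded_linear_scaleC])
    have clin: "h (c *\<^sub>C X) = c *\<^sub>C h X" for c X
      by (simp add: h_def scaleC.diff_right blinfun_compose_scaleC_right A.clinear[OF s] scaleC_scaleC mult.commute)
    define Ks where "Ks = M * K\<^sub>B * (1 + cmod s) powr (-\<delta>)"
    have "Gamma_decay \<phi> (\<lambda>z. h (RA (- z) o\<^sub>L RB z)) (1 - \<delta>) Ks"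
      unfolding Gamma_decay_def
    proof (intro conjI ballI)
      show "continuous_on (Gamma_path \<phi>) (\<lambda>z. h (RA (- z) o\<^sub>L RB z))"
        by (intro bounded_linear.continuous_on[OF lin] continuous_intros continuous_on_path_A continuous_on_path_B)
      fix z assume z: "z \<in> Gamma_path \<phi>"
      have "h (RA (- z) o\<^sub>L RB z) = (RA (- z) - s *\<^sub>C (RA s o\<^sub>L RA (- z))) o\<^sub>L RB z"
        by (simp add: h_def blinfun_compose.diff_left blinfun_compose_scaleC_left blinfun_compose_assoc)
      also have "norm \<dots> \<le> norm (RA (- z) - s *\<^sub>C (RA s o\<^sub>L RA (- z))) * norm (RB z)"
        by (rule norm_blinfun_compose)
      also have "\<dots> \<le> (M * (1 + cmod s) powr (-\<delta>) * (1 + cmod z) powr (- (1 - \<delta>))) * (K\<^sub>B / (1 + cmod z))"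
        using Q_le[OF path_A[OF z] s] B.norm_R_le[OF path_B[OF z]] \<open>0 \<le> M\<close> by (intro mult_mono) auto
      also have "\<dots> = Ks * (1 + cmod z) powr (-1 - (1 - \<delta>))"
        by (simp add: Ks_def powr_diff powr_minus divide_simps add_nonneg_eq_0_iff power2_eq_square)
      finally show "norm (h (RA (- z) o\<^sub>L RB z)) \<le> Ks * (1 + cmod z) powr (-1 - (1 - \<delta>))" .
    qed (use assms in simp)
    then have "norm (h S) \<le> 1 / (2 * pi) * (2 * (Ks / (1 - \<delta>)))"
      unfolding S_linear[OF lin clin] norm_scaleC
      by (intro mult_mono norm_Gamma_integral_le) (auto simp: norm_divide norm_mult)
    then have "norm (h S) * norm y \<le> (1 / (2 * pi) * (2 * (Ks / (1 - \<delta>)))) * norm y"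
      by (rule mult_right_mono) simp
    also have "\<dots> = C * (1 + cmod s) powr (-\<delta>)" by (simp add: C_def Ks_def)
    finally have "norm (h S) * norm y \<le> C * (1 + cmod s) powr (-\<delta>)" .
    moreover have "S y - s *\<^sub>C RA s (S y) = h S y"
      by (simp add: h_def blinfun.diff_left blinfun_apply_scaleC)
    ultimately show "norm (S y - s *\<^sub>C RA s (S y)) \<le> C * (1 + cmod s) powr (-\<delta>)"
      using order_trans[OF norm_blinfun] by metis
  qed
qed

end


section \<open>Complex derivatives of products\<close>

lemma has_derivative_scaleC_product:
  assumes u: "(u has_field_derivative D) (at z within T)"
    and v: "(v has_derivative (\<lambda>h. h *\<^sub>C E)) (at z within T)"
  shows "((\<lambda>z. u z *\<^sub>C v z) has_derivative (\<lambda>h. h *\<^sub>C (u z *\<^sub>C E + D *\<^sub>C v z))) (at z within T)"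
  using scaleC.FDERIV[OF u[unfolded has_field_derivative_def] v]
  by (simp add: scaleC_add_right scaleC_scaleC mult.commute)

text \<open>\<open>u z\<close> has to be complex linear because the complex increment h is moved
  through it.\<close>

lemma has_derivative_compose_product:
  fixes u v :: "complex \<Rightarrow> 'a :: complex_banach \<Rightarrow>\<^sub>L 'a"
  assumes u: "(u has_derivative (\<lambda>h. h *\<^sub>C D)) (at z within T)"
    and v: "(v has_derivative (\<lambda>h. h *\<^sub>C E)) (at z within T)" and "u z \<in> L_space"
  shows "((\<lambda>z. u z o\<^sub>L v z) has_derivative (\<lambda>h. h *\<^sub>C ((u z o\<^sub>L E) + (D o\<^sub>L v z)))) (at z within T)"
  using blinfun_compose.FDERIV[OF u v] assms(3)
  by (simp add: scaleC_add_right blinfun_compose_scaleC_left blinfun_compose_scaleC_right)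

lemma has_derivative_comp_uminus:
  assumes "(v has_derivative (\<lambda>h. h *\<^sub>C D)) (at (- z) within uminus ` T)"
  shows "((\<lambda>z. v (- z)) has_derivative (\<lambda>h. h *\<^sub>C (- D))) (at z within T)"
proof -
  have "((\<lambda>z. - z) has_derivative (\<lambda>h. - h)) (at z within T)" by (intro derivative_intros)
  from has_derivative_in_compose[OF this assms] show ?thesis
    by (simp add: scaleC.minus_left scaleC.minus_right)
qed


section \<open>The calculus of a sectorial operator\<close>

text \<open>Trades exponential decay for one power: 1 + x is at most (1 + 1/a) (1 + a x), and 1 + a
  x is at most exp (a x).\<close>

lemma exp_minus_le_inverse:
  assumes "0 < a" "0 \<le> (x::real)"
  shows "exp (- a * x) \<le> (1 + 1 / a) / (1 + x)"
proof -
  have "1 + x \<le> (1 + 1 / a) * (1 + a * x)" using assms by (simp add: field_simps)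
  also have "\<dots> \<le> (1 + 1 / a) * exp (a * x)"
    using assms by (intro mult_left_mono exp_ge_add_one_self) auto
  finally have "(1 + x) * exp (- a * x) \<le> (1 + 1 / a) * exp (a * x) * exp (- a * x)"
    by (rule mult_right_mono) simp
  also have "\<dots> = 1 + 1 / a" by (simp add: exp_minus)
  finally show ?thesis using assms by (simp add: pos_le_divide_eq mult.commute)
qed

text \<open>|w| bounds the difference for small w and 2 for large w; the square root covers both.
  With w = \<delta> z, a linear bound would leave only 1/|z| of the decay 1/|z|^2 of the integrand,
  whereas the root leaves the integrable |z|^(-3/2).\<close>

lemma norm_exp_minus_diff_one_le:
  assumes "0 \<le> Re w"
  shows "cmod (exp (- w) - 1) \<le> 2 * sqrt (cmod w)"
proof (cases "cmod w \<le> 1")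
  case True
  have "cmod (exp (- w) - exp (- 0)) \<le> 1 * cmod (w - 0)"
  proof (rule field_differentiable_bound[where S = "{z. 0 \<le> Re z}"])
    show "((\<lambda>z. exp (- z)) has_field_derivative - exp (- z)) (at z within {z. 0 \<le> Re z})" for z :: complex
      by (auto intro!: derivative_eq_intros)
  qed (use assms in \<open>auto simp: convex_halfspace_Re_ge\<close>)
  also have "\<dots> \<le> sqrt (cmod w)"
    using True real_le_rsqrt[of "cmod w" "cmod w"] by (simp add: power2_eq_square mult_left_le)
  also have "\<dots> \<le> 2 * sqrt (cmod w)" by simp
  finally show ?thesis by simp
next
  case False
  have "cmod (exp (- w) - 1) \<le> cmod (exp (- w)) + 1" using norm_triangle_ineq4[of "exp (- w)" 1] by simp
  also have "\<dots> \<le> 2" using assms by simp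
  also have "\<dots> \<le> 2 * sqrt (cmod w)" using False by simp
  finally show ?thesis .
qed

context commuting_pair
begin

section \<open>Independence of the angle of the path\<close>

lemma has_derivative_integrand:
  assumes "- z \<in> sector \<theta>\<^sub>A" "z \<in> sector \<theta>\<^sub>B" and "uminus ` T \<subseteq> sector \<theta>\<^sub>A" "T \<subseteq> sector \<theta>\<^sub>B"
  shows "((\<lambda>z. RA (- z) o\<^sub>L RB z) has_derivative (\<lambda>h. h *\<^sub>C
    ((RA (- z) o\<^sub>L - (RB z o\<^sub>L RB z)) + (- (- (RA (- z) o\<^sub>L RA (- z))) o\<^sub>L RB z)))) (at z within T)"
  by (intro has_derivative_compose_product has_derivative_comp_uminus
      A.has_derivative_R B.has_derivative_R A.clinear assms)

lemma S_rotate: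
  assumes psi: "0 < \<psi>" "\<psi> \<le> \<phi>" "pi - \<psi> \<le> \<theta>\<^sub>A"
  shows "sum_inverse RA RB \<psi> = S"
proof -
  \<comment> \<open>Angles of modulus between \<psi> and \<phi> keep z in the sector of B and -z in
    that of A. The upper and the lower ray are rotated separately, because -z leaves the sector of A
    on the positive axis.\<close>
  have eq: "integral {0..} (ray (\<lambda>z. RA (- z) o\<^sub>L RB z) a) = integral {0..} (ray (\<lambda>z. RA (- z) o\<^sub>L RB z) b)"
    if "a \<le> b" and ab: "\<And>t. a \<le> t \<Longrightarrow> t \<le> b \<Longrightarrow> \<psi> \<le> \<bar>t\<bar> \<and> \<bar>t\<bar> \<le> \<phi>" for a b
  proof -
    have wB: "wedge a b \<subseteq> sector \<theta>\<^sub>B"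
      using ab phi B.angle by (fastforce simp: wedge_def intro!: polar_in_sector)
    have wA: "uminus ` wedge a b \<subseteq> sector \<theta>\<^sub>A"
      using ab phi psi A.angle by (fastforce simp: wedge_def intro!: uminus_polar_in_sector)
    have cA: "continuous_on (wedge a b) (\<lambda>z. RA (- z))"
      using wA by (intro continuous_on_compose2[OF A.continuous_on_R]) (auto intro!: continuous_intros)
    have cB: "continuous_on (wedge a b) RB"
      using wB by (rule continuous_on_subset[OF B.continuous_on_R])
    show ?thesis
      by (rule integral_ray_eq[OF \<open>a \<le> b\<close> zero_less_one has_derivative_integrand _ norm_compose_le])
        (use wA wB in \<open>auto intro!: continuous_intros cA cB\<close>)
  qed
  have "Gamma_integral \<psi> (\<lambda>z. RA (- z) o\<^sub>L RB z) = Gamma_integral \<phi> (\<lambda>z. RA (- z) o\<^sub>L RB z)"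
    unfolding Gamma_integral_def
    by (intro arg_cong2[of _ _ _ _ minus] eq eq[symmetric]) (use psi in auto)
  then show ?thesis by (simp add: sum_inverse_def)
qed

text \<open>Here u = B S y with y in D(A) + D(B), and \<open>bnd\<close> says that S A is bounded by
  C on D(A). Applied to w = A (A + s)^-1 y with s = m > 0, it bounds s (A + s)^-1 A S y by C times
  the norm of s (A + s)^-1 y, thus by \<open>C * K\<^sub>A * norm y\<close>. As A S y = y - u, this
  bounds s (A + s)^-1 u, which converges to u as m grows.\<close>

lemma norm_RB_preimage_le:
  assumes bnd: "\<And>w. norm (S w) \<le> C * norm (RA 0 w)" and "0 \<le> C"
    and y: "y = RA 0 a + RB 0 b" and u: "S y = RB 0 u"
  shows "norm u \<le> (1 + C) * K\<^sub>A * norm y"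
proof -
  interpret sw: commuting_pair RB RA \<theta>\<^sub>B K\<^sub>B \<theta>\<^sub>A K\<^sub>A "pi - \<phi>" by (rule swap)
  define v where "v = y - u"
  have Sv: "S y = RA 0 v"
    using sw.S_eq_RB_if_RA[of y u] u by (simp add: S_swap v_def)
  have "RB 0 (u - (RA 0 a + S (b - a))) = 0"
  proof -
    have "S (RA 0 a) = RB 0 (RA 0 a - S a)" by (rule S_eq_RB_if_RA) (simp add: S_RA)
    then have "S y = RB 0 (RA 0 a + S (b - a))"
      by (simp add: y blinfun.add_right blinfun.diff_right S_RB)
    with u show ?thesis by (simp add: blinfun.diff_right)
  qed
  \<comment> \<open>Written as an element of D(A) plus a value of \<open>S\<close>, u is
    approximated by s (A + s)^-1 u at a rate; the exponent 1/2 below is an arbitrary choice between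
    0 and 1.\<close>
  then have u_eq: "u = RA 0 a + S (b - a)" using B.inj by fastforce
  obtain C1 where C1: "0 \<le> C1" "\<And>s. s \<in> sector \<theta>\<^sub>A \<Longrightarrow>
      norm (S (b - a) - s *\<^sub>C RA s (S (b - a))) \<le> C1 * (1 + cmod s) powr (-(1/2))"
    using norm_S_minus_resolvent_le[of "1/2" "b - a"] by auto
  have est: "norm u - (1 + C) * K\<^sub>A * norm y \<le> (C1 + K\<^sub>A * norm a) * (1 + m) powr (-(1/2))" if "0 \<le> m" for m
  proof -
    define s where "s = complex_of_real m"
    have s: "s \<in> sector \<theta>\<^sub>A" "cmod s = m" using that A.angle by (auto simp: s_def intro: of_real_in_sector)
    have sR: "norm (s *\<^sub>C RA s x) \<le> K\<^sub>A * norm x" for x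
    proof -
      have "norm (s *\<^sub>C RA s x) \<le> (cmod s * norm (RA s)) * norm x"
        unfolding norm_scaleC mult.assoc by (intro mult_left_mono norm_blinfun) auto
      also have "\<dots> \<le> ((1 + cmod s) * norm (RA s)) * norm x" by (intro mult_right_mono) auto
      also have "\<dots> \<le> K\<^sub>A * norm x" by (intro mult_right_mono A.bound s) auto
      finally show ?thesis .
    qed
    have id: "RA 0 x = RA s x + s *\<^sub>C RA 0 (RA s x)" for x
      using A.identity_apply[OF zero_in_sector s(1), of x] by (simp add: algebra_simps)
    have c: "RA 0 (c *\<^sub>C x) = c *\<^sub>C RA 0 x" "RA s (c *\<^sub>C x) = c *\<^sub>C RA s x"
       "S (c *\<^sub>C x) = c *\<^sub>C S x" for c x
      using A.clinear[OF zero_in_sector] A.clinear[OF s(1)] S_clinear by (simp_all add: L_spaceD)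
    have "RA 0 (y - s *\<^sub>C RA s y) = RA s y"
      using id[of y] by (simp add: blinfun.diff_right c)
    moreover have "S (y - s *\<^sub>C RA s y) = RA 0 v - s *\<^sub>C RA 0 (RA s v)"
      by (simp add: blinfun.diff_right c S_RA s Sv A.commute_self_apply[OF s(1) zero_in_sector])
    then have "S (y - s *\<^sub>C RA s y) = RA s v" by (subst (asm) id[of v]) simp
    ultimately have "norm (RA s v) \<le> C * norm (RA s y)" using bnd by metis
    then have "cmod s * norm (RA s v) \<le> cmod s * (C * norm (RA s y))" by (intro mult_left_mono) auto
    also have "\<dots> = C * norm (s *\<^sub>C RA s y)" by (simp add: norm_scaleC)
    also have "\<dots> \<le> C * (K\<^sub>A * norm y)" using sR \<open>0 \<le> C\<close> by (intro mult_left_mono)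
    finally have nv: "norm (s *\<^sub>C RA s v) \<le> C * K\<^sub>A * norm y" by (simp add: norm_scaleC mult_ac)
    have "u - s *\<^sub>C RA s u =
        (S (b - a) - s *\<^sub>C RA s (S (b - a))) + (RA 0 a - s *\<^sub>C RA 0 (RA s a))"
      by (simp add: u_eq blinfun.add_right scaleC_add_right A.commute_self_apply[OF s(1) zero_in_sector])
    also have "RA 0 a - s *\<^sub>C RA 0 (RA s a) = RA s a" by (subst id[of a]) simp
    also have "norm ((S (b - a) - s *\<^sub>C RA s (S (b - a))) + RA s a) \<le> C1 * (1 + m) powr (-(1/2)) + K\<^sub>A / (1 + m) * norm a"
      using C1(2)[OF s(1)] A.norm_R_le[OF s(1)] s(2)
      by (intro order_trans[OF norm_triangle_ineq] add_mono order_trans[OF norm_blinfun] mult_right_mono) auto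
    also have "K\<^sub>A / (1 + m) * norm a \<le> K\<^sub>A * norm a * (1 + m) powr (-(1/2))"
    proof -
      have "(1 + m) powr (-1) \<le> (1 + m) powr (-(1/2))" using that by (intro powr_mono) auto
      then have "(K\<^sub>A * norm a) * (1 + m) powr (-1) \<le> (K\<^sub>A * norm a) * (1 + m) powr (-(1/2))"
        using A.K_nonneg by (intro mult_left_mono) auto
      then show ?thesis using that by (simp add: powr_minus_divide)
    qed
    finally have 1: "norm (u - s *\<^sub>C RA s u) \<le> (C1 + K\<^sub>A * norm a) * (1 + m) powr (-(1/2))"
      by (simp add: algebra_simps)
    have "u = (u - s *\<^sub>C RA s u) + (s *\<^sub>C RA s y - s *\<^sub>C RA s v)"
      by (simp add: v_def blinfun.diff_right scaleC.diff_right)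
    also have "norm \<dots> \<le> norm (u - s *\<^sub>C RA s u) + (norm (s *\<^sub>C RA s y) + norm (s *\<^sub>C RA s v))"
      by (intro order_trans[OF norm_triangle_ineq] add_mono norm_triangle_ineq4) auto
    finally show ?thesis using 1 nv sR[of y] by (simp add: algebra_simps)
  qed
  have "norm u - (1 + C) * K\<^sub>A * norm y \<le> 0"
    by (rule tendsto_lowerbound[OF powr_minus_at_top[of "1/2" "C1 + K\<^sub>A * norm a"]])
      (use est in \<open>auto intro: eventually_at_top_linorderI[of 0]\<close>)
  then show ?thesis by simp
qed

text \<open>B S is bounded on the dense subspace D(A) + D(B), so approximating y yields a Cauchy
  sequence of images; continuity of B^-1 identifies its limit as a preimage of S y.\<close>

lemma S_in_range_RB:
  assumes bnd: "\<And>w. norm (S w) \<le> C * norm (RA 0 w)" and "0 \<le> C"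
    and dense: "closure {RA 0 a + RB 0 b | a b. True} = UNIV"
  obtains u where "S y = RB 0 u"
proof -
  define M where "M = (1 + C) * K\<^sub>A"
  have "0 \<le> M" using \<open>0 \<le> C\<close> A.K_nonneg by (simp add: M_def)
  have "y \<in> closure {RA 0 a + RB 0 b | a b. True}" unfolding dense by simp
  then obtain Y where Y: "\<And>n::nat. \<exists>a b. Y n = RA 0 a + RB 0 b" and lim: "Y \<longlonglongrightarrow> y"
    unfolding closure_sequential by auto
  from Y obtain a b where ab: "\<And>n. Y n = RA 0 (a n) + RB 0 (b n)" by metis
  define u where "u n = RA 0 (a n) - S (a n) + S (b n)" for n
  have u: "S (Y n) = RB 0 (u n)" for n
  proof -
    have "S (RA 0 (a n)) = RB 0 (RA 0 (a n) - S (a n))" by (rule S_eq_RB_if_RA) (simp add: S_RA)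
    then show ?thesis by (simp add: ab u_def blinfun.add_right blinfun.diff_right S_RB)
  qed
  have diff: "norm (u m - u n) \<le> M * norm (Y m - Y n)" for m n
    unfolding M_def
    by (rule norm_RB_preimage_le[OF bnd \<open>0 \<le> C\<close>, where a = "a m - a n" and b = "b m - b n"])
      (simp_all add: ab u blinfun.diff_right blinfun.add_right flip: u)
  have "Cauchy u"
  proof (rule CauchyI)
    fix e :: real assume "0 < e"
    then have "0 < e / (M + 1)" using \<open>0 \<le> M\<close> by simp
    then obtain N where N: "\<And>m n. N \<le> m \<Longrightarrow> N \<le> n \<Longrightarrow> norm (Y m - Y n) < e / (M + 1)"
      using CauchyD[OF LIMSEQ_imp_Cauchy[OF lim]] by metis
    have "norm (u m - u n) < e" if "N \<le> m" "N \<le> n" for m n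
    proof -
      have "norm (u m - u n) \<le> (M + 1) * norm (Y m - Y n)" 
        using diff[of m n] by (simp add: algebra_simps add_increasing)
      also have "\<dots> < e" using N[OF that] \<open>0 \<le> M\<close> by (simp add: field_simps)
      finally show ?thesis .
    qed
    then show "\<exists>N. \<forall>m\<ge>N. \<forall>n\<ge>N. norm (u m - u n) < e" by blast
  qed
  then obtain l where l: "u \<longlonglongrightarrow> l" by (auto simp: Cauchy_convergent_iff convergent_def)
  have "(\<lambda>n. RB 0 (u n)) \<longlonglongrightarrow> RB 0 l" by (intro tendsto_intros l)
  moreover have "(\<lambda>n. RB 0 (u n)) \<longlonglongrightarrow> S y" unfolding u[symmetric] by (intro tendsto_intros lim)
  ultimately have "S y = RB 0 l" using LIMSEQ_unique by blast
  then show ?thesis by (rule that)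
qed

section \<open>Test functions for the calculus\<close>

text \<open>Integrand \<open>\<lambda> (B - \<lambda>)\<^sup>-\<^sup>1 e\<^sup>\<delta>\<^sup>\<lambda>\<close> of the calculus, which approximates
  \<open>- A (A + B)\<^sup>-\<^sup>1\<close> as \<open>\<delta>\<close> tends to \<open>0\<close>.\<close>

definition calculus_fun :: "real \<Rightarrow> complex \<Rightarrow> 'a \<Rightarrow>\<^sub>L 'a" where
  "calculus_fun \<delta> \<zeta> = (\<zeta> * exp (of_real \<delta> * \<zeta>)) *\<^sub>C RB (- \<zeta>)"

text \<open>What the calculus sees of \<open>S\<close>: up to sign, the value of
  \<open>calculus_fun\<close> composed with A^-1. The damping is exp (\<delta> \<zeta>) in the
  variable z = - \<zeta>.\<close>

definition regularised :: "real \<Rightarrow> 'a \<Rightarrow>\<^sub>L 'a" where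
  "regularised \<delta> = (1 / (2 * of_real pi * \<i>)) *\<^sub>C
     Gamma_integral \<phi> (\<lambda>z. exp (- (of_real \<delta> * z)) *\<^sub>C (RA (- z) o\<^sub>L RB z))"

lemma norm_exp_minus_le:
  assumes "z \<in> sector \<phi>" "0 \<le> \<delta>"
  shows "cmod (exp (- (of_real \<delta> * z))) \<le> exp (- (\<delta> * cos \<phi>) * cmod z)"
proof -
  have "\<delta> * (cos \<phi> * cmod z) \<le> \<delta> * Re z"
    using Re_ge_if_in_sector[OF assms(1)] phi \<open>0 \<le> \<delta>\<close> by (intro mult_left_mono) auto
  then show ?thesis by (simp add: mult_ac)
qed

lemma Re_nonneg:
  assumes "z \<in> sector \<phi>" "\<phi> < pi / 2"
  shows "0 \<le> Re z"
proof -
  have "0 \<le> cos \<phi> * cmod z" using assms phi by (intro mult_nonneg_nonneg cos_ge_zero) auto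
  also have "\<dots> \<le> Re z" using Re_ge_if_in_sector[OF assms(1)] phi by simp
  finally show ?thesis .
qed

lemma norm_calculus_fun_le:
  assumes "- \<zeta> \<in> sector \<phi>" "0 \<le> \<delta>"
  shows "norm (calculus_fun \<delta> \<zeta>) \<le> K\<^sub>B * (cmod \<zeta> / (1 + cmod \<zeta>)) * exp (- (\<delta> * cos \<phi>) * cmod \<zeta>)"
proof -
  have "- \<zeta> \<in> sector \<theta>\<^sub>B" using assms(1) sector_mono[OF phi(3)] by auto
  then have "norm (RB (- \<zeta>)) \<le> K\<^sub>B / (1 + cmod \<zeta>)" using B.norm_R_le by fastforce
  moreover have "cmod (exp (of_real \<delta> * \<zeta>)) \<le> exp (- (\<delta> * cos \<phi>) * cmod \<zeta>)"
    using norm_exp_minus_le[OF assms] by simp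
  ultimately have "cmod \<zeta> * cmod (exp (of_real \<delta> * \<zeta>)) * norm (RB (- \<zeta>)) \<le>
      cmod \<zeta> * exp (- (\<delta> * cos \<phi>) * cmod \<zeta>) * (K\<^sub>B / (1 + cmod \<zeta>))"
    by (intro mult_mono mult_left_mono) (auto intro!: mult_nonneg_nonneg)
  then show ?thesis by (simp add: calculus_fun_def norm_scaleC norm_mult mult_ac)
qed

text \<open>Uniformity in \<delta> is the point: the bound from the calculus then survives the limit
  \<delta> to 0.\<close>

lemma norm_calculus_fun_le_K:
  assumes "- \<zeta> \<in> sector \<phi>" "0 \<le> \<delta>" "\<phi> < pi / 2"
  shows "norm (calculus_fun \<delta> \<zeta>) \<le> K\<^sub>B"
proof -
  have "0 \<le> cos \<phi>" using assms phi by (intro cos_ge_zero) auto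
  then have "exp (- (\<delta> * cos \<phi>) * cmod \<zeta>) \<le> 1" using assms by simp
  moreover have "cmod \<zeta> / (1 + cmod \<zeta>) \<le> 1" by (simp add: divide_le_eq add_pos_nonneg)
  ultimately have "(cmod \<zeta> / (1 + cmod \<zeta>)) * exp (- (\<delta> * cos \<phi>) * cmod \<zeta>) \<le> 1 * 1"
    by (intro mult_mono) auto
  then have "K\<^sub>B * ((cmod \<zeta> / (1 + cmod \<zeta>)) * exp (- (\<delta> * cos \<phi>) * cmod \<zeta>)) \<le> K\<^sub>B * 1"
    using B.K_nonneg by (intro mult_left_mono) auto
  with norm_calculus_fun_le[OF assms(1,2)] show ?thesis by (simp add: mult_ac)
qed

lemma continuous_on_calculus_fun: "continuous_on (uminus ` sector \<theta>\<^sub>B) (calculus_fun \<delta>)"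
  unfolding calculus_fun_def
  by (intro continuous_intros continuous_on_compose2[OF B.continuous_on_R]) auto

lemma uminus_path_sector: "z \<in> Gamma_path \<phi> \<Longrightarrow> z \<in> sector \<phi>"
  using Gamma_path_subset_sector[of \<phi> \<phi>] phi by auto

text \<open>The reflection of the domain lies in the sector with angle \<phi>, inside that of B. The
  factor \<zeta> supplies the zero required at 0, and (B - \<zeta>)^-1 absorbs its growth. The
  exponential decays at the rate \<delta> cos \<phi>, positive because \<phi> is acute.\<close>

lemma calculus_fun_Hinf:
  assumes RA: "RA = res A" and phi_A: "\<theta>\<^sub>A = pi - \<phi>" and acute: "\<phi> < pi / 2" and "0 < \<delta>"
  shows "calculus_fun \<delta> \<in> Hinf_e \<theta>\<^sub>A A"
  unfolding Hinf_e_def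
proof (intro CollectI conjI ballI)
  have neg: "- \<zeta> \<in> sector \<phi>" "- \<zeta> \<in> sector \<theta>\<^sub>B" if "\<zeta> \<in> - sector \<theta>\<^sub>A" for \<zeta>
    using uminus_in_sector_if_not[of \<zeta> \<theta>\<^sub>A] that sector_mono[OF phi(3)] by (auto simp: phi_A)
  have L: "RB (- \<zeta>) \<in> L_space" if "\<zeta> \<in> - sector \<theta>\<^sub>A" for \<zeta>
    using B.clinear neg[OF that] by blast
  show "calculus_fun \<delta> ` (- sector \<theta>\<^sub>A) \<subseteq> L_space"
    using L by (auto simp: calculus_fun_def intro: scaleC_L_space)
  show "vholomorphic_on (calculus_fun \<delta>) (- sector \<theta>\<^sub>A)"
    unfolding vholomorphic_on_def
  proof (intro ballI exI)
    fix \<zeta> assume \<zeta>: "\<zeta> \<in> - sector \<theta>\<^sub>A"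
    show "(calculus_fun \<delta> has_derivative (\<lambda>h. h *\<^sub>C ((\<zeta> * exp (of_real \<delta> * \<zeta>)) *\<^sub>C - (- (RB (- \<zeta>) o\<^sub>L RB (- \<zeta>)))
        + (exp (of_real \<delta> * \<zeta>) + \<zeta> * (of_real \<delta> * exp (of_real \<delta> * \<zeta>))) *\<^sub>C RB (- \<zeta>))))
        (at \<zeta> within - sector \<theta>\<^sub>A)"
      unfolding calculus_fun_def
    proof (rule has_derivative_scaleC_product)
      show "((\<lambda>\<zeta>. \<zeta> * exp (of_real \<delta> * \<zeta>)) has_field_derivative
          exp (of_real \<delta> * \<zeta>) + \<zeta> * (of_real \<delta> * exp (of_real \<delta> * \<zeta>))) (at \<zeta> within - sector \<theta>\<^sub>A)"
        by (auto intro!: derivative_eq_intros)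
      show "((\<lambda>\<zeta>. RB (- \<zeta>)) has_derivative (\<lambda>h. h *\<^sub>C - (- (RB (- \<zeta>) o\<^sub>L RB (- \<zeta>)))))
          (at \<zeta> within - sector \<theta>\<^sub>A)"
        by (intro has_derivative_comp_uminus B.has_derivative_R) (use neg \<zeta> in auto)
    qed
  qed
  show "bounded (calculus_fun \<delta> ` (- sector \<theta>\<^sub>A))"
    using norm_calculus_fun_le_K[OF neg(1)] acute \<open>0 < \<delta>\<close> by (intro boundedI[where B = K\<^sub>B]) auto
  show "calculus_fun \<delta> \<zeta> o\<^sub>L res A z = res A z o\<^sub>L calculus_fun \<delta> \<zeta>"
    if "\<zeta> \<in> - sector \<theta>\<^sub>A" "z \<in> sector \<theta>\<^sub>A" for \<zeta> z
    using commute[OF that(2) neg(2)[OF that(1)]] A.clinear[OF that(2)]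
    by (simp add: calculus_fun_def blinfun_compose_scaleC_left blinfun_compose_scaleC_right RA)
  show "\<exists>c>0. \<exists>\<delta>'>0. \<forall>\<zeta>\<in>- sector \<theta>\<^sub>A.
      norm (calculus_fun \<delta> \<zeta>) \<le> c * (cmod \<zeta> / (1 + cmod \<zeta>)) * exp (- \<delta>' * cmod \<zeta>)"
  proof (intro exI conjI ballI)
    \<comment> \<open>\<open>c\<close> has to be positive, while \<open>K\<^sub>B\<close> is only
      known to be nonnegative.\<close>
    show "0 < K\<^sub>B + 1" using B.K_nonneg by simp
    show "0 < \<delta> * cos \<phi>" using \<open>0 < \<delta>\<close> phi acute by (intro mult_pos_pos cos_gt_zero) auto
    fix \<zeta> assume "\<zeta> \<in> - sector \<theta>\<^sub>A"
    then have "norm (calculus_fun \<delta> \<zeta>) \<le> K\<^sub>B * (cmod \<zeta> / (1 + cmod \<zeta>)) * exp (- (\<delta> * cos \<phi>) * cmod \<zeta>)"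
      using norm_calculus_fun_le[OF neg(1)] \<open>0 < \<delta>\<close> by simp
    also have "\<dots> \<le> (K\<^sub>B + 1) * (cmod \<zeta> / (1 + cmod \<zeta>)) * exp (- (\<delta> * cos \<phi>) * cmod \<zeta>)"
      by (intro mult_right_mono) auto
    finally show "norm (calculus_fun \<delta> \<zeta>) \<le> (K\<^sub>B + 1) * (cmod \<zeta> / (1 + cmod \<zeta>)) * exp (- (\<delta> * cos \<phi>) * cmod \<zeta>)" .
  qed
qed

text \<open>The formula is continuous on the reflected sector of B, which contains the boundary
  rays, so it takes its own boundary values there without exceptional points.\<close>

lemma calculus_fun_boundary_values:
  assumes phi_A: "\<theta>\<^sub>A = pi - \<phi>"
  shows "boundary_values \<theta>\<^sub>A (calculus_fun \<delta>) (calculus_fun \<delta>)"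
proof -
  have "nontangential_limit \<theta>\<^sub>A (calculus_fun \<delta>) (of_real r * cis t) (calculus_fun \<delta> (of_real r * cis t))"
    if "0 < r" "t \<in> {\<theta>\<^sub>A, - \<theta>\<^sub>A}" for r t
    unfolding nontangential_limit_def
  proof (intro allI impI)
    fix k :: real
    have "- (of_real r * cis t) \<in> sector \<theta>\<^sub>B"
      using that phi A.angle B.angle by (intro uminus_polar_in_sector) (auto simp: phi_A)
    then have "of_real r * cis t \<in> uminus ` sector \<theta>\<^sub>B" by (metis imageI minus_minus)
    then have "(calculus_fun \<delta> \<longlongrightarrow> calculus_fun \<delta> (of_real r * cis t))
        (at (of_real r * cis t) within uminus ` sector \<theta>\<^sub>B)"
      using continuous_on_calculus_fun by (auto simp: continuous_on_def)
    moreover have "- sector \<theta>\<^sub>A \<subseteq> uminus ` sector \<theta>\<^sub>B"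
    proof
      fix z assume "z \<in> - sector \<theta>\<^sub>A"
      then have "- z \<in> sector \<theta>\<^sub>B"
        using uminus_in_sector_if_not[of z \<theta>\<^sub>A] sector_mono[OF phi(3)] by (auto simp: phi_A)
      then show "z \<in> uminus ` sector \<theta>\<^sub>B" by (metis imageI minus_minus)
    qed
    ultimately show "(calculus_fun \<delta> \<longlongrightarrow> calculus_fun \<delta> (of_real r * cis t)) (at (of_real r * cis t) within
        {z. z \<notin> sector \<theta>\<^sub>A \<and> dist z (of_real r * cis t) < k * infdist z (sector \<theta>\<^sub>A)})"
      by (elim tendsto_within_subset) auto
  qed
  then show ?thesis unfolding boundary_values_def by (auto intro: negligible_subset[OF negligible_empty])
qed

lemma Gamma_decay_exp:
  assumes "continuous_on (Gamma_path \<phi>) f" and "0 \<le> C"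
    and "\<And>z. z \<in> Gamma_path \<phi> \<Longrightarrow> norm (f z) \<le> C * exp (- a * cmod z) * (1 / (1 + cmod z))" and "0 < a"
  shows "Gamma_decay \<phi> f 1 (C * (1 + 1 / a))"
  unfolding Gamma_decay_def
proof (intro conjI ballI)
  fix z assume "z \<in> Gamma_path \<phi>"
  then have "norm (f z) \<le> C * exp (- a * cmod z) * (1 / (1 + cmod z))" by (rule assms(3))
  also have "\<dots> \<le> C * ((1 + 1 / a) / (1 + cmod z)) * (1 / (1 + cmod z))"
    using assms by (intro mult_right_mono mult_left_mono exp_minus_le_inverse) auto
  also have "\<dots> = C * (1 + 1 / a) * (1 + cmod z) powr (-1 - 1)"
    unfolding powr_minus_one_minus_one[OF norm_ge_zero] by (simp add: power2_eq_square)
  finally show "norm (f z) \<le> C * (1 + 1 / a) * (1 + cmod z) powr (-1 - 1)" .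
qed (use assms in auto)

text \<open>The lower ray can be rotated through the positive axis onto the upper one, because the
  whole sector with angle \<phi> lies in that of B and the exponential decays on it. This is
  Cauchy's theorem for the part without (A - z)^-1.\<close>

lemma exp_RB_integral_zero:
  assumes acute: "\<phi> < pi / 2" and "0 < \<delta>"
  shows "Gamma_integral \<phi> (\<lambda>z. exp (- (of_real \<delta> * z)) *\<^sub>C RB z) = 0"
proof -
  define a where "a = \<delta> * cos \<phi>"
  have "0 < a" unfolding a_def using \<open>0 < \<delta>\<close> phi acute by (intro mult_pos_pos cos_gt_zero) auto
  have bound: "norm (exp (- (of_real \<delta> * z)) *\<^sub>C RB z) \<le> K\<^sub>B * (1 + 1 / a) * (1 + cmod z) powr (-1 - 1)"
    if "z \<in> sector \<phi>" for z
  proof -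
    have z: "z \<in> sector \<theta>\<^sub>B" using that sector_mono[OF phi(3)] by auto
    have "norm (exp (- (of_real \<delta> * z)) *\<^sub>C RB z) \<le> ((1 + 1 / a) / (1 + cmod z)) * (K\<^sub>B / (1 + cmod z))"
      unfolding norm_scaleC
      using order_trans[OF norm_exp_minus_le[OF that, of \<delta>] exp_minus_le_inverse[OF \<open>0 < a\<close>, of "cmod z", unfolded a_def]]
        \<open>0 < \<delta>\<close> \<open>0 < a\<close> B.norm_R_le[OF z]
      by (intro mult_mono) (auto simp: a_def)
    then show ?thesis
      unfolding powr_minus_one_minus_one[OF norm_ge_zero] by (simp add: power2_eq_square mult_ac)
  qed
  have eq: "integral {0..} (ray (\<lambda>z. exp (- (of_real \<delta> * z)) *\<^sub>C RB z) s) =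
      integral {0..} (ray (\<lambda>z. exp (- (of_real \<delta> * z)) *\<^sub>C RB z) t)"
    if "s \<le> t" "- \<phi> \<le> s" "t \<le> \<phi>" for s t
  proof -
    have w: "wedge s t \<subseteq> sector \<phi>"
      using that phi by (fastforce simp: wedge_def intro!: polar_in_sector)
    then have wB: "wedge s t \<subseteq> sector \<theta>\<^sub>B" using sector_mono[OF phi(3)] by auto
    show ?thesis
    proof (rule integral_ray_eq[OF \<open>s \<le> t\<close> zero_less_one, where C = "K\<^sub>B * (1 + 1 / a)"])
      fix z assume z: "z \<in> wedge s t"
      show "((\<lambda>z. exp (- (of_real \<delta> * z)) *\<^sub>C RB z) has_derivative (\<lambda>h. h *\<^sub>C
          (exp (- (of_real \<delta> * z)) *\<^sub>C - (RB z o\<^sub>L RB z) + (- (of_real \<delta> * exp (- (of_real \<delta> * z)))) *\<^sub>C RB z)))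
          (at z within wedge s t)"
        by (rule has_derivative_scaleC_product)
          (use z wB in \<open>auto intro!: derivative_eq_intros B.has_derivative_R\<close>)
      show "norm (exp (- (of_real \<delta> * z)) *\<^sub>C RB z) \<le> K\<^sub>B * (1 + 1 / a) * (1 + cmod z) powr (-1 - 1)"
        using bound z w by auto
    qed (use wB in \<open>auto intro!: continuous_intros continuous_on_subset[OF B.continuous_on_R]\<close>)
  qed
  show ?thesis
    using eq[of "- \<phi>" \<phi>] phi by (simp add: Gamma_integral_def)
qed

lemma regularised_decay:
  assumes "\<phi> < pi / 2" and "0 \<le> \<delta>"
  shows "Gamma_decay \<phi> (\<lambda>z. exp (- (of_real \<delta> * z)) *\<^sub>C (RA (- z) o\<^sub>L RB z)) 1 (K\<^sub>A * K\<^sub>B)"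
  unfolding Gamma_decay_def
proof (intro conjI ballI)
  fix z assume z: "z \<in> Gamma_path \<phi>"
  have "0 \<le> \<delta> * Re z" using Re_nonneg[OF uminus_path_sector[OF z]] assms by (intro mult_nonneg_nonneg) auto
  then have "norm (exp (- (of_real \<delta> * z)) *\<^sub>C (RA (- z) o\<^sub>L RB z)) \<le> norm (RA (- z) o\<^sub>L RB z)"
    unfolding norm_scaleC by (intro mult_left_le_one_le) auto
  also have "\<dots> \<le> K\<^sub>A * K\<^sub>B * (1 + cmod z) powr (-1 - 1)"
    by (intro norm_compose_le path_A path_B z)
  finally show "norm (exp (- (of_real \<delta> * z)) *\<^sub>C (RA (- z) o\<^sub>L RB z)) \<le> K\<^sub>A * K\<^sub>B * (1 + cmod z) powr (-1 - 1)" .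
qed (use continuous_on_path_A continuous_on_path_B in \<open>auto intro!: continuous_intros\<close>)

text \<open>The integrands differ by a term of order sqrt \<delta> |z|^(-3/2), which is integrable
  with decay exponent 1/2.\<close>

lemma norm_regularised_diff_le:
  assumes acute: "\<phi> < pi / 2" and "0 \<le> \<delta>"
  shows "norm (regularised \<delta> - S) \<le> (4 * (K\<^sub>A * K\<^sub>B) / pi) * sqrt \<delta>"
proof -
  define G where "G z = RA (- z) o\<^sub>L RB z" for z
  define C where "C = 2 * sqrt \<delta> * (K\<^sub>A * K\<^sub>B)"
  have decay: "Gamma_decay \<phi> (\<lambda>z. exp (- (of_real \<delta> * z)) *\<^sub>C G z - G z) (1 / 2) C"
    unfolding Gamma_decay_def
  proof (intro conjI ballI)
    show "continuous_on (Gamma_path \<phi>) (\<lambda>z. exp (- (of_real \<delta> * z)) *\<^sub>C G z - G z)"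
      unfolding G_def by (intro continuous_intros continuous_on_path_A continuous_on_path_B)
    fix z assume z: "z \<in> Gamma_path \<phi>"
    have "0 \<le> \<delta> * Re z" using Re_nonneg[OF uminus_path_sector[OF z]] assms by (intro mult_nonneg_nonneg) auto
    then have "cmod (exp (- (of_real \<delta> * z)) - 1) \<le> 2 * sqrt (cmod (of_real \<delta> * z))"
      by (intro norm_exp_minus_diff_one_le) simp
    also have "\<dots> = 2 * sqrt \<delta> * sqrt (cmod z)"
      using \<open>0 \<le> \<delta>\<close> by (simp add: norm_mult real_sqrt_mult)
    also have "\<dots> \<le> 2 * sqrt \<delta> * sqrt (1 + cmod z)"
      using \<open>0 \<le> \<delta>\<close> by (intro mult_left_mono) auto
    finally have e: "cmod (exp (- (of_real \<delta> * z)) - 1) \<le> 2 * sqrt \<delta> * sqrt (1 + cmod z)" .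
    have "exp (- (of_real \<delta> * z)) *\<^sub>C G z - G z = (exp (- (of_real \<delta> * z)) - 1) *\<^sub>C G z"
      by (simp add: scaleC.diff_left)
    also have "norm \<dots> \<le> (2 * sqrt \<delta> * sqrt (1 + cmod z)) * (K\<^sub>A * K\<^sub>B * (1 + cmod z) powr (-1 - 1))"
      unfolding norm_scaleC G_def using e z \<open>0 \<le> \<delta>\<close>
      by (intro mult_mono norm_compose_le path_A path_B) auto
    also have "\<dots> = C * ((1 + cmod z) powr (1 / 2) * (1 + cmod z) powr (-1 - 1))"
      by (simp add: C_def powr_half_sqrt)
    also have "(1 + cmod z) powr (1 / 2) * (1 + cmod z) powr (-1 - 1) = (1 + cmod z) powr (-1 - 1 / 2)"
      by (simp flip: powr_add)
    finally show "norm (exp (- (of_real \<delta> * z)) *\<^sub>C G z - G z) \<le> C * (1 + cmod z) powr (-1 - 1 / 2)" .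
  qed simp
  have "regularised \<delta> - S = (1 / (2 * of_real pi * \<i>)) *\<^sub>C
      Gamma_integral \<phi> (\<lambda>z. exp (- (of_real \<delta> * z)) *\<^sub>C G z - G z)"
    using Gamma_integral_diff[OF regularised_decay[OF assms] S_decay]
    by (simp add: regularised_def sum_inverse_def G_def scaleC.diff_right)
  also have "norm \<dots> \<le> 1 / (2 * pi) * (2 * (C / (1 / 2)))"
    unfolding norm_scaleC by (intro mult_mono norm_Gamma_integral_le decay) (auto simp: norm_divide norm_mult)
  also have "\<dots> = (4 * (K\<^sub>A * K\<^sub>B) / pi) * sqrt \<delta>" by (simp add: C_def)
  finally show ?thesis .
qed

text \<open>Rests on z (A - z)^-1 A^-1 = (A - z)^-1 - A^-1: the factor z of the test function is
  consumed, leaving the integrand of \<open>regularised\<close> and a term in which only (B + z)^-1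
  depends on the resolvent parameter.\<close>

lemma calculus_value:
  assumes RA: "RA = res A" and phi_A: "\<theta>\<^sub>A = pi - \<phi>" and acute: "\<phi> < pi / 2" and "0 < \<delta>"
  obtains T where "has_calculus_value \<theta>\<^sub>A A (calculus_fun \<delta>) T" "T o\<^sub>L RA 0 = - regularised \<delta>"
proof -
  define a where "a = \<delta> * cos \<phi>"
  have "0 < a" unfolding a_def using \<open>0 < \<delta>\<close> phi acute by (intro mult_pos_pos cos_gt_zero) auto
  \<comment> \<open>The integrand of the calculus in the variable z = - \<zeta>, in which its path
    has angle \<phi>.\<close>
  define f where "f z = calculus_fun \<delta> (- z) o\<^sub>L RA (- z)" for z
  define E where "E z = exp (- (complex_of_real \<delta> * z))" for z
  have cE: "continuous_on X E" for X unfolding E_def by (intro continuous_intros)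
  have f_eq: "f z = (- z * E z) *\<^sub>C (RB z o\<^sub>L RA (- z))" for z
    by (simp add: f_def E_def calculus_fun_def blinfun_compose_scaleC_left)
  have nE: "cmod (E z) \<le> exp (- a * cmod z)" if "z \<in> Gamma_path \<phi>" for z
    unfolding E_def a_def using norm_exp_minus_le[OF uminus_path_sector[OF that]] \<open>0 < \<delta>\<close> by simp
  have decay_f: "Gamma_decay \<phi> f 1 ((K\<^sub>B * K\<^sub>A) * (1 + 1 / a))"
  proof (rule Gamma_decay_exp)
    show "continuous_on (Gamma_path \<phi>) f"
      unfolding f_eq by (intro continuous_intros continuous_on_path_A continuous_on_path_B cE)
    fix z assume z: "z \<in> Gamma_path \<phi>"
    have "norm (RB z o\<^sub>L RA (- z)) \<le> norm (RB z) * norm (RA (- z))" by (rule norm_blinfun_compose)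
    then have "cmod z * norm (RB z o\<^sub>L RA (- z)) \<le> (cmod z * norm (RB z)) * norm (RA (- z))"
      by (simp add: mult_left_mono mult.assoc)
    also have "\<dots> \<le> K\<^sub>B * (K\<^sub>A / (1 + cmod z))"
    proof (intro mult_mono)
      show "cmod z * norm (RB z) \<le> K\<^sub>B"
        by (rule order_trans[OF _ B.bound[OF path_B[OF z]]]) (intro mult_right_mono, auto)
    qed (use A.norm_R_le[OF path_A[OF z]] B.K_nonneg in auto)
    finally have "cmod (E z) * (cmod z * norm (RB z o\<^sub>L RA (- z))) \<le>
        exp (- a * cmod z) * (K\<^sub>B * (K\<^sub>A / (1 + cmod z)))"
      by (rule mult_mono[OF nE[OF z]]) auto
    then show "norm (f z) \<le> (K\<^sub>B * K\<^sub>A) * exp (- a * cmod z) * (1 / (1 + cmod z))"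
      by (simp add: f_eq norm_scaleC norm_mult mult_ac)
  qed (use A.K_nonneg B.K_nonneg \<open>0 < a\<close> in auto)
  have decay_RB: "Gamma_decay \<phi> (\<lambda>z. E z *\<^sub>C RB z) 1 (K\<^sub>B * (1 + 1 / a))"
  proof (rule Gamma_decay_exp)
    show "continuous_on (Gamma_path \<phi>) (\<lambda>z. E z *\<^sub>C RB z)"
      by (intro continuous_intros continuous_on_path_B cE)
    fix z assume z: "z \<in> Gamma_path \<phi>"
    have "cmod (E z) * norm (RB z) \<le> exp (- a * cmod z) * (K\<^sub>B / (1 + cmod z))"
      using nE[OF z] B.norm_R_le[OF path_B[OF z]] by (intro mult_mono) auto
    then show "norm (E z *\<^sub>C RB z) \<le> K\<^sub>B * exp (- a * cmod z) * (1 / (1 + cmod z))"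
      by (simp add: norm_scaleC mult_ac)
  qed (use B.K_nonneg \<open>0 < a\<close> in auto)
  define I where "I = Gamma_integral \<phi> f"
  have path_neg: "- z \<in> Gamma_path \<phi>" if z_in: "z \<in> Gamma_path \<theta>\<^sub>A" for z
  proof -
    obtain r t where z: "z = of_real r * cis t" "0 \<le> r" "t = pi - \<phi> \<or> t = - (pi - \<phi>)"
      using z_in unfolding Gamma_path_def phi_A by blast
    have "cis (pi - \<phi>) = - cis (- \<phi>)" "cis (- (pi - \<phi>)) = - cis \<phi>"
      by (simp_all add: complex_eq_iff sin_diff cos_diff)
    then have "- z = of_real r * cis (- \<phi>) \<or> - z = of_real r * cis \<phi>"
      using z(1,3) by auto
    then show ?thesis using z(2) by (auto intro: Gamma_pathI)
  qed
  have "has_Gamma_integral (\<lambda>\<zeta>. calculus_fun \<delta> \<zeta> o\<^sub>L res A \<zeta>) I \<theta>\<^sub>A"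
  proof -
    have "Gamma_decay \<theta>\<^sub>A (\<lambda>\<zeta>. f (- \<zeta>)) 1 ((K\<^sub>B * K\<^sub>A) * (1 + 1 / a))"
      using decay_f path_neg unfolding Gamma_decay_def
      by (force intro: continuous_on_compose2 continuous_intros)
    from has_Gamma_integral[OF this] show ?thesis
      using Gamma_integral_uminus[of \<phi> "\<lambda>\<zeta>. f (- \<zeta>)"] by (simp add: f_def[abs_def] RA I_def phi_A)
  qed
  then have val: "has_calculus_value \<theta>\<^sub>A A (calculus_fun \<delta>) ((1 / (2 * of_real pi * \<i>)) *\<^sub>C I)"
    unfolding has_calculus_value_def using calculus_fun_boundary_values[OF phi_A] by blast
  have "I o\<^sub>L RA 0 = Gamma_integral \<phi> (\<lambda>z. f z o\<^sub>L RA 0)"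
    unfolding I_def
    by (rule Gamma_integral_linear[OF decay_f]) (simp_all add: blinfun_compose.bounded_linear_left blinfun_compose_scaleC_left)
  also have "\<dots> = Gamma_integral \<phi> (\<lambda>z. ((E z *\<^sub>C RB z) o\<^sub>L RA 0) - E z *\<^sub>C (RA (- z) o\<^sub>L RB z))"
  proof (rule Gamma_integral_cong)
    fix z assume z: "z \<in> Gamma_path \<phi>"
    have "RA (- z) - RA 0 = z *\<^sub>C (RA (- z) o\<^sub>L RA 0)"
      using A.resolvent_identity[OF path_A[OF z] zero_in_sector] by simp
    moreover have "f z o\<^sub>L RA 0 = - (E z *\<^sub>C (RB z o\<^sub>L (z *\<^sub>C (RA (- z) o\<^sub>L RA 0))))"
      by (simp add: f_eq blinfun_compose_scaleC_left blinfun_compose_scaleC_right B.clinear path_B[OF z]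
          scaleC_scaleC scaleC.minus_left blinfun_compose.minus_left blinfun_compose_assoc mult.commute)
    ultimately have "f z o\<^sub>L RA 0 = - (E z *\<^sub>C (RB z o\<^sub>L (RA (- z) - RA 0)))" by simp
    then show "f z o\<^sub>L RA 0 = ((E z *\<^sub>C RB z) o\<^sub>L RA 0) - E z *\<^sub>C (RA (- z) o\<^sub>L RB z)"
      using commute[OF path_A[OF z] path_B[OF z]]
      by (simp add: blinfun_compose.diff_right scaleC.diff_right blinfun_compose_scaleC_left)
  qed
  also have "\<dots> = Gamma_integral \<phi> (\<lambda>z. (E z *\<^sub>C RB z) o\<^sub>L RA 0)
      - Gamma_integral \<phi> (\<lambda>z. E z *\<^sub>C (RA (- z) o\<^sub>L RB z))"
  proof -
    obtain C where C: "Gamma_decay \<phi> (\<lambda>z. (E z *\<^sub>C RB z) o\<^sub>L RA 0) 1 C"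
      by (rule Gamma_decay_linear[OF decay_RB blinfun_compose.bounded_linear_left])
    have "Gamma_decay \<phi> (\<lambda>z. E z *\<^sub>C (RA (- z) o\<^sub>L RB z)) 1 (K\<^sub>A * K\<^sub>B)"
      unfolding E_def by (rule regularised_decay[OF acute]) (use \<open>0 < \<delta>\<close> in simp)
    from Gamma_integral_diff[OF C this] show ?thesis .
  qed
  also have "Gamma_integral \<phi> (\<lambda>z. (E z *\<^sub>C RB z) o\<^sub>L RA 0) = Gamma_integral \<phi> (\<lambda>z. E z *\<^sub>C RB z) o\<^sub>L RA 0"
    by (rule Gamma_integral_linear[OF decay_RB, symmetric])
      (simp_all add: blinfun_compose.bounded_linear_left blinfun_compose_scaleC_left)
  also have "Gamma_integral \<phi> (\<lambda>z. E z *\<^sub>C RB z) = 0"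
    unfolding E_def by (rule exp_RB_integral_zero[OF acute \<open>0 < \<delta>\<close>])
  finally have "((1 / (2 * of_real pi * \<i>)) *\<^sub>C I) o\<^sub>L RA 0 = - regularised \<delta>"
    by (simp add: regularised_def E_def blinfun_compose_scaleC_left scaleC.minus_right)
  with val show ?thesis by (rule that)
qed

lemma norm_S_le_norm_RA:
  assumes RA: "RA = res A" and phi_A: "\<theta>\<^sub>A = pi - \<phi>" and acute: "\<phi> < pi / 2"
    and calc: "bounded_Hinf_calculus \<theta>\<^sub>A A"
  obtains C where "0 \<le> C" "\<And>w. norm (S w) \<le> C * norm (RA 0 w)"
proof -
  obtain C where C: "\<And>f T. f \<in> Hinf_e \<theta>\<^sub>A A \<Longrightarrow> has_calculus_value \<theta>\<^sub>A A f T \<Longrightarrow>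
      norm T \<le> C * (SUP \<zeta>\<in>- sector \<theta>\<^sub>A. norm (f \<zeta>))"
    using calc unfolding bounded_Hinf_calculus_def by blast
  \<comment> \<open>The constant of the calculus comes without a sign, hence the absolute
    value.\<close>
  define M where "M = \<bar>C\<bar> * K\<^sub>B"
  define D where "D = 4 * (K\<^sub>A * K\<^sub>B) / pi"
  have reg: "norm (regularised \<delta> w) \<le> M * norm (RA 0 w)" if pos: "0 < \<delta>" for \<delta> w
  proof -
    obtain T where T: "has_calculus_value \<theta>\<^sub>A A (calculus_fun \<delta>) T" "T o\<^sub>L RA 0 = - regularised \<delta>"
      by (rule calculus_value[OF RA phi_A acute pos])
    have neg: "- \<zeta> \<in> sector \<phi>" if "\<zeta> \<in> - sector \<theta>\<^sub>A" for \<zeta>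
      using uminus_in_sector_if_not[of \<zeta> \<theta>\<^sub>A] that by (auto simp: phi_A)
    \<comment> \<open>-1 has argument pi, beyond \<open>\<theta>\<^sub>A\<close>, so the supremum is
      taken over a nonempty set.\<close>
    have "- 1 \<in> - sector \<theta>\<^sub>A" using A.angle Arg_of_real[of "-1"] by (simp add: sector_def)
    then have ne: "- sector \<theta>\<^sub>A \<noteq> {}" by blast
    have le: "norm (calculus_fun \<delta> \<zeta>) \<le> K\<^sub>B" if "\<zeta> \<in> - sector \<theta>\<^sub>A" for \<zeta>
      using norm_calculus_fun_le_K[OF neg[OF that]] acute \<open>0 < \<delta>\<close> by simp
    have S1: "(SUP \<zeta>\<in>- sector \<theta>\<^sub>A. norm (calculus_fun \<delta> \<zeta>)) \<le> K\<^sub>B"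
      using ne le by (intro cSUP_least)
    have S0: "0 \<le> (SUP \<zeta>\<in>- sector \<theta>\<^sub>A. norm (calculus_fun \<delta> \<zeta>))"
    proof (rule cSUP_upper2[OF _ \<open>- 1 \<in> - sector \<theta>\<^sub>A\<close>])
      show "bdd_above ((\<lambda>\<zeta>. norm (calculus_fun \<delta> \<zeta>)) ` (- sector \<theta>\<^sub>A))" using le by (intro bdd_aboveI2)
    qed simp
    have "norm T \<le> C * (SUP \<zeta>\<in>- sector \<theta>\<^sub>A. norm (calculus_fun \<delta> \<zeta>))"
      by (rule C[OF calculus_fun_Hinf[OF RA phi_A acute pos] T(1)])
    also have "\<dots> \<le> \<bar>C\<bar> * (SUP \<zeta>\<in>- sector \<theta>\<^sub>A. norm (calculus_fun \<delta> \<zeta>))"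
      using S0 by (intro mult_right_mono) auto
    also have "\<dots> \<le> M" unfolding M_def using S1 by (intro mult_left_mono) auto
    finally have nT: "norm T \<le> M" .
    have "regularised \<delta> w = - T (RA 0 w)"
      using arg_cong[OF T(2), of "\<lambda>X. - blinfun_apply X w"] by (simp add: blinfun.minus_left)
    then have "norm (regularised \<delta> w) \<le> norm T * norm (RA 0 w)" by (simp add: norm_blinfun)
    also have "\<dots> \<le> M * norm (RA 0 w)" using nT by (rule mult_right_mono) simp
    finally show ?thesis .
  qed
  have "norm (S w) \<le> M * norm (RA 0 w)" for w
  proof (rule tendsto_lowerbound)
    have "(\<lambda>n. M * norm (RA 0 w) + D * sqrt (inverse (real (Suc n))) * norm w) \<longlonglongrightarrow>
        M * norm (RA 0 w) + D * sqrt 0 * norm w"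
      by (intro tendsto_intros LIMSEQ_inverse_real_of_nat)
    then show "(\<lambda>n. M * norm (RA 0 w) + D * sqrt (inverse (real (Suc n))) * norm w) \<longlonglongrightarrow> M * norm (RA 0 w)"
      by simp
    show "\<forall>\<^sub>F n in sequentially. norm (S w) \<le> M * norm (RA 0 w) + D * sqrt (inverse (real (Suc n))) * norm w"
    proof (rule always_eventually, intro allI)
      fix n
      define \<delta> where "\<delta> = inverse (real (Suc n))"
      have "0 < \<delta>" by (simp add: \<delta>_def)
      have "S w = regularised \<delta> w - (regularised \<delta> - S) w" by (simp add: blinfun.diff_left)
      also have "norm \<dots> \<le> norm (regularised \<delta> w) + norm ((regularised \<delta> - S) w)" by (rule norm_triangle_ineq4)
      also have "norm ((regularised \<delta> - S) w) \<le> (D * sqrt \<delta>) * norm w"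
        unfolding D_def using norm_regularised_diff_le[OF acute, of \<delta>] \<open>0 < \<delta>\<close>
        by (intro order_trans[OF norm_blinfun] mult_right_mono) auto
      finally show "norm (S w) \<le> M * norm (RA 0 w) + D * sqrt (inverse (real (Suc n))) * norm w"
        using reg[OF \<open>0 < \<delta>\<close>, of w] by (simp add: \<delta>_def)
    qed
  qed simp
  moreover have "0 \<le> M" using B.K_nonneg by (simp add: M_def)
  ultimately show ?thesis using that by blast
qed

end


section \<open>Resolvents of unbounded operators\<close>

text \<open>Turns membership in the graph into an equation for a bounded operator; the resolvent
  identity and commutation then follow by substitution.\<close>

lemma resolvent_iff:
  assumes "z \<in> resolvent_set (op_uminus A)"
  shows "(x, y) \<in> A \<longleftrightarrow> x = res A z (y + z *\<^sub>C x)"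
proof -
  obtain R where R: "(op_add A (scalar_op z))\<inverse> = op_graph R"
    using assms by (auto simp: resolvent_set_uminus boundedly_invertible_def)
  then have "res A z = R" by (simp add: res_def op_inv_eqI)
  with R have "(op_add A (scalar_op z))\<inverse> = op_graph (res A z)" by simp
  then have "(y + z *\<^sub>C x, x) \<in> (op_add A (scalar_op z))\<inverse> \<longleftrightarrow> x = res A z (y + z *\<^sub>C x)"
    by (simp add: op_graph_def)
  then show ?thesis by (auto simp: op_add_def scalar_op_def)
qed

lemma resolvent_mem:
  assumes "z \<in> resolvent_set (op_uminus A)"
  shows "(res A z u, u - z *\<^sub>C res A z u) \<in> A"
  by (simp add: resolvent_iff[OF assms])

lemma res_clinear:
  assumes "linear_op A" "z \<in> resolvent_set (op_uminus A)"
  shows "res A z \<in> L_space"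
  unfolding L_space_def
proof (intro CollectI allI)
  fix c u
  have "(c *\<^sub>C res A z u, c *\<^sub>C (u - z *\<^sub>C res A z u)) \<in> A"
    using assms(1) resolvent_mem[OF assms(2)] by (simp add: linear_op_def)
  then show "res A z (c *\<^sub>C u) = c *\<^sub>C res A z u"
    by (simp add: resolvent_iff[OF assms(2)] scaleC.diff_right scaleC_scaleC mult.commute)
qed

lemma res_identity:
  assumes "linear_op A" and z: "z \<in> resolvent_set (op_uminus A)" and w: "w \<in> resolvent_set (op_uminus A)"
  shows "res A z - res A w = (w - z) *\<^sub>C (res A z o\<^sub>L res A w)"
proof (rule blinfun_eqI)
  fix u
  have "res A w u = res A z (u - w *\<^sub>C res A w u + z *\<^sub>C res A w u)"
    using resolvent_mem[OF w] by (simp add: resolvent_iff[OF z])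
  also have "\<dots> = res A z u - (w - z) *\<^sub>C res A z (res A w u)"
    by (simp add: blinfun.add_right blinfun.diff_right L_spaceD[OF res_clinear[OF assms(1) z]] scaleC.diff_left)
  finally show "(res A z - res A w) u = ((w - z) *\<^sub>C (res A z o\<^sub>L res A w)) u"
    by (simp add: blinfun.diff_left blinfun_apply_scaleC algebra_simps)
qed

text \<open>Commutation with one resolvent says that T maps the graph of A into itself, a property
  that does not refer to \<zeta>.\<close>

lemma res_commute:
  assumes T: "T \<in> L_space" and \<zeta>: "\<zeta> \<in> resolvent_set (op_uminus A)"
    and comm: "T o\<^sub>L res A \<zeta> = res A \<zeta> o\<^sub>L T" and z: "z \<in> resolvent_set (op_uminus A)"
  shows "T o\<^sub>L res A z = res A z o\<^sub>L T"
proof (rule blinfun_eqI)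
  fix u
  define x where "x = res A z u"
  have "x = res A \<zeta> (u - z *\<^sub>C x + \<zeta> *\<^sub>C x)"
    using resolvent_mem[OF z, of u] by (simp add: x_def resolvent_iff[OF \<zeta>])
  then have "T x = T (res A \<zeta> (u - z *\<^sub>C x + \<zeta> *\<^sub>C x))" by simp
  also have "\<dots> = res A \<zeta> (T (u - z *\<^sub>C x + \<zeta> *\<^sub>C x))"
    using arg_cong[OF comm, of "\<lambda>X. blinfun_apply X (u - z *\<^sub>C x + \<zeta> *\<^sub>C x)"] by simp
  finally have "(T x, T u - z *\<^sub>C T x) \<in> A"
    by (simp add: resolvent_iff[OF \<zeta>] blinfun.add_right blinfun.diff_right L_spaceD[OF T])
  then show "(T o\<^sub>L res A z) u = (res A z o\<^sub>L T) u"
    by (simp add: resolvent_iff[OF z] x_def)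
qed

lemma sectorialD:
  assumes "A \<in> sectorial \<theta>"
  shows "linear_op A" "sector \<theta> \<subseteq> resolvent_set (op_uminus A)"
  using assms by (auto simp: sectorial_def sectorial_K_def closed_op_def)

lemma sectorial_resolvent_family:
  assumes A: "A \<in> sectorial \<theta>" and angle: "0 < \<theta>" "\<theta> < pi"
  obtains K where "resolvent_family (res A) \<theta> K"
proof -
  note lin = sectorialD(1)[OF A] and sub = subsetD[OF sectorialD(2)[OF A]]
  obtain K where K: "\<And>z. z \<in> sector \<theta> \<Longrightarrow> (1 + cmod z) * norm (res A z) \<le> K"
    using A by (auto simp: sectorial_def sectorial_K_def)
  have "resolvent_family (res A) \<theta> K"
  proof
    fix x assume "res A 0 x = 0"
    then have "(0, x) \<in> A" by (simp add: resolvent_iff[OF sub[OF zero_in_sector]] scaleC.zero_left)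
    then show "x = 0" using lin by (auto simp: linear_op_def dest: single_valuedD)
  next
    show "res A z \<in> L_space" if "z \<in> sector \<theta>" for z
      by (rule res_clinear[OF lin sub[OF that]])
    show "res A z - res A w = (w - z) *\<^sub>C (res A z o\<^sub>L res A w)"
      if "z \<in> sector \<theta>" "w \<in> sector \<theta>" for z w
      by (rule res_identity[OF lin sub[OF that(1)] sub[OF that(2)]])
  qed (use angle K in auto)
  then show ?thesis by (rule that)
qed

lemma sectorial_graph:
  assumes "A \<in> sectorial \<theta>"
  shows "(x, y) \<in> A \<longleftrightarrow> x = res A 0 y"
  using resolvent_iff[OF subsetD[OF sectorialD(2)[OF assms] zero_in_sector], of x y]
  by (simp add: scaleC.zero_left)

lemma linear_op_add:
  assumes "linear_op A" "linear_op B"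
  shows "linear_op (op_add A B)"
  unfolding linear_op_def
proof (intro conjI allI impI)
  show "single_valued (op_add A B)"
    using assms by (fastforce simp: linear_op_def op_add_def intro!: single_valuedI dest: single_valuedD)
  show "(0, 0) \<in> op_add A B"
    using assms unfolding linear_op_def op_add_def by (auto intro!: exI[of _ 0])
  fix x y x' y' and c
  assume xy: "(x, y) \<in> op_add A B"
  then obtain a b where ab: "y = a + b" "(x, a) \<in> A" "(x, b) \<in> B" by (auto simp: op_add_def)
  then have "(c *\<^sub>C x, c *\<^sub>C a) \<in> A" "(c *\<^sub>C x, c *\<^sub>C b) \<in> B"
    using assms by (auto simp: linear_op_def)
  then show "(c *\<^sub>C x, c *\<^sub>C y) \<in> op_add A B"
    unfolding op_add_def ab(1) scaleC_add_right by blast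
  assume "(x', y') \<in> op_add A B"
  then obtain a' b' where ab': "y' = a' + b'" "(x', a') \<in> A" "(x', b') \<in> B" by (auto simp: op_add_def)
  have "(x + x', a + a') \<in> A" "(x + x', b + b') \<in> B"
    using assms ab ab' by (auto simp: linear_op_def)
  then have "(x + x', (a + a') + (b + b')) \<in> op_add A B" unfolding op_add_def by blast
  then show "(x + x', y + y') \<in> op_add A B" by (simp add: ab ab' algebra_simps)
qed


section \<open>Interpolation spaces\<close>

lemma K_functional_le:
  assumes "(a, b) \<in> A" "0 \<le> t"
  shows "K_functional A t x \<le> norm (x - a) + t * (norm a + norm b)"
proof -
  have "bdd_below ((\<lambda>(a, b). norm (x - a) + t * (norm a + norm b)) ` A)"
    using assms(2) by (intro bdd_belowI2[where m = 0]) auto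
  from cINF_lower[OF this assms(1)] show ?thesis by (simp add: K_functional_def)
qed

lemma le_K_functional:
  assumes "(0, 0) \<in> A" "\<And>a b. (a, b) \<in> A \<Longrightarrow> c \<le> norm (x - a) + t * (norm a + norm b)"
  shows "c \<le> K_functional A t x"
  unfolding K_functional_def by (rule cINF_greatest) (use assms in auto)

lemma K_functional_mono:
  assumes "(0, 0) \<in> A" "0 \<le> s" "s \<le> t"
  shows "K_functional A s x \<le> K_functional A t x"
proof (rule le_K_functional[OF assms(1)])
  fix a b assume "(a, b) \<in> A"
  then have "K_functional A s x \<le> norm (x - a) + s * (norm a + norm b)" by (rule K_functional_le) fact
  also have "\<dots> \<le> norm (x - a) + t * (norm a + norm b)"
    using assms by (intro add_left_mono mult_right_mono) auto
  finally show "K_functional A s x \<le> norm (x - a) + t * (norm a + norm b)" .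
qed

lemma K_functional_nonneg: "(0, 0) \<in> A \<Longrightarrow> 0 \<le> t \<Longrightarrow> 0 \<le> K_functional A t x"
  by (rule le_K_functional) auto

text \<open>The K-functional increases with t, so the part of the integral over [t, 2 t] alone
  controls its value at t.\<close>

lemma real_interp_imp_K_functional_le:
  assumes x: "x \<in> real_interp A \<sigma> p" and zero: "(0, 0) \<in> A" and "0 < \<sigma>" "1 \<le> p"
  shows "\<exists>C. \<forall>t>0. K_functional A t x \<le> C * t powr \<sigma>"
proof -
  define F where "F s = (s powr (-\<sigma>) * K_functional A s x) powr p / s" for s
  define J where "J = (\<integral>\<^sup>+s\<in>{0<..}. ennreal (F s) \<partial>lborel)"
  have "J < \<infinity>" using x by (simp add: real_interp_def J_def F_def)
  define N where "N = enn2real J"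
  have J: "J = ennreal N" using \<open>J < \<infinity>\<close> by (simp add: N_def)
  have "0 \<le> N" by (simp add: N_def)
  have est: "K_functional A t x \<le> ((2 * N) powr (1 / p) * 2 powr \<sigma>) * t powr \<sigma>" if "0 < t" for t
  proof -
    \<comment> \<open>On [t, 2 t] the weight s^(-\<sigma>) is least at 2 t and the K-functional at
      t. The interval has length t and 1/s is at least 1/(2 t) on it, which is where the factor in 2
      N comes from.\<close>
    define k where "k = (2 * t) powr (-\<sigma>) * K_functional A t x"
    have "0 \<le> k" using K_functional_nonneg[OF zero] \<open>0 < t\<close> by (simp add: k_def)
    have le: "k powr p / (2 * t) \<le> F s" if "s \<in> {t..2 * t}" for s
      unfolding F_def
    proof (intro frac_le powr_mono2)
      show "k \<le> s powr (-\<sigma>) * K_functional A s x"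
        unfolding k_def
        by (intro mult_mono powr_mono2' K_functional_mono zero K_functional_nonneg)
          (use \<open>0 < t\<close> \<open>0 < \<sigma>\<close> that in auto)
    qed (use \<open>0 < t\<close> that \<open>1 \<le> p\<close> \<open>0 \<le> k\<close> in auto)
    have "ennreal (k powr p / (2 * t)) * emeasure lborel {t..2 * t} =
        (\<integral>\<^sup>+s. ennreal (k powr p / (2 * t)) * indicator {t..2 * t} s \<partial>lborel)"
      by (simp add: nn_integral_cmult_indicator)
    also have "\<dots> \<le> J"
      unfolding J_def
      by (rule nn_integral_mono) (use le \<open>0 < t\<close> in \<open>auto simp: indicator_def ennreal_leI\<close>)
    also have "emeasure lborel {t..2 * t} = ennreal t" using \<open>0 < t\<close> by simp
    finally have "ennreal (k powr p / (2 * t) * t) \<le> ennreal N"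
      using \<open>0 < t\<close> by (subst ennreal_mult) (auto simp: J)
    then have "k powr p / (2 * t) * t \<le> N" using \<open>0 \<le> N\<close> by simp
    then have "k powr p \<le> 2 * N" using \<open>0 < t\<close> by simp
    then have "(k powr p) powr (1 / p) \<le> (2 * N) powr (1 / p)" using \<open>1 \<le> p\<close> by (intro powr_mono2) auto
    then have "k \<le> (2 * N) powr (1 / p)" using \<open>0 \<le> k\<close> \<open>1 \<le> p\<close> by (simp add: powr_powr)
    then have "k * (2 * t) powr \<sigma> \<le> (2 * N) powr (1 / p) * (2 * t) powr \<sigma>" by (intro mult_right_mono) auto
    also have "k * (2 * t) powr \<sigma> = K_functional A t x" using \<open>0 < t\<close> by (simp add: k_def powr_minus)
    finally show ?thesis using \<open>0 < t\<close> by (simp add: powr_mult)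
  qed
  then show ?thesis by blast
qed

text \<open>Near 0 the integral converges because \<sigma> < \<delta>; beyond 1 the competitor a = 0
  bounds the K-functional by the norm of x, and \<sigma> > 0 suffices.\<close>

lemma real_interpI:
  assumes zero: "(0, 0) \<in> A" and "0 < \<sigma>" "\<sigma> < \<delta>" "1 \<le> q"
    and K: "\<And>t. 0 < t \<Longrightarrow> t \<le> 1 \<Longrightarrow> K_functional A t x \<le> C * t powr \<delta>"
  shows "x \<in> real_interp A \<sigma> q"
proof -
  define F where "F s = (s powr (-\<sigma>) * K_functional A s x) powr q / s" for s
  define g where "g s = C powr q * s powr ((\<delta> - \<sigma>) * q - 1)" for s
  define h where "h s = norm x powr q * s powr (- \<sigma> * q - 1)" for s
  have KN: "K_functional A t x \<le> norm x" if "0 \<le> t" for t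
    using K_functional_le[OF zero that] by simp
  have Fg: "F s \<le> g s" if "0 < s" "s \<le> 1" for s
  proof -
    have "s powr (-\<sigma>) * K_functional A s x \<le> s powr (-\<sigma>) * (C * s powr \<delta>)"
      using K[OF that] by (intro mult_left_mono) auto
    also have "\<dots> = C * s powr (\<delta> - \<sigma>)" by (simp add: powr_diff powr_minus_divide)
    finally have "(s powr (-\<sigma>) * K_functional A s x) powr q \<le> (C * s powr (\<delta> - \<sigma>)) powr q"
      using K_functional_nonneg[OF zero] that assms by (intro powr_mono2) auto
    also have "\<dots> = C powr q * s powr ((\<delta> - \<sigma>) * q)"
    proof -
      have "0 \<le> C" using K[of 1] K_functional_nonneg[OF zero, of 1 x] by simp
      then show ?thesis by (simp add: powr_mult powr_powr)
    qed
    finally show ?thesis using that by (simp add: F_def g_def powr_diff divide_right_mono)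
  qed
  have Fh: "F s \<le> h s" if "0 < s" for s
  proof -
    have "(s powr (-\<sigma>) * K_functional A s x) powr q \<le> (s powr (-\<sigma>) * norm x) powr q"
      using K_functional_nonneg[OF zero] KN that assms by (intro powr_mono2 mult_left_mono mult_nonneg_nonneg) auto
    also have "\<dots> = norm x powr q * s powr (- \<sigma> * q)" by (simp add: powr_mult powr_powr)
    finally show ?thesis using that by (simp add: F_def h_def powr_diff divide_right_mono)
  qed
  have Ig: "(\<integral>\<^sup>+s. ennreal (g s) * indicator {0..1} s \<partial>lborel) < \<infinity>"
  proof -
    have "(g has_integral (C powr q * (1 powr ((\<delta> - \<sigma>) * q - 1 + 1) / ((\<delta> - \<sigma>) * q - 1 + 1)))) {0..1}"
      unfolding g_def
      by (intro has_integral_mult_right has_integral_powr_from_0) (use assms in auto)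
    from nn_integral_has_integral_lebesgue'[OF _ this] show ?thesis by (simp add: g_def)
  qed
  have Ih: "(\<integral>\<^sup>+s. ennreal (h s) * indicator {1..} s \<partial>lborel) < \<infinity>"
  proof -
    have "(h has_integral (norm x powr q * (- (1 powr (- \<sigma> * q - 1 + 1)) / (- \<sigma> * q - 1 + 1)))) {1..}"
      unfolding h_def
      by (intro has_integral_mult_right has_integral_powr_to_inf) (use assms in auto)
    from nn_integral_has_integral_lebesgue'[OF _ this] show ?thesis by (simp add: h_def)
  qed
  have "(\<integral>\<^sup>+s\<in>{0<..}. ennreal (F s) \<partial>lborel) \<le>
      (\<integral>\<^sup>+s. ennreal (g s) * indicator {0..1} s + ennreal (h s) * indicator {1..} s \<partial>lborel)"
    by (rule nn_integral_mono)
      (use Fg Fh in \<open>auto simp: indicator_def ennreal_leI not_le intro: add_increasing2\<close>)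
  also have "\<dots> = (\<integral>\<^sup>+s. ennreal (g s) * indicator {0..1} s \<partial>lborel)
      + (\<integral>\<^sup>+s. ennreal (h s) * indicator {1..} s \<partial>lborel)"
    by (rule nn_integral_add) (simp_all add: g_def h_def)
  also have "\<dots> < \<infinity>" using Ig Ih by simp
  finally show ?thesis by (simp add: real_interp_def F_def)
qed

text \<open>For every a = A^-1 b, A (A + z)^-1 x is the sum of A (A + z)^-1 (x - a) and (A + z)^-1
  b. Its norm is thus at most (1 + K) |x - a| + K |b| / (1 + |z|), and the infimum over a gives the
  K-functional at t = 1 / (1 + |z|).\<close>

lemma real_interp_imp_resolvent_decay:
  assumes A: "A \<in> sectorial \<theta>" and fam: "resolvent_family (res A) \<theta> K"
    and x: "x \<in> real_interp A \<sigma> p" and "0 < \<sigma>" "1 \<le> p"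
  shows "\<exists>C. \<forall>z\<in>sector \<theta>. norm (x - z *\<^sub>C res A z x) \<le> C * (1 + cmod z) powr (-\<sigma>)"
proof -
  interpret resolvent_family "res A" \<theta> K by fact
  have zero: "(0, 0) \<in> A" using sectorialD(1)[OF A] by (simp add: linear_op_def)
  obtain C where C: "\<And>t. 0 < t \<Longrightarrow> K_functional A t x \<le> C * t powr \<sigma>"
    using real_interp_imp_K_functional_le[OF x zero \<open>0 < \<sigma>\<close> \<open>1 \<le> p\<close>] by blast
  have "norm (x - z *\<^sub>C res A z x) \<le> ((1 + K) * C) * (1 + cmod z) powr (-\<sigma>)" if z: "z \<in> sector \<theta>" for z
  proof -
    define t where "t = 1 / (1 + cmod z)"
    have "0 < t" by (simp add: t_def add_pos_nonneg)
    have "norm (x - z *\<^sub>C res A z x) / (1 + K) \<le> K_functional A t x"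
    proof (rule le_K_functional[OF zero])
      fix a b assume "(a, b) \<in> A"
      then have a: "a = res A 0 b" by (simp add: sectorial_graph[OF A])
      have "x - z *\<^sub>C res A z x = ((x - a) - z *\<^sub>C res A z (x - a)) + (a - z *\<^sub>C res A z a)"
        by (simp add: blinfun.diff_right scaleC.diff_right)
      also have "a - z *\<^sub>C res A z a = res A z b"
        using identity_apply[OF z zero_in_sector, of b] by (simp add: a scaleC.minus_left algebra_simps)
      finally have "norm (x - z *\<^sub>C res A z x) =
          norm (((x - a) - z *\<^sub>C res A z (x - a)) + res A z b)" by (rule arg_cong)
      then have "norm (x - z *\<^sub>C res A z x) \<le>
          (norm (x - a) + norm (z *\<^sub>C res A z (x - a))) + norm (res A z b)"
        using norm_triangle_ineq[of "(x - a) - z *\<^sub>C res A z (x - a)" "res A z b"]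
          norm_triangle_ineq4[of "x - a" "z *\<^sub>C res A z (x - a)"] by linarith
      also have "norm (z *\<^sub>C res A z (x - a)) \<le> K * norm (x - a)"
      proof -
        have "norm (z *\<^sub>C res A z (x - a)) \<le> (cmod z * norm (res A z)) * norm (x - a)"
          unfolding norm_scaleC mult.assoc by (intro mult_left_mono norm_blinfun) auto
        also have "\<dots> \<le> ((1 + cmod z) * norm (res A z)) * norm (x - a)" by (intro mult_right_mono) auto
        also have "\<dots> \<le> K * norm (x - a)" by (intro mult_right_mono bound z) auto
        finally show ?thesis .
      qed
      also have "norm (res A z b) \<le> (K * t) * norm b"
        using norm_R_le[OF z] by (intro order_trans[OF norm_blinfun] mult_right_mono) (auto simp: t_def)
      also have "(norm (x - a) + K * norm (x - a)) + (K * t) * norm b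
          \<le> (1 + K) * (norm (x - a) + t * (norm a + norm b))"
        using K_nonneg \<open>0 < t\<close> by (simp add: algebra_simps add_nonneg_nonneg)
      finally show "norm (x - z *\<^sub>C res A z x) / (1 + K) \<le> norm (x - a) + t * (norm a + norm b)"
        using K_nonneg by (simp add: pos_divide_le_eq mult.commute add_pos_nonneg)
    qed
    also have "\<dots> \<le> C * t powr \<sigma>" by (rule C) fact
    also have "t powr \<sigma> = (1 + cmod z) powr (-\<sigma>)"
      by (simp add: t_def powr_minus_divide powr_divide)
    finally show ?thesis using K_nonneg by (simp add: pos_divide_le_eq mult_ac add_pos_nonneg)
  qed
  then show ?thesis by blast
qed

text \<open>The competitor in the K-functional is a = s (A + s)^-1 x with s = 1/t. Then x - a is Q =
  A (A + s)^-1 x and A a = s Q, so t |A a| is just |Q|.\<close>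

lemma resolvent_decay_imp_real_interp:
  assumes A: "A \<in> sectorial \<theta>" and fam: "resolvent_family (res A) \<theta> K"
    and "0 \<le> C" and C: "\<And>z. z \<in> sector \<theta> \<Longrightarrow> norm (x - z *\<^sub>C res A z x) \<le> C * (1 + cmod z) powr (-\<delta>)"
    and "0 < \<sigma>" "\<sigma> < \<delta>" "\<delta> < 1" "1 \<le> q"
  shows "x \<in> real_interp A \<sigma> q"
proof (rule real_interpI[OF _ \<open>0 < \<sigma>\<close> \<open>\<sigma> < \<delta>\<close> \<open>1 \<le> q\<close>])
  interpret resolvent_family "res A" \<theta> K by fact
  have lin: "linear_op A" by (rule sectorialD(1)[OF A])
  then show "(0, 0) \<in> A" by (simp add: linear_op_def)
  fix t :: real assume t: "0 < t" "t \<le> 1"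
  define s where "s = complex_of_real (1 / t)"
  have s: "s \<in> sector \<theta>" "cmod s = 1 / t"
    using t angle unfolding s_def by (auto intro: of_real_in_sector simp del: of_real_divide simp: norm_divide)
  define Q where "Q = x - s *\<^sub>C res A s x"
  have "(s *\<^sub>C res A s x, s *\<^sub>C Q) \<in> A"
    using lin resolvent_mem[OF subsetD[OF sectorialD(2)[OF A] s(1)], of x] unfolding linear_op_def Q_def by blast
  then have "K_functional A t x \<le> norm Q + t * (norm (s *\<^sub>C res A s x) + norm (s *\<^sub>C Q))"
    using K_functional_le[of "s *\<^sub>C res A s x" "s *\<^sub>C Q" A t x] t by (simp add: Q_def)
  also have "\<dots> = 2 * norm Q + norm (res A s x)"
    using t by (simp add: norm_scaleC s(2) field_simps)
  also have "norm (res A s x) \<le> K / (1 + 1 / t) * norm x"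
    using norm_R_le[OF s(1)] s(2) by (intro order_trans[OF norm_blinfun] mult_right_mono) auto
  also have "K / (1 + 1 / t) * norm x \<le> (K * norm x) * t powr \<delta>"
  proof -
    \<comment> \<open>The term t |a| is of order t, which is below t^\<delta> since
      \<open>t \<le> 1\<close> and \<open>\<delta> < 1\<close>.\<close>
    have "1 / (1 + 1 / t) \<le> t" using t by (simp add: field_simps)
    also have "t \<le> t powr \<delta>" using t \<open>\<delta> < 1\<close> powr_mono'[of \<delta> 1 t] by simp
    finally have "(K * norm x) * (1 / (1 + 1 / t)) \<le> (K * norm x) * t powr \<delta>"
      using K_nonneg by (intro mult_left_mono) auto
    then show ?thesis by simp
  qed
  also have "norm Q \<le> C * t powr \<delta>"
  proof -
    have "norm Q \<le> C * (1 + 1 / t) powr (-\<delta>)" using C[OF s(1)] by (simp add: Q_def s(2))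
    also have "(1 + 1 / t) powr (-\<delta>) \<le> (1 / t) powr (-\<delta>)"
      using t assms by (intro powr_mono2') auto
    also have "(1 / t) powr (-\<delta>) = t powr \<delta>" using t by (simp add: powr_minus powr_divide)
    finally show ?thesis using \<open>0 \<le> C\<close> by (simp add: mult_left_mono)
  qed
  finally show "K_functional A t x \<le> (2 * C + K * norm x) * t powr \<delta>" by (simp add: algebra_simps)
qed


section \<open>The closure of the sum\<close>

theorem theorem2p1:
  fixes A B :: "'a :: complex_banach op" and \<theta>\<^sub>A \<theta>\<^sub>B :: real
  assumes angles: "0 < \<theta>\<^sub>A" "\<theta>\<^sub>A < pi" "0 < \<theta>\<^sub>B" "\<theta>\<^sub>B < pi"
    and A: "A \<in> sectorial \<theta>\<^sub>A"
    and B: "B \<in> sectorial \<theta>\<^sub>B"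
    and commuting: "resolvent_commuting A B"
    and angle_less: "\<theta>\<^sub>A > \<theta>\<^sub>B"
    and parabolic: "\<theta>\<^sub>A + \<theta>\<^sub>B > pi"
    and dense: "closure {a + b | a b. a \<in> Domain A \<and> b \<in> Domain B} = UNIV"
  shows "closable_op (op_add A B) \<and>
    (\<forall>y. \<exists>!x. (x, y) \<in> closure (op_add A B)) \<and>
    (\<forall>x y. (x, y) \<in> closure (op_add A B) \<longrightarrow>
       (\<forall>q\<ge>1. x \<in> (\<Inter>\<theta>\<in>{0<..<1}. real_interp A \<theta> q \<inter> real_interp B \<theta> q)) \<and>
       (\<exists>I. has_Gamma_integral (\<lambda>z. res A (- z) (res B z y)) I \<theta>\<^sub>B \<and>
            x = (1 / (2 * of_real pi * \<i>)) *\<^sub>C I) \<and>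
       ((\<exists>p\<ge>1. y \<in> (\<Union>\<theta>\<in>{0<..<1}. real_interp A \<theta> p \<union> real_interp B \<theta> p)) \<longrightarrow>
          x \<in> Domain A \<inter> Domain B)) \<and>
    (bounded_Hinf_calculus \<theta>\<^sub>A A \<longrightarrow>
       (\<forall>x y. (x, y) \<in> closure (op_add A B) \<longrightarrow> x \<in> Domain A \<inter> Domain B) \<and>
       closure (op_add A B) = op_add A B)"
proof -
  note linA = sectorialD(1)[OF A] and linB = sectorialD(1)[OF B]
  note subA = subsetD[OF sectorialD(2)[OF A]] and subB = subsetD[OF sectorialD(2)[OF B]]
  obtain K\<^sub>A where FA: "resolvent_family (res A) \<theta>\<^sub>A K\<^sub>A"
    by (rule sectorial_resolvent_family[OF A angles(1,2)])
  obtain K\<^sub>B where FB: "resolvent_family (res B) \<theta>\<^sub>B K\<^sub>B"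
    by (rule sectorial_resolvent_family[OF B angles(3,4)])
  have comm: "res A z o\<^sub>L res B w = res B w o\<^sub>L res A z" if "z \<in> sector \<theta>\<^sub>A" "w \<in> sector \<theta>\<^sub>B" for z w
  proof -
    obtain \<zeta> \<mu> where \<zeta>: "\<zeta> \<in> resolvent_set (op_uminus A)" and \<mu>: "\<mu> \<in> resolvent_set (op_uminus B)"
      and "res A \<zeta> o\<^sub>L res B \<mu> = res B \<mu> o\<^sub>L res A \<zeta>"
      using commuting by (auto simp: resolvent_commuting_def)
    then have "res B \<mu> o\<^sub>L res A z = res A z o\<^sub>L res B \<mu>"
      by (intro res_commute[OF res_clinear[OF linB \<mu>] \<zeta> _ subA[OF that(1)]]) simp
    then show ?thesis
      by (intro res_commute[OF res_clinear[OF linA subA[OF that(1)]] \<mu> _ subB[OF that(2)]]) simp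
  qed
  have pairI: "commuting_pair (res A) (res B) \<theta>\<^sub>A K\<^sub>A \<theta>\<^sub>B K\<^sub>B \<phi>"
    if "0 < \<phi>" "\<phi> < pi" "\<phi> \<le> \<theta>\<^sub>B" "pi - \<phi> \<le> \<theta>\<^sub>A" for \<phi>
    by (intro commuting_pair.intro commuting_pair_axioms.intro FA FB comm that)
  interpret pair: commuting_pair "res A" "res B" \<theta>\<^sub>A K\<^sub>A \<theta>\<^sub>B K\<^sub>B \<theta>\<^sub>B
    by (rule pairI) (use angles parabolic in auto)
  interpret sw: commuting_pair "res B" "res A" \<theta>\<^sub>B K\<^sub>B \<theta>\<^sub>A K\<^sub>A "pi - \<theta>\<^sub>B"
    by (rule pair.swap)
  define S where "S = sum_inverse (res A) (res B) \<theta>\<^sub>B"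
  have S_swap: "sum_inverse (res B) (res A) (pi - \<theta>\<^sub>B) = S"
    unfolding S_def by (rule pair.S_swap)

  have add_iff: "(x, y) \<in> op_add A B \<longleftrightarrow> (\<exists>a b. y = a + b \<and> x = res A 0 a \<and> x = res B 0 b)" for x y
    by (auto simp: op_add_def sectorial_graph[OF A] sectorial_graph[OF B])
  have sum_A: "(S y, y) \<in> op_add A B" if "S y = res A 0 w" for y w
    using pair.S_eq_RB_if_RA[of y w] that unfolding add_iff S_def
    by (intro exI[of _ w] exI[of _ "y - w"]) auto
  have sum_B: "(S y, y) \<in> op_add A B" if "S y = res B 0 w" for y w
    using sw.S_eq_RB_if_RA[of y w] that unfolding add_iff S_swap
    by (intro exI[of _ "y - w"] exI[of _ w]) auto
  have range_eq: "{a + b | a b. a \<in> Domain A \<and> b \<in> Domain B} = {res A 0 a + res B 0 b | a b. True}"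
    by (auto simp: Domain_iff sectorial_graph[OF A] sectorial_graph[OF B])
  have dense': "closure {res A 0 a + res B 0 b | a b. True} = UNIV"
    using dense unfolding range_eq .
  have sum_range: "(S y, y) \<in> op_add A B" if y: "y = res A 0 a + res B 0 b" for y a b
  proof (rule sum_A)
    have "S (res B 0 b) = res A 0 (res B 0 b - S b)"
      unfolding S_swap[symmetric] by (rule sw.S_eq_RB_if_RA) (simp add: sw.S_RA)
    then show "S y = res A 0 (S a + (res B 0 b - S b))"
      by (simp add: y blinfun.add_right pair.S_RA[folded S_def])
  qed
  have cl: "closure (op_add A B) = {(x, y). x = S y}"
  proof (intro equalityI)
    have "closed {(x, y). x = S y}"
      unfolding case_prod_beta by (intro closed_Collect_eq continuous_intros)
    moreover have "op_add A B \<subseteq> {(x, y). x = S y}"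
      using pair.S_add_eq[folded S_def] by (auto simp: add_iff)
    ultimately show "closure (op_add A B) \<subseteq> {(x, y). x = S y}" by (intro closure_minimal)
    \<comment> \<open>Density enters here: y is approximated from D(A) + D(B), and boundedness of S
      makes the graph points converge.\<close>
    have "(S y, y) \<in> closure (op_add A B)" for y
    proof -
      have "y \<in> closure {res A 0 a + res B 0 b | a b. True}" unfolding dense' by simp
      then obtain Y where Y: "\<And>n::nat. \<exists>a b. Y n = res A 0 a + res B 0 b" and lim: "Y \<longlonglongrightarrow> y"
        unfolding closure_sequential by auto
      have "(S (Y n), Y n) \<in> op_add A B" for n using Y[of n] sum_range by blast
      moreover have "(\<lambda>n. (S (Y n), Y n)) \<longlonglongrightarrow> (S y, y)" by (intro tendsto_intros lim)
      ultimately show ?thesis unfolding closure_sequential by (intro exI[of _ "\<lambda>n. (S (Y n), Y n)"]) auto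
    qed
    then show "{(x, y). x = S y} \<subseteq> closure (op_add A B)" by auto
  qed
  have S_clin: "S (c *\<^sub>C y) = c *\<^sub>C S y" for c y
    using pair.S_clinear by (simp add: L_spaceD S_def)
  have "linear_op {(x, y). x = S y}"
    unfolding linear_op_def
  proof (intro conjI allI impI)
    \<comment> \<open>The relation reads x = S y, so this is injectivity of S.\<close>
    show "single_valued {(x, y). x = S y}"
    proof (rule single_valuedI)
      fix x y z assume "(x, y) \<in> {(x, y). x = S y}" "(x, z) \<in> {(x, y). x = S y}"
      then have "S (y - z) = 0" by (simp add: blinfun.diff_right)
      then have "y - z = 0" unfolding S_def by (rule pair.S_inj)
      then show "y = z" by simp
    qed
  qed (auto simp: blinfun.add_right S_clin)
  then have closable: "closable_op (op_add A B)"
    unfolding closable_op_def cl using linear_op_add[OF linA linB] by simp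

  have interp: "S y \<in> real_interp A \<sigma> q \<inter> real_interp B \<sigma> q"
    if \<sigma>: "0 < \<sigma>" "\<sigma> < 1" and "1 \<le> q" for y \<sigma> q
  proof -
    \<comment> \<open>A decay exponent strictly above \<sigma> makes the interpolation integral
      converge at 0.\<close>
    obtain \<delta> where \<delta>: "\<sigma> < \<delta>" "\<delta> < 1" using dense_order_class.dense[OF \<sigma>(2)] by blast
    then have "0 < \<delta>" using \<sigma> by simp
    obtain C where "0 \<le> C" "\<And>s. s \<in> sector \<theta>\<^sub>A \<Longrightarrow> norm (S y - s *\<^sub>C res A s (S y)) \<le> C * (1 + cmod s) powr (-\<delta>)"
      using pair.norm_S_minus_resolvent_le[OF \<open>0 < \<delta>\<close> \<delta>(2), of y] unfolding S_def by metis
    then have 1: "S y \<in> real_interp A \<sigma> q"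
      by (rule resolvent_decay_imp_real_interp[OF A FA]) (use \<sigma> \<delta> \<open>1 \<le> q\<close> in auto)
    obtain C where "0 \<le> C" "\<And>s. s \<in> sector \<theta>\<^sub>B \<Longrightarrow> norm (S y - s *\<^sub>C res B s (S y)) \<le> C * (1 + cmod s) powr (-\<delta>)"
      using sw.norm_S_minus_resolvent_le[OF \<open>0 < \<delta>\<close> \<delta>(2), of y] unfolding S_swap by metis
    then have 2: "S y \<in> real_interp B \<sigma> q"
      by (rule resolvent_decay_imp_real_interp[OF B FB]) (use \<sigma> \<delta> \<open>1 \<le> q\<close> in auto)
    from 1 2 show ?thesis by simp
  qed

  have formula: "\<exists>I. has_Gamma_integral (\<lambda>z. res A (- z) (res B z y)) I \<theta>\<^sub>B \<and>
      S y = (1 / (2 * of_real pi * \<i>)) *\<^sub>C I" for y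
  proof (intro exI conjI)
    show "has_Gamma_integral (\<lambda>z. res A (- z) (res B z y))
        (Gamma_integral \<theta>\<^sub>B (\<lambda>z. res A (- z) o\<^sub>L res B z) y) \<theta>\<^sub>B"
      using has_Gamma_integral_linear[OF has_Gamma_integral[OF pair.S_decay]
          blinfun.bounded_linear_left, of y]
      by (simp add: blinfun_apply_scaleC)
  qed (simp add: S_def sum_inverse_def blinfun_apply_scaleC)

  have regular: "(S y, y) \<in> op_add A B"
    if y: "y \<in> real_interp A \<sigma> p \<union> real_interp B \<sigma> p" and \<sigma>: "0 < \<sigma>" and p: "1 \<le> p" for y \<sigma> p
    using y
  proof
    assume "y \<in> real_interp A \<sigma> p"
    from real_interp_imp_resolvent_decay[OF A FA this \<sigma> p]
    obtain C where C: "\<And>z. z \<in> sector \<theta>\<^sub>A \<Longrightarrow> norm (y - z *\<^sub>C res A z y) \<le> C * (1 + cmod z) powr (-\<sigma>)"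
      by blast
    obtain w where "S y = res A 0 w"
      unfolding S_def by (rule pair.S_in_range_RA[OF \<sigma> C])
    then show ?thesis by (rule sum_A)
  next
    assume "y \<in> real_interp B \<sigma> p"
    from real_interp_imp_resolvent_decay[OF B FB this \<sigma> p]
    obtain C where C: "\<And>z. z \<in> sector \<theta>\<^sub>B \<Longrightarrow> norm (y - z *\<^sub>C res B z y) \<le> C * (1 + cmod z) powr (-\<sigma>)"
      by blast
    obtain w where "S y = res B 0 w"
      unfolding S_swap[symmetric] by (rule sw.S_in_range_RA[OF \<sigma> C])
    then show ?thesis by (rule sum_B)
  qed

  have maximal: "(S y, y) \<in> op_add A B" if calc: "bounded_Hinf_calculus \<theta>\<^sub>A A" for y
  proof -
    \<comment> \<open>The reflected path of the calculus has this angle; it is acute because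
      \<open>angle_less\<close> and \<open>parabolic\<close> give \<open>\<theta>\<^sub>A\<close> >
      pi/2.\<close>
    define \<psi> where "\<psi> = pi - \<theta>\<^sub>A"
    have psi: "0 < \<psi>" "\<psi> < pi / 2" "\<psi> \<le> \<theta>\<^sub>B" "pi - \<psi> \<le> \<theta>\<^sub>A" "\<theta>\<^sub>A = pi - \<psi>"
      using angles angle_less parabolic by (auto simp: \<psi>_def)
    interpret rot: commuting_pair "res A" "res B" \<theta>\<^sub>A K\<^sub>A \<theta>\<^sub>B K\<^sub>B \<psi>
      by (rule pairI) (use psi angles in auto)
    have S_rot: "sum_inverse (res A) (res B) \<psi> = S"
      unfolding S_def by (rule pair.S_rotate) (use psi in auto)
    obtain C where "0 \<le> C" "\<And>w. norm (S w) \<le> C * norm (res A 0 w)"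
      using rot.norm_S_le_norm_RA[OF refl psi(5,2) calc] unfolding S_rot by metis
    then obtain u where "S y = res B 0 u"
      using pair.S_in_range_RB[folded S_def, OF _ _ dense'] by metis
    then show ?thesis by (rule sum_B)
  qed

  have dom: "x \<in> Domain A \<inter> Domain B" if "(x, y) \<in> op_add A B" for x y
    using that by (auto simp: Domain_op_add[symmetric])
  have closed: "closure (op_add A B) = op_add A B" if "bounded_Hinf_calculus \<theta>\<^sub>A A"
    using maximal[OF that] closure_subset[of "op_add A B"] by (auto simp: cl)
  show ?thesis
  proof (intro conjI allI impI)
    show "closable_op (op_add A B)" by (rule closable)
    show "\<exists>!x. (x, y) \<in> closure (op_add A B)" for y by (simp add: cl)
    fix x y
    {
      assume "(x, y) \<in> closure (op_add A B)"
      then have x: "x = S y" by (simp add: cl)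
      show "x \<in> (\<Inter>\<theta>\<in>{0<..<1}. real_interp A \<theta> q \<inter> real_interp B \<theta> q)" if "1 \<le> q" for q
        using interp that unfolding x by auto
      show "\<exists>I. has_Gamma_integral (\<lambda>z. res A (- z) (res B z y)) I \<theta>\<^sub>B \<and>
          x = (1 / (2 * of_real pi * \<i>)) *\<^sub>C I"
        unfolding x by (rule formula)
      assume "\<exists>p\<ge>1. y \<in> (\<Union>\<theta>\<in>{0<..<1}. real_interp A \<theta> p \<union> real_interp B \<theta> p)"
      then obtain p \<sigma> where "1 \<le> p" "0 < \<sigma>" "y \<in> real_interp A \<sigma> p \<union> real_interp B \<sigma> p" by auto
      then show "x \<in> Domain A \<inter> Domain B"
        unfolding x by (intro dom[OF regular])
    }
    assume calc: "bounded_Hinf_calculus \<theta>\<^sub>A A"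
    show "closure (op_add A B) = op_add A B" by (rule closed[OF calc])
    assume "(x, y) \<in> closure (op_add A B)"
    then show "x \<in> Domain A \<inter> Domain B" using dom[OF maximal[OF calc]] by (simp add: cl)
  qed
qed

end
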